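(* Let $D\subset\mathbb{R}^2$ be the open unit disk and let $\alpha\in(-1,0]$. Let $(u_n)_{n}\subset H^1_0(D)$ be a sequence such that $\int_D|\nabla u_n|^2\,dx\le 1$ for all $n$ and $u_n\rightharpoonup 0$ weakly in $H^1_0(D)$. Then $$\limsup_{n\to\infty}\int_D |x|^{2\alpha}e^{4\pi(1+\alpha)u_n^2}\,dx\le \frac{\pi(1+e)}{1+\alpha}.$$ *)

theory Defs
  imports "HOL-Analysis.Analysis"
begin

definition pgrad :: "(real^2 \<Rightarrow> real) \<Rightarrow> real^2 \<Rightarrow> real^2" where
  "pgrad f x = (\<chi> i. frechet_derivative f (at x) (axis i 1))"

primrec Ck :: "nat \<Rightarrow> (real^2 \<Rightarrow> real) \<Rightarrow> bool" where
  "Ck 0 f = continuous_on UNIV f"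
| "Ck (Suc k) f = (continuous_on UNIV f \<and> f differentiable_on UNIV \<and>
      (\<forall>i. Ck k (\<lambda>x. frechet_derivative f (at x) (axis i 1))))"

definition smooth_fun :: "(real^2 \<Rightarrow> real) \<Rightarrow> bool" where
  "smooth_fun f = (\<forall>k. Ck k f)"

definition test_fun :: "(real^2) set \<Rightarrow> (real^2 \<Rightarrow> real) \<Rightarrow> bool" where
  "test_fun D f = (smooth_fun f \<and> compact (closure {x. f x \<noteq> 0})
                    \<and> closure {x. f x \<noteq> 0} \<subseteq> D)"

text \<open>H10_grad D u g: u belongs to H^1_0(D) (closure of C_c^infinity(D) in the H^1 norm),
  and g is its (weak) gradient. Functions are extended by zero outside D.\<close>
definition H10_grad :: "(real^2) set \<Rightarrow> (real^2 \<Rightarrow> real) \<Rightarrow> (real^2 \<Rightarrow> real^2) \<Rightarrow> bool" where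
  "H10_grad D u g = (u \<in> borel_measurable lebesgue \<and> g \<in> borel_measurable lebesgue \<and>
     (\<exists>\<phi>::nat \<Rightarrow> real^2 \<Rightarrow> real. (\<forall>k. test_fun D (\<phi> k)) \<and>
        ((\<lambda>k. \<integral>\<^sup>+ x. ennreal ((\<phi> k x - u x)^2) \<partial>lebesgue) \<longlonglongrightarrow> 0) \<and>
        ((\<lambda>k. \<integral>\<^sup>+ x. ennreal ((norm (pgrad (\<phi> k) x - g x))^2) \<partial>lebesgue) \<longlonglongrightarrow> 0)))"

definition in_H10 :: "(real^2) set \<Rightarrow> (real^2 \<Rightarrow> real) \<Rightarrow> bool" where
  "in_H10 D u = (\<exists>g. H10_grad D u g)"

text \<open>H^1 norm (independent of the choice of gradient, which is unique a.e.).\<close>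
definition H1_norm :: "(real^2) set \<Rightarrow> (real^2 \<Rightarrow> real) \<Rightarrow> real" where
  "H1_norm D u = sqrt ((\<integral>x. (u x)^2 \<partial>lebesgue)
       + (\<integral>x. (norm ((SOME g. H10_grad D u g) x))^2 \<partial>lebesgue))"

definition H10_dual :: "(real^2) set \<Rightarrow> ((real^2 \<Rightarrow> real) \<Rightarrow> real) \<Rightarrow> bool" where
  "H10_dual D L = ((\<forall>u v a b. in_H10 D u \<longrightarrow> in_H10 D v \<longrightarrow>
        L (\<lambda>x. a * u x + b * v x) = a * L u + b * L v) \<and>
     (\<exists>C. \<forall>u. in_H10 D u \<longrightarrow> \<bar>L u\<bar> \<le> C * H1_norm D u))"

definition H10_weak_conv :: "(real^2) set \<Rightarrow> (nat \<Rightarrow> real^2 \<Rightarrow> real) \<Rightarrow> (real^2 \<Rightarrow> real) \<Rightarrow> bool" where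
  "H10_weak_conv D u w = (\<forall>L. H10_dual D L \<longrightarrow> (\<lambda>n. L (u n)) \<longlonglongrightarrow> L w)"

end

theory Submission
  imports Defs "HOL-Real_Asymp.Real_Asymp"
begin

text \<open>
  Symmetrisation is carried out on level sets only. The Brunn--Minkowski inequality applied to the
  superlevel sets of \<open>\<bar>\<phi>\<bar>\<close> and a small disc gives, through the layer-cake formula, the integrated
  isoperimetric inequality, and with Cauchy--Schwarz on thin shells the isocapacitary bound
  \<open>4 \<pi> (s - t)\<^sup>2 \<le> E ln (m t / m s)\<close>, where \<open>m\<close> is the distribution function and \<open>E\<close> the Dirichlet
  energy between the levels \<open>t\<close> and \<open>s\<close>. In the variables \<open>T = (1 + \<alpha>) ln (\<pi> / m)\<close> and
  \<open>y = sqrt (4 \<pi> (1 + \<alpha>)) t\<close> this says that the interpolated path \<open>T \<mapsto> y\<close> has energy at most 1,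
  and the bathtub principle for the decreasing weight bounds the functional by
  \<open>\<pi> / (1 + \<alpha>)\<close> times \<open>\<integral> exp (y\<^sup>2 - T) dT\<close>, independently of \<open>\<alpha>\<close>. Following Carleson and Chang, if
  \<open>y\<close> is small on a long initial interval, this integral is at most \<open>1 + e\<close> up to a small error: the
  first point \<open>a\<close> with \<open>y\<^sup>2 \<ge> a - 2 ln a\<close> leaves little energy for the tail, which the radial Onofri
  inequality bounds by \<open>e\<close>. Smallness of \<open>y\<close> amounts to smallness in \<open>L\<^sup>2\<close>, which weak convergence
  yields by Rellich compactness.
\<close>

section \<open>Brunn--Minkowski inequality in the plane\<close>

text \<open>The two summands of \<open>1 + e\<close> have separate origins: 1 is the integral of exp
  (- T) over the stretch where the path is nearly zero, and e bounds a late concentration that uses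
  up the energy. Working with level sets alone means that the rearranged function is never built or
  differentiated: the path passes through finitely many levels \<open>k * \<eta>\<close>, and the
  price, a factor exp (c (2 C \<eta> + \<eta>^2)), tends to 1 with the mesh for each fixed bounded
  function. The factor 1 + \<alpha> in T is forced by the weight: a centred disc of area m has
  weighted area pi / (1 + \<alpha>) times exp (- T). The barrier t - 2 ln t for y^2 balances two
  demands: below it exp (y^2 - t) is at most 1 / t^2, integrable with a small tail; at a point
  reaching it, all but a fraction 2 ln t / t of the energy is already spent. The level set argument
  asks for C1 functions of energy at most 1. Smooth approximants of a Sobolev function may exceed
  this slightly, so they are rescaled, and Fatou's lemma passes to the limit.\<close>

lemma layer_cake:
  fixes f :: "'a \<Rightarrow> real" and S :: "real set"
  assumes "sigma_finite_measure M" and [measurable]: "f \<in> borel_measurable M" "S \<in> sets borel"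
  shows "(\<integral>\<^sup>+ x. emeasure lborel (S \<inter> {..<f x}) \<partial>M)
       = (\<integral>\<^sup>+ t\<in>S. emeasure M {x \<in> space M. t < f x} \<partial>lborel)"
proof -
  interpret sigma_finite_measure M by fact
  interpret pair_sigma_finite M lborel
    by (simp add: pair_sigma_finite_def assms(1) lborel.sigma_finite_measure_axioms)
  have "(\<integral>\<^sup>+ x. emeasure lborel (S \<inter> {..<f x}) \<partial>M)
      = (\<integral>\<^sup>+ x. (\<integral>\<^sup>+ t. indicator S t * indicator {t. t < f x} t \<partial>lborel) \<partial>M)"
    by (intro nn_integral_cong) (auto simp: nn_integral_indicator[symmetric] simp del: nn_integral_indicator
        intro!: nn_integral_cong split: split_indicator)
  also have "\<dots> = (\<integral>\<^sup>+ t. (\<integral>\<^sup>+ x. indicator S t * indicator {t. t < f x} t \<partial>M) \<partial>lborel)"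
    by (rule Fubini'[symmetric]) measurable
  also have "\<dots> = (\<integral>\<^sup>+ t. (\<integral>\<^sup>+ x. indicator S t * indicator {x \<in> space M. t < f x} x \<partial>M) \<partial>lborel)"
    by (intro nn_integral_cong) (auto split: split_indicator)
  also have "\<dots> = (\<integral>\<^sup>+ t\<in>S. emeasure M {x \<in> space M. t < f x} \<partial>lborel)"
    by (subst nn_integral_cmult) (auto simp: mult.commute)
  finally show ?thesis .
qed

lemma layer_cake_interval:
  fixes g :: "'a::euclidean_space \<Rightarrow> real"
  assumes "g \<in> borel_measurable borel"
  shows "(\<integral>\<^sup>+ t\<in>{a<..<b}. emeasure lborel {x. t < g x} \<partial>lborel) = (\<integral>\<^sup>+ x. ennreal (max 0 (min b (g x) - a)) \<partial>lborel)"
proof -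
  have "(\<integral>\<^sup>+ t\<in>{a<..<b}. emeasure lborel {x \<in> space lborel. t < g x} \<partial>lborel)
      = (\<integral>\<^sup>+ x. emeasure lborel ({a<..<b} \<inter> {..<g x}) \<partial>lborel)"
    using assms by (intro layer_cake[symmetric] lborel.sigma_finite_measure_axioms) auto
  also have "\<dots> = (\<integral>\<^sup>+ x. ennreal (max 0 (min b (g x) - a)) \<partial>lborel)"
  proof (intro nn_integral_cong)
    fix x
    have "{a<..<b} \<inter> {..<g x} = {a<..<min b (g x)}" by auto
    then show "emeasure lborel ({a<..<b} \<inter> {..<g x}) = ennreal (max 0 (min b (g x) - a))"
      by (cases "a \<le> min b (g x)") (auto simp: max_def)
  qed
  finally show ?thesis by simp
qed

text \<open>Translate \<open>X\<close> by a nearly minimal point of \<open>Y\<close> and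
  \<open>Y\<close> by a nearly maximal point of \<open>X\<close>: up to small pieces the copies lie
  in \<open>W\<close> on opposite sides of one point, so their lengths add. Allowing any Borel
  \<open>W\<close> that contains the sums avoids the question whether the sumset is Borel.\<close>

lemma brunn_minkowski_line:
  fixes X Y W :: "real set"
  assumes X: "X \<in> sets borel" "bounded X" "X \<noteq> {}" and Y: "Y \<in> sets borel" "bounded Y" "Y \<noteq> {}"
    and W: "W \<in> sets borel" "\<And>x y. x \<in> X \<Longrightarrow> y \<in> Y \<Longrightarrow> x + y \<in> W"
  shows "emeasure lborel X + emeasure lborel Y \<le> emeasure lborel W"
proof (rule ennreal_le_epsilon)
  fix \<epsilon> :: real assume "0 < \<epsilon>"
  note [measurable] = X(1) Y(1) W(1)
  \<comment> \<open>The extrema need not be attained; cutting at points within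
    \<open>\<epsilon> / 2\<close> of them loses at most \<open>\<epsilon> / 2\<close> of length from
    each set.\<close>
  obtain x where x: "x \<in> X" "Sup X - \<epsilon> / 2 < x"
    using less_cSupD[of X "Sup X - \<epsilon> / 2"] X(3) \<open>0 < \<epsilon>\<close> by auto
  obtain y where y: "y \<in> Y" "y < Inf Y + \<epsilon> / 2"
    using cInf_lessD[of Y "Inf Y + \<epsilon> / 2"] Y(3) \<open>0 < \<epsilon>\<close> by auto
  define X1 where "X1 = X \<inter> {..<x}"
  define Y1 where "Y1 = Y \<inter> {y<..}"
  have [measurable]: "X1 \<in> sets borel" "Y1 \<in> sets borel" by (simp_all add: X1_def Y1_def)
  have tr: "emeasure lborel ((\<lambda>t. t - c) -` A) = emeasure lborel A" if "A \<in> sets borel" for A and c :: real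
  proof -
    have "emeasure lborel A = emeasure (distr lborel borel ((+) (- c))) A"
      using lborel_distr_plus[of "- c"] by simp
    also have "\<dots> = emeasure lborel ((\<lambda>t. t - c) -` A)"
      using that by (subst emeasure_distr) (auto intro!: arg_cong[where f="emeasure lborel"])
    finally show ?thesis by simp
  qed
  have "X \<subseteq> X1 \<union> {x..Sup X}" using cSup_upper[of _ X] X(2) bounded_imp_bdd_above[of X] by (force simp: X1_def)
  then have "emeasure lborel X \<le> emeasure lborel (X1 \<union> {x..Sup X})" by (intro emeasure_mono) auto
  also have "\<dots> \<le> emeasure lborel X1 + emeasure lborel {x..Sup X}" by (intro emeasure_subadditive) auto
  also have "\<dots> \<le> emeasure lborel X1 + ennreal (\<epsilon> / 2)"
    using x cSup_upper[of x X] bounded_imp_bdd_above[of X] X(2) by (intro add_left_mono) (auto intro!: ennreal_leI)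
  finally have 1: "emeasure lborel X \<le> emeasure lborel X1 + ennreal (\<epsilon> / 2)" .
  have "Y \<subseteq> Y1 \<union> {Inf Y..y}" using cInf_lower[of _ Y] Y(2) bounded_imp_bdd_below[of Y] by (force simp: Y1_def)
  then have "emeasure lborel Y \<le> emeasure lborel (Y1 \<union> {Inf Y..y})" by (intro emeasure_mono) auto
  also have "\<dots> \<le> emeasure lborel Y1 + emeasure lborel {Inf Y..y}" by (intro emeasure_subadditive) auto
  also have "\<dots> \<le> emeasure lborel Y1 + ennreal (\<epsilon> / 2)"
    using y cInf_lower[of y Y] bounded_imp_bdd_below[of Y] Y(2) by (intro add_left_mono) (auto intro!: ennreal_leI)
  finally have 2: "emeasure lborel Y \<le> emeasure lborel Y1 + ennreal (\<epsilon> / 2)" .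
  have m: "(\<lambda>t. t - y) -` X1 \<in> sets borel" "(\<lambda>t. t - x) -` Y1 \<in> sets borel"
    using measurable_sets[of "\<lambda>t. t - y" borel borel X1] measurable_sets[of "\<lambda>t. t - x" borel borel Y1] by auto
  have "emeasure lborel X1 + emeasure lborel Y1
      = emeasure lborel ((\<lambda>t. t - y) -` X1) + emeasure lborel ((\<lambda>t. t - x) -` Y1)"
    by (simp add: tr)
  also have "\<dots> = emeasure lborel ((\<lambda>t. t - y) -` X1 \<union> (\<lambda>t. t - x) -` Y1)"
    using m by (intro plus_emeasure) (auto simp: X1_def Y1_def)
  also have "\<dots> \<le> emeasure lborel W" using W(2)[OF _ y(1)] W(2)[OF x(1)]
    by (intro emeasure_mono) (force simp: X1_def Y1_def)+
  finally have 3: "emeasure lborel X1 + emeasure lborel Y1 \<le> emeasure lborel W" .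
  have "emeasure lborel X + emeasure lborel Y
     \<le> (emeasure lborel X1 + ennreal (\<epsilon> / 2)) + (emeasure lborel Y1 + ennreal (\<epsilon> / 2))"
    by (intro add_mono 1 2)
  also have "\<dots> = (emeasure lborel X1 + emeasure lborel Y1) + (ennreal (\<epsilon> / 2) + ennreal (\<epsilon> / 2))"
    by (simp add: ac_simps)
  also have "ennreal (\<epsilon> / 2) + ennreal (\<epsilon> / 2) = ennreal \<epsilon>"
    using \<open>0 < \<epsilon>\<close> by (subst ennreal_plus[symmetric]) auto
  also have "(emeasure lborel X1 + emeasure lborel Y1) + ennreal \<epsilon> \<le> emeasure lborel W + ennreal \<epsilon>"
    using 3 by (intro add_right_mono)
  finally show "emeasure lborel X + emeasure lborel Y \<le> emeasure lborel W + ennreal \<epsilon>" .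
qed


text \<open>
  Slice lengths are divided by their suprema \<open>\<alpha>\<close> and \<open>\<beta>\<close>, so that at every relative height \<open>t < 1\<close>
  both superlevel sets are nonempty and the one-dimensional inequality applies to them.
\<close>

lemma brunn_minkowski_plane_pair:
  fixes A B W :: "(real \<times> real) set"
  assumes A: "A \<in> sets borel" "bounded A" and B: "B \<in> sets borel" "bounded B"
    and W: "W \<in> sets borel" "bounded W" and sum: "\<And>x y. x \<in> A \<Longrightarrow> y \<in> B \<Longrightarrow> x + y \<in> W"
    and pos: "0 < measure lborel A" "0 < measure lborel B"
  shows "(sqrt (measure lborel A) + sqrt (measure lborel B))\<^sup>2 \<le> measure lborel W"
proof -
  define len where "len S x = measure lborel (Pair x -` S)" for S :: "(real \<times> real) set" and x
  have slice: "Pair x -` S \<in> sets borel" "bounded (Pair x -` S)" if "S \<in> sets borel" "bounded S"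
    for S :: "(real \<times> real) set" and x :: real
  proof -
    show "Pair x -` S \<in> sets borel"
      using measurable_sets[of "Pair x" borel borel S] that by (simp add: borel_prod[symmetric])
    obtain C where "norm z \<le> C" if "z \<in> S" for z using \<open>bounded S\<close> by (auto simp: bounded_iff)
    then have "norm y \<le> C" if "y \<in> Pair x -` S" for y
      using \<open>\<And>z. z \<in> S \<Longrightarrow> norm z \<le> C\<close>[of "(x, y)"] that norm_snd_le[of y x] by fastforce
    then show "bounded (Pair x -` S)" by (auto simp: bounded_iff)
  qed
  have em_slice: "emeasure lborel (Pair x -` S) = ennreal (len S x)" if "S \<in> sets borel" "bounded S"
    for S :: "(real \<times> real) set" and x
    unfolding len_def using emeasure_bounded_finite[OF slice(2)[OF that]]
    by (intro emeasure_eq_ennreal_measure) (simp add: less_top)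
  have [measurable]: "len S \<in> borel_measurable borel" if "S \<in> sets borel" for S
  proof -
    have "S \<in> sets (lborel \<Otimes>\<^sub>M lborel)" using that by (simp only: lborel_prod sets_lborel)
    then have "(\<lambda>x. emeasure lborel (Pair x -` S)) \<in> borel_measurable lborel"
      by (rule lborel.measurable_emeasure_Pair)
    then show ?thesis unfolding len_def measure_def by simp
  qed
  have area: "ennreal (measure lborel S) = (\<integral>\<^sup>+ x. ennreal (len S x) \<partial>lborel)" if "S \<in> sets borel" "bounded S"
    for S :: "(real \<times> real) set"
  proof -
    have "ennreal (measure lborel S) = emeasure (lborel \<Otimes>\<^sub>M lborel) S"
      using emeasure_bounded_finite[OF that(2)] by (simp add: lborel_prod emeasure_eq_ennreal_measure)
    also have "\<dots> = (\<integral>\<^sup>+ x. emeasure lborel (Pair x -` S) \<partial>lborel)"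
      using that by (intro lborel.emeasure_pair_measure_alt) (simp only: lborel_prod sets_lborel)
    finally show ?thesis by (simp add: em_slice[OF that])
  qed
  have len_nonneg: "0 \<le> len S x" for S x by (simp add: len_def)
  have len_bdd: "bdd_above (range (len S))" if "S \<in> sets borel" "bounded S" for S
  proof -
    obtain C where C: "norm z \<le> C" if "z \<in> S" for z using \<open>bounded S\<close> by (auto simp: bounded_iff)
    have "len S x \<le> measure lborel {- C..C}" for x unfolding len_def
    proof (rule measure_mono_fmeasurable)
      show "Pair x -` S \<subseteq> {- C..C}"
      proof
        fix y assume "y \<in> Pair x -` S"
        then show "y \<in> {- C..C}" using C[of "(x, y)"] norm_snd_le[of y x] by fastforce
      qed
    qed (use slice[OF that] in \<open>auto intro: fmeasurable_compact\<close>)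
    then show ?thesis by (rule bdd_aboveI2)
  qed
  define \<alpha> where "\<alpha> = (SUP x. len A x)"
  define \<beta> where "\<beta> = (SUP x. len B x)"
  have sup_pos: "0 < (SUP x. len S x)" if "S \<in> sets borel" "bounded S" "0 < measure lborel S" for S
  proof (rule ccontr)
    assume "\<not> 0 < (SUP x. len S x)"
    then have "len S x = 0" for x
      using cSUP_upper[OF UNIV_I len_bdd[OF that(1,2)], of x] len_nonneg[of S x] by simp
    then have "ennreal (measure lborel S) = 0" using area[OF that(1,2)] by simp
    with that(3) show False by simp
  qed
  have \<alpha>: "0 < \<alpha>" and \<beta>: "0 < \<beta>" unfolding \<alpha>_def \<beta>_def by (auto intro!: sup_pos A B pos)
  have layers: "(\<integral>\<^sup>+ t\<in>{0<..<1}. emeasure lborel {x. t < len S x / c} \<partial>lborel) = (\<integral>\<^sup>+ x. ennreal (min 1 (len S x / c)) \<partial>lborel)"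
    if S: "S \<in> sets borel" "bounded S" and c: "0 < c" for S c
  proof -
    have "(\<lambda>x. len S x / c) \<in> borel_measurable borel" using S by (intro borel_measurable_divide) auto
    moreover have "max 0 (min 1 (len S x / c) - 0) = min 1 (len S x / c)" for x
      using c len_nonneg[of S x] by (simp add: max_def)
    ultimately show ?thesis by (simp add: layer_cake_interval)
  qed
  have scaled: "(\<integral>\<^sup>+ x. ennreal (len S x / c) \<partial>lborel) = ennreal (measure lborel S / c)"
    if S: "S \<in> sets borel" "bounded S" and c: "0 < c" for S c
  proof -
    have "(\<integral>\<^sup>+ x. ennreal (len S x / c) \<partial>lborel) = (\<integral>\<^sup>+ x. ennreal (1 / c) * ennreal (len S x) \<partial>lborel)"
      using c len_nonneg by (intro nn_integral_cong) (simp add: ennreal_mult[symmetric])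
    also have "\<dots> = ennreal (1 / c) * ennreal (measure lborel S)"
      using S by (subst nn_integral_cmult) (auto simp: area)
    finally show ?thesis using c by (simp add: ennreal_mult[symmetric])
  qed
  \<comment> \<open>The one-dimensional inequality is used twice: for the superlevel sets of slice
    lengths and, to show that sums of their points qualify, for the slices themselves, since the
    slices over \<open>x\<close> and \<open>y\<close> add up inside the slice of \<open>W\<close>
    over \<open>x + y\<close>.\<close>
  have level: "emeasure lborel {x. t < len A x / \<alpha>} + emeasure lborel {x. t < len B x / \<beta>}
      \<le> emeasure lborel {x. t < len W x / (\<alpha> + \<beta>)}" if t: "0 < t" "t < 1" for t
  proof (rule brunn_minkowski_line)
    note [measurable] = A(1) B(1) W(1)
    show "{x. t < len A x / \<alpha>} \<in> sets borel" "{x. t < len B x / \<beta>} \<in> sets borel"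
      "{x. t < len W x / (\<alpha> + \<beta>)} \<in> sets borel" using A(1) B(1) W(1) by measurable
    have nonempty: "{x. t < len S x / (SUP x. len S x)} \<noteq> {}" if S: "S \<in> sets borel" "bounded S" "0 < (SUP x. len S x)" for S
    proof -
      have "t * (SUP x. len S x) < (SUP x. len S x)" using t S(3) by simp
      then obtain x where "t * (SUP x. len S x) < len S x"
        using less_cSUP_iff[OF UNIV_not_empty len_bdd[OF S(1,2)]] by blast
      then show ?thesis using S(3) by (auto simp: field_simps)
    qed
    show "{x. t < len A x / \<alpha>} \<noteq> {}" "{x. t < len B x / \<beta>} \<noteq> {}"
      using nonempty A B \<alpha> \<beta> unfolding \<alpha>_def \<beta>_def by auto
    have bdd: "bounded {x. t < len S x / c}" if "bounded S" for S c
    proof -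
      have "{x. t < len S x / c} \<subseteq> fst ` S"
      proof
        fix x assume "x \<in> {x. t < len S x / c}"
        then have "len S x \<noteq> 0" using t by auto
        then have "Pair x -` S \<noteq> {}" by (auto simp: len_def)
        then show "x \<in> fst ` S" by force
      qed
      with that show ?thesis using bounded_fst bounded_subset by blast
    qed
    show "bounded {x. t < len A x / \<alpha>}" "bounded {x. t < len B x / \<beta>}" using bdd A B by auto
    fix x y assume x: "x \<in> {x. t < len A x / \<alpha>}" and y: "y \<in> {x. t < len B x / \<beta>}"
    then have x': "t * \<alpha> < len A x" and y': "t * \<beta> < len B y" using \<alpha> \<beta> by (auto simp: field_simps)
    have "0 < t * \<alpha>" "0 < t * \<beta>" using t \<alpha> \<beta> by auto
    with x' y' have "len A x \<noteq> 0" "len B y \<noteq> 0" by auto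
    then have ne: "Pair x -` A \<noteq> {}" "Pair y -` B \<noteq> {}" by (auto simp: len_def)
    have "emeasure lborel (Pair x -` A) + emeasure lborel (Pair y -` B) \<le> emeasure lborel (Pair (x + y) -` W)"
      using slice A B W ne sum by (intro brunn_minkowski_line) force+
    then have "len A x + len B y \<le> len W (x + y)"
      using len_nonneg by (simp add: em_slice A B W ennreal_plus[symmetric] del: ennreal_plus)
    with x' y' show "x + y \<in> {x. t < len W x / (\<alpha> + \<beta>)}" using \<alpha> \<beta> by (simp add: field_simps)
  qed
  \<comment> \<open>Truncation at 1 changes nothing for \<open>A\<close> and \<open>B\<close>, whose
    normalised slice lengths never exceed 1; for \<open>W\<close> it only lowers the integral, which
    is the favourable direction.\<close>
  have "ennreal (measure lborel A / \<alpha>) + ennreal (measure lborel B / \<beta>)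
     = (\<integral>\<^sup>+ x. ennreal (min 1 (len A x / \<alpha>)) \<partial>lborel) + (\<integral>\<^sup>+ x. ennreal (min 1 (len B x / \<beta>)) \<partial>lborel)"
  proof -
    have "len A x / \<alpha> \<le> 1" "len B x / \<beta> \<le> 1" for x
      using cSUP_upper[OF UNIV_I len_bdd, of _ x] A B \<alpha> \<beta> unfolding \<alpha>_def \<beta>_def by auto
    then have "min 1 (len A x / \<alpha>) = len A x / \<alpha>" "min 1 (len B x / \<beta>) = len B x / \<beta>" for x
      by (simp_all add: min_absorb2)
    then show ?thesis using scaled A B \<alpha> \<beta> by simp
  qed
  also have "\<dots> = (\<integral>\<^sup>+ t\<in>{0<..<1}. emeasure lborel {x. t < len A x / \<alpha>} \<partial>lborel)
      + (\<integral>\<^sup>+ t\<in>{0<..<1}. emeasure lborel {x. t < len B x / \<beta>} \<partial>lborel)"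
    using layers A B \<alpha> \<beta> by simp
  also have "\<dots> = (\<integral>\<^sup>+ t\<in>{0<..<1}. emeasure lborel {x. t < len A x / \<alpha>} + emeasure lborel {x. t < len B x / \<beta>} \<partial>lborel)"
  proof -
    note [measurable] = A(1) B(1)
    have m: "(\<lambda>t. emeasure lborel {x. t < len S x / c}) \<in> borel_measurable lborel" if [measurable]: "S \<in> sets borel" for S c
    proof -
      have "(\<lambda>t. emeasure lborel {x \<in> space lborel. t < len S x / c}) \<in> borel_measurable lborel"
        by (intro lborel.measurable_emeasure) (use that in measurable)
      then show ?thesis by simp
    qed
    show ?thesis using m A B by (subst nn_integral_add[symmetric]) (auto simp: distrib_right)
  qed
  also have "\<dots> \<le> (\<integral>\<^sup>+ t\<in>{0<..<1}. emeasure lborel {x. t < len W x / (\<alpha> + \<beta>)} \<partial>lborel)"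
    using level by (intro nn_integral_mono) (auto split: split_indicator)
  also have "\<dots> = (\<integral>\<^sup>+ x. ennreal (min 1 (len W x / (\<alpha> + \<beta>))) \<partial>lborel)"
    using layers W \<alpha> \<beta> by simp
  also have "\<dots> \<le> (\<integral>\<^sup>+ x. ennreal (len W x / (\<alpha> + \<beta>)) \<partial>lborel)"
    by (intro nn_integral_mono ennreal_leI) auto
  also have "\<dots> = ennreal (measure lborel W / (\<alpha> + \<beta>))" using scaled W \<alpha> \<beta> by simp
  finally have "measure lborel A / \<alpha> + measure lborel B / \<beta> \<le> measure lborel W / (\<alpha> + \<beta>)"
    using \<alpha> \<beta> by (simp add: ennreal_plus[symmetric] del: ennreal_plus)
  then have *: "(\<alpha> + \<beta>) * (measure lborel A / \<alpha> + measure lborel B / \<beta>) \<le> measure lborel W"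
    using \<alpha> \<beta> by (simp add: field_simps)
  \<comment> \<open>The suprema \<open>\<alpha>\<close> and \<open>\<beta>\<close> are unknown, but
    the left side of \<open>*\<close> is at least \<open>(p + q)\<^sup>2\<close> whatever they are;
    the excess is a square.\<close>
  define p q where "p = sqrt (measure lborel A)" and "q = sqrt (measure lborel B)"
  have pq: "measure lborel A = p\<^sup>2" "measure lborel B = q\<^sup>2" by (simp_all add: p_def q_def)
  have "(\<alpha> + \<beta>) * (p\<^sup>2 / \<alpha> + q\<^sup>2 / \<beta>) - (p + q)\<^sup>2 = (\<beta> * p - \<alpha> * q)\<^sup>2 / (\<alpha> * \<beta>)"
    using \<alpha> \<beta> by (simp add: field_simps power2_eq_square)
  also have "\<dots> \<ge> 0" using \<alpha> \<beta> by simp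
  finally show ?thesis using * unfolding p_def[symmetric] q_def[symmetric] by (simp add: pq)
qed

section \<open>Transfer from the product of two lines to \<open>real^2\<close>\<close>

definition plane :: "real \<times> real \<Rightarrow> real^2" where
  "plane p = (\<chi> i. if i = 1 then fst p else snd p)"

lemma plane_nth [simp]: "plane p $ 1 = fst p" "plane p $ 2 = snd p"
  by (simp_all add: plane_def)

lemma plane_linear: "plane (p + q) = plane p + plane q"
  by (simp add: vec_eq_iff forall_2)

lemma norm_plane [simp]: "norm (plane p) = norm p"
  by (simp add: norm_vec_def L2_set_def sum_2 norm_prod_def)

lemma continuous_on_plane: "continuous_on A plane"
  unfolding plane_def
proof (intro continuous_on_vec_lambda)
  show "continuous_on A (\<lambda>p. if i = 1 then fst p else snd p)" for i :: 2
    by (cases "i = 1") (auto intro: continuous_intros)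
qed

lemma measurable_plane [measurable]: "plane \<in> borel_measurable borel"
  by (rule borel_measurable_continuous_onI[OF continuous_on_plane])

lemma Basis_real2: "(Basis :: (real^2) set) = {axis 1 1, axis 2 1}"
  by (auto simp: Basis_vec_def UNIV_2)

lemma distr_plane: "distr lborel borel plane = lborel"
proof (rule lborel_eqI[symmetric])
  fix l u :: "real^2" assume lu: "\<And>b. b \<in> Basis \<Longrightarrow> l \<bullet> b \<le> u \<bullet> b"
  then have le: "l $ 1 \<le> u $ 1" "l $ 2 \<le> u $ 2"
    using lu[of "axis 1 1"] lu[of "axis 2 1"] by (simp_all add: Basis_real2 inner_axis)
  have "plane -` box l u = {l $ 1<..<u $ 1} \<times> {l $ 2<..<u $ 2}" by (auto simp: mem_box_cart forall_2)
  then have "emeasure (distr lborel borel plane) (box l u)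
      = emeasure (lborel \<Otimes>\<^sub>M lborel) ({l $ 1<..<u $ 1} \<times> {l $ 2<..<u $ 2})"
    by (subst emeasure_distr) (auto simp: lborel_prod)
  also have "\<dots> = ennreal (u $ 1 - l $ 1) * ennreal (u $ 2 - l $ 2)"
    using le by (subst lborel.emeasure_pair_measure_Times) auto
  also have "\<dots> = ennreal (\<Prod>b\<in>Basis. (u - l) \<bullet> b)"
    using le by (simp add: Basis_real2 inner_axis axis_eq_axis ennreal_mult)
  finally show "emeasure (distr lborel borel plane) (box l u) = ennreal (\<Prod>b\<in>Basis. (u - l) \<bullet> b)" .
qed simp

text \<open>\<open>plane\<close> is additive and preserves norm and Lebesgue measure, so the
  inequality obtained by slicing the product carries over through preimages.\<close>

lemma brunn_minkowski_plane:
  fixes A B W :: "(real^2) set"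
  assumes A: "A \<in> sets borel" "bounded A" and B: "B \<in> sets borel" "bounded B"
    and W: "W \<in> sets borel" "bounded W" and sum: "\<And>x y. x \<in> A \<Longrightarrow> y \<in> B \<Longrightarrow> x + y \<in> W"
    and pos: "0 < measure lborel A" "0 < measure lborel B"
  shows "(sqrt (measure lborel A) + sqrt (measure lborel B))\<^sup>2 \<le> measure lborel W"
proof -
  have vi: "plane -` S \<in> sets borel" "bounded (plane -` S)" "measure lborel S = measure lborel (plane -` S)"
    if "S \<in> sets borel" "bounded S" for S
  proof -
    show "plane -` S \<in> sets borel" using measurable_sets[OF measurable_plane that(1)] by simp
    show "bounded (plane -` S)" using that(2) unfolding bounded_iff by (metis norm_plane vimageE)
    have "measure lborel S = measure (distr lborel borel plane) S" by (simp add: distr_plane)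
    also have "\<dots> = measure lborel (plane -` S)" using that by (subst measure_distr) auto
    finally show "measure lborel S = measure lborel (plane -` S)" .
  qed
  have "(sqrt (measure lborel (plane -` A)) + sqrt (measure lborel (plane -` B)))\<^sup>2 \<le> measure lborel (plane -` W)"
    using pos sum by (intro brunn_minkowski_plane_pair vi A B W) (auto simp: vi(3)[symmetric] A B plane_linear)
  then show ?thesis by (simp add: vi(3)[symmetric] A B W)
qed

section \<open>Isoperimetric coarea inequality\<close>

text \<open>The gradient is carried along as an explicit continuous field. Since both functions
  vanish off the open disc, energies over the plane and over the disc coincide. Test functions
  belong to this class, and it is stable under scaling.\<close>

definition C1_disc :: "(real^2 \<Rightarrow> real) \<Rightarrow> (real^2 \<Rightarrow> real^2) \<Rightarrow> bool" where
  "C1_disc \<phi> G \<longleftrightarrow> (\<forall>x. (\<phi> has_derivative (\<lambda>h. G x \<bullet> h)) (at x)) \<and> continuous_on UNIV G \<and>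
     (\<forall>x. x \<notin> ball 0 1 \<longrightarrow> \<phi> x = 0 \<and> G x = 0)"

text \<open>The intersection with the disc matters at level 0, where it yields the disc of area pi
  instead of the plane, so that the time variable starts at 0.\<close>

definition superlevel :: "(real^2 \<Rightarrow> real) \<Rightarrow> real \<Rightarrow> (real^2) set" where
  "superlevel \<phi> t = {x \<in> ball 0 1. t \<le> \<bar>\<phi> x\<bar>}"

text \<open>Half-open in the level, so that consecutive shells are disjoint and their energies add
  exactly, even if a level has positive measure.\<close>

definition shell :: "(real^2 \<Rightarrow> real) \<Rightarrow> real \<Rightarrow> real \<Rightarrow> (real^2) set" where
  "shell \<phi> a b = {x \<in> ball 0 1. a \<le> \<bar>\<phi> x\<bar> \<and> \<bar>\<phi> x\<bar> < b}"

abbreviation (input) dirichlet :: "(real^2) set \<Rightarrow> (real^2 \<Rightarrow> real^2) \<Rightarrow> real" where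
  "dirichlet A G \<equiv> LINT x:A|lborel. (norm (G x))\<^sup>2"

abbreviation (input) nn_square :: "'a measure \<Rightarrow> ('a \<Rightarrow> real) \<Rightarrow> ennreal" where
  "nn_square M f \<equiv> \<integral>\<^sup>+ x. ennreal ((f x)\<^sup>2) \<partial>M"

lemma C1_disc_continuous:
  assumes "C1_disc \<phi> G" shows "continuous_on A \<phi>" "continuous_on A G"
proof -
  have "continuous_on UNIV \<phi>"
    using assms unfolding C1_disc_def by (meson has_derivative_continuous continuous_at_imp_continuous_on)
  then show "continuous_on A \<phi>" "continuous_on A G"
    using assms unfolding C1_disc_def by (auto intro: continuous_on_subset)
qed

lemma C1_disc_measurable:
  assumes "C1_disc \<phi> G" shows "\<phi> \<in> borel_measurable borel" "G \<in> borel_measurable borel"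
  using C1_disc_continuous[OF assms, of UNIV] by (auto intro: borel_measurable_continuous_onI)

lemma C1_disc_zero: "C1_disc \<phi> G \<Longrightarrow> x \<notin> ball 0 1 \<Longrightarrow> \<phi> x = 0" "C1_disc \<phi> G \<Longrightarrow> x \<notin> ball 0 1 \<Longrightarrow> G x = 0"
  by (auto simp: C1_disc_def)

lemma C1_disc_bounded:
  assumes "C1_disc \<phi> G"
  obtains C where "0 < C" "\<And>x. \<bar>\<phi> x\<bar> \<le> C" "\<And>x. norm (G x) \<le> C"
proof -
  have "bounded (\<phi> ` cball 0 1)" "bounded (G ` cball 0 1)"
    by (auto intro!: compact_imp_bounded compact_continuous_image C1_disc_continuous[OF assms])
  then obtain B B' where B: "\<And>x. x \<in> cball 0 1 \<Longrightarrow> norm (\<phi> x) \<le> B" "\<And>x. x \<in> cball 0 1 \<Longrightarrow> norm (G x) \<le> B'"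
    unfolding bounded_iff by blast
  show thesis
  proof (rule that[of "max 1 (max B B')"])
    fix x
    show "\<bar>\<phi> x\<bar> \<le> max 1 (max B B')" using B(1)[of x] C1_disc_zero[OF assms, of x] by (cases "x \<in> ball 0 1") auto
    show "norm (G x) \<le> max 1 (max B B')" using B(2)[of x] C1_disc_zero[OF assms, of x] by (cases "x \<in> ball 0 1") auto
  qed auto
qed

text \<open>Controls the supremum of \<bar>\<phi>\<bar> over a small ball. It is applied both with
  the global gradient bound and with a local one close to \<open>norm (G x)\<close>.\<close>

lemma C1_disc_increment:
  assumes "C1_disc \<phi> G" and B: "\<And>z. z \<in> ball x \<epsilon> \<Longrightarrow> norm (G z) \<le> B" and y: "y \<in> ball x \<epsilon>"
  shows "\<bar>\<phi> y\<bar> \<le> \<bar>\<phi> x\<bar> + B * \<epsilon>"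
proof -
  have \<epsilon>: "0 < \<epsilon>" using y by (metis ball_eq_empty empty_iff not_le)
  have B0: "0 \<le> B" using B[of x] \<epsilon> norm_ge_zero order_trans by (metis centre_in_ball)
  have "norm (\<phi> y - \<phi> x) \<le> B * norm (y - x)"
  proof (rule differentiable_bound[OF convex_ball])
    show "(\<phi> has_derivative (\<lambda>h. G z \<bullet> h)) (at z within ball x \<epsilon>)" for z
      using assms(1) by (auto simp: C1_disc_def intro: has_derivative_at_withinI)
    show "onorm (\<lambda>h. G z \<bullet> h) \<le> B" if "z \<in> ball x \<epsilon>" for z
    proof (rule onorm_bound[OF B0])
      fix h
      show "norm (G z \<bullet> h) \<le> B * norm h"
        using Cauchy_Schwarz_ineq2[of "G z" h] mult_right_mono[OF B[OF that], of "norm h"] by simp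
    qed
  qed (use y \<epsilon> in auto)
  also have "\<dots> \<le> B * \<epsilon>" using y B0 by (intro mult_left_mono) (auto simp: dist_norm norm_minus_commute)
  finally show ?thesis by simp
qed

lemma sets_superlevel_shell:
  assumes "C1_disc \<phi> G"
  shows "superlevel \<phi> t \<in> sets borel" "shell \<phi> a b \<in> sets borel"
proof -
  note [measurable] = C1_disc_measurable[OF assms]
  have "superlevel \<phi> t = ball 0 1 \<inter> {x \<in> space borel. t \<le> \<bar>\<phi> x\<bar>}" by (auto simp: superlevel_def)
  also have "\<dots> \<in> sets borel" by measurable
  finally show "superlevel \<phi> t \<in> sets borel" .
  have "shell \<phi> a b = ball 0 1 \<inter> {x \<in> space borel. a \<le> \<bar>\<phi> x\<bar> \<and> \<bar>\<phi> x\<bar> < b}" by (auto simp: shell_def)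
  also have "\<dots> \<in> sets borel" by measurable
  finally show "shell \<phi> a b \<in> sets borel" .
qed

lemma fmeasurable_disc_subset:
  fixes A :: "(real^2) set"
  shows "A \<in> sets borel \<Longrightarrow> A \<subseteq> ball 0 r \<Longrightarrow> A \<in> fmeasurable lborel"
  by (intro fmeasurableI emeasure_bounded_finite bounded_subset[OF bounded_ball]) auto

lemma integrable_indicator_ball:
  fixes x :: "'a :: euclidean_space"
  shows "integrable lborel (\<lambda>y. c * indicator (ball x r) y :: real)"
  using emeasure_lborel_ball_finite[of x r] by (auto intro!: integrable_mult_right integrable_real_indicator)

lemma integrable_ball_bounded:
  fixes f :: "'a :: euclidean_space \<Rightarrow> real"
  assumes "f \<in> borel_measurable borel" and le: "\<And>y. \<bar>f y\<bar> \<le> c * indicator (ball x r) y"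
  shows "integrable lborel f"
proof (rule Bochner_Integration.integrable_bound[OF integrable_indicator_ball[of c x r]])
  show "AE y in lborel. norm (f y) \<le> norm (c * indicator (ball x r) y)"
    using le by (intro AE_I2) (metis abs_ge_self order_trans real_norm_def)
qed (use assms in simp)

text \<open>Let \<open>fe\<close> be the supremum of \<open>f = \<bar>\<phi>\<bar>\<close> over the
  \<open>\<epsilon>\<close>-ball. The set where \<open>fe\<close> exceeds \<open>t\<close> is the
  \<open>\<epsilon>\<close>-enlargement of the set where \<open>f\<close> does, so Brunn-Minkowski
  makes its area larger by at least \<open>c * \<epsilon>\<close>. Integrating over \<open>t\<close>
  and using \<open>fe \<le> f + \<epsilon> * norm G\<close> up to a small error, then dividing by
  \<open>\<epsilon>\<close>, gives the claim without any regularity of the level curves.\<close>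

lemma coarea_isoperimetric:
  assumes C1: "C1_disc \<phi> G" and ab: "0 \<le> a" "a < b"
  shows "2 * sqrt pi * sqrt (measure lborel (superlevel \<phi> b)) * (b - a) \<le> (LINT x:shell \<phi> a b|lborel. norm (G x))"
proof (cases "measure lborel (superlevel \<phi> b) = 0")
  case True
  then show ?thesis by (simp add: set_lebesgue_integral_def)
next
  case False
  define m where "m = measure lborel (superlevel \<phi> b)"
  have m: "0 < m" using False measure_nonneg[of lborel "superlevel \<phi> b"] unfolding m_def by linarith
  note [measurable] = C1_disc_measurable[OF C1]
  obtain L where L: "0 < L" "\<And>x. \<bar>\<phi> x\<bar> \<le> L" "\<And>x. norm (G x) \<le> L" using C1_disc_bounded[OF C1] by blast
  define f where "f x = \<bar>\<phi> x\<bar>" for x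
  have [measurable]: "f \<in> borel_measurable borel" unfolding f_def by measurable
  have f0: "f x = 0" if "x \<notin> ball 0 1" for x using C1_disc_zero(1)[OF C1 that] by (simp add: f_def)
  define fe where "fe \<epsilon> x = (SUP y\<in>ball x \<epsilon>. f y)" for \<epsilon> x
  \<comment> \<open>The length of the part of \<open>{a<..<b}\<close> below \<open>s\<close>; its
    integral is the layer-cake form of the area integral over these levels.\<close>
  define H where "H s = max 0 (min b s - a)" for s
  have bdd: "bdd_above (f ` ball x \<epsilon>)" for x \<epsilon> using L(2) by (auto simp: f_def intro!: bdd_aboveI2)
  have fe_gt: "t < fe \<epsilon> x \<longleftrightarrow> (\<exists>y\<in>ball x \<epsilon>. t < f y)" if "0 < \<epsilon>" for t \<epsilon> x
    unfolding fe_def using that by (intro less_cSUP_iff bdd) auto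
  have fe_set: "{x. t < fe \<epsilon> x} = (\<Union>y\<in>{y. t < f y}. ball y \<epsilon>)" if "0 < \<epsilon>" for t \<epsilon>
    using fe_gt[OF that] by (auto simp: dist_commute)
  have [measurable]: "fe \<epsilon> \<in> borel_measurable borel" if "0 < \<epsilon>" for \<epsilon>
  proof (rule borel_measurableI_greater)
    fix t show "{x \<in> space borel. t < fe \<epsilon> x} \<in> sets borel" using fe_set[OF that, of t] by (auto intro: borel_open)
  qed
  have cake: "(\<integral>\<^sup>+ t\<in>{a<..<b}. emeasure lborel {x. t < g x} \<partial>lborel) = (\<integral>\<^sup>+ x. ennreal (H (g x)) \<partial>lborel)"
    if "g \<in> borel_measurable borel" for g :: "real^2 \<Rightarrow> real"
    unfolding H_def by (rule layer_cake_interval[OF that])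
  \<comment> \<open>The circumference of a disc of area \<open>m\<close>. The set at level
    \<open>b\<close> lies inside every set with \<open>t < b\<close>, so this one rate serves all
    levels.\<close>
  define c where "c = 2 * sqrt pi * sqrt m"
  have c: "0 \<le> c" using m by (simp add: c_def)
  have expansion: "emeasure lborel {x. t < f x} + ennreal (c * \<epsilon>) \<le> emeasure lborel {x. t < fe \<epsilon> x}"
    if t: "a < t" "t < b" and \<epsilon>: "0 < \<epsilon>" "\<epsilon> \<le> 1" for t \<epsilon>
  proof -
    have f_sub: "{x. t < f x} \<subseteq> ball 0 1" using f0 t ab by force
    have fe_sub: "{x. t < fe \<epsilon> x} \<subseteq> ball 0 2"
    proof
      fix x assume "x \<in> {x. t < fe \<epsilon> x}"
      then obtain y where "dist x y < \<epsilon>" "y \<in> ball 0 1" using fe_gt[OF \<epsilon>(1)] f_sub by auto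
      then show "x \<in> ball 0 2" using \<epsilon> dist_triangle[of 0 x y] by (simp add: dist_commute)
    qed
    have S: "{x. t < f x} \<in> sets borel" "{x. t < fe \<epsilon> x} \<in> sets borel"
      using \<epsilon> by measurable
    have fm: "{x. t < f x} \<in> fmeasurable lborel" "{x. t < fe \<epsilon> x} \<in> fmeasurable lborel"
      using fmeasurable_disc_subset S f_sub fe_sub by blast+
    have ge: "m \<le> measure lborel {x. t < f x}"
      unfolding m_def using t by (intro measure_mono_fmeasurable fm) (auto simp: superlevel_def f_def sets_superlevel_shell[OF C1, unfolded superlevel_def])
    have ball: "measure lborel (ball 0 \<epsilon> :: (real^2) set) = pi * \<epsilon>\<^sup>2"
      using \<epsilon> by (simp add: content_ball unit_ball_vol_2)
    have "(sqrt (measure lborel {x. t < f x}) + sqrt (measure lborel (ball 0 \<epsilon> :: (real^2) set)))\<^sup>2 \<le> measure lborel {x. t < fe \<epsilon> x}"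
    proof (rule brunn_minkowski_plane)
      show "0 < measure lborel {x. t < f x}" using ge m by simp
      show "0 < measure lborel (ball 0 \<epsilon> :: (real^2) set)" using \<epsilon> by (simp add: ball)
      fix x y :: "real^2" assume "x \<in> {x. t < f x}" "y \<in> ball 0 \<epsilon>"
      then show "x + y \<in> {x. t < fe \<epsilon> x}" using fe_gt[OF \<epsilon>(1)] by (auto simp: dist_norm intro!: bexI[of _ x])
    qed (use S bounded_subset[OF bounded_ball f_sub] bounded_subset[OF bounded_ball fe_sub] in auto)
    moreover have "sqrt (measure lborel (ball 0 \<epsilon> :: (real^2) set)) = sqrt pi * \<epsilon>"
      using \<epsilon> by (simp add: ball real_sqrt_mult)
    moreover have "c * \<epsilon> \<le> 2 * sqrt (measure lborel {x. t < f x}) * (sqrt pi * \<epsilon>)"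
      using ge \<epsilon> by (simp add: c_def)
    ultimately have "measure lborel {x. t < f x} + c * \<epsilon> \<le> measure lborel {x. t < fe \<epsilon> x}"
      using zero_le_power2[of "sqrt pi * \<epsilon>"] unfolding power2_sum by (simp only: real_sqrt_pow2[OF measure_nonneg])
    then have "ennreal (measure lborel {x. t < f x} + c * \<epsilon>) \<le> ennreal (measure lborel {x. t < fe \<epsilon> x})"
      by (rule ennreal_leI)
    then show ?thesis using fm c \<epsilon> by (simp add: emeasure_eq_measure2)
  qed
  \<comment> \<open>Up to the factor \<open>\<epsilon>\<close>, this majorises the gain of
    \<open>H\<close> on passing from \<open>f\<close> to \<open>fe\<close>. A point below
    \<open>a\<close> can be lifted past it only from within \<open>L * \<epsilon>\<close>, hence the
    widened band; radius 2 covers the disc enlarged by \<open>\<epsilon> \<le> 1\<close>.\<close>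
  define k where "k \<epsilon> \<omega> x = (norm (G x) + \<omega>) * indicator {x \<in> ball 0 2. a - L * \<epsilon> \<le> f x \<and> f x < b} x" for \<epsilon> \<omega> x
  have region: "{x \<in> ball 0 2. d \<le> f x \<and> f x < b} \<in> sets borel" for d
  proof -
    have "{x \<in> ball 0 2. d \<le> f x \<and> f x < b} = ball 0 2 \<inter> {x \<in> space borel. d \<le> f x \<and> f x < b}" by auto
    also have "\<dots> \<in> sets borel" by measurable
    finally show ?thesis .
  qed
  have k_meas [measurable]: "k \<epsilon> \<omega> \<in> borel_measurable borel" for \<epsilon> \<omega>
    unfolding k_def by (intro borel_measurable_times borel_measurable_indicator region) measurable
  have step: "c * (b - a) \<le> (\<integral>x. k \<epsilon> \<omega> x \<partial>lborel)"
    if \<epsilon>: "0 < \<epsilon>" "\<epsilon> \<le> 1" and \<omega>: "0 < \<omega>" "\<omega> \<le> 1"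
      and uc: "\<And>x y. x \<in> ball 0 2 \<Longrightarrow> y \<in> ball x \<epsilon> \<Longrightarrow> norm (G y) \<le> norm (G x) + \<omega>" for \<epsilon> \<omega>
  proof -
    have pw: "H (fe \<epsilon> x) \<le> H (f x) + \<epsilon> * k \<epsilon> \<omega> x" for x
    proof -
      have fe_le: "fe \<epsilon> x \<le> f x + B * \<epsilon>" if "\<And>z. z \<in> ball x \<epsilon> \<Longrightarrow> norm (G z) \<le> B" for B
        unfolding fe_def f_def using \<epsilon> C1_disc_increment[OF C1 that] by (intro cSUP_least) auto
      have k0: "0 \<le> \<epsilon> * k \<epsilon> \<omega> x" using \<epsilon> \<omega> by (simp add: k_def)
      consider "x \<notin> ball 0 2" | "f x < a - L * \<epsilon>" | "b \<le> f x" | "x \<in> ball 0 2" "a - L * \<epsilon> \<le> f x" "f x < b" by force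
      then show ?thesis
      proof cases
        case 1
        have "f y = 0" if "y \<in> ball x \<epsilon>" for y
        proof (rule f0, rule notI)
          assume "y \<in> ball 0 1"
          with that \<epsilon> have "dist 0 x < 2" using dist_triangle[of 0 x y] by (simp add: dist_commute)
          with 1 show False by simp
        qed
        then have "fe \<epsilon> x = 0" unfolding fe_def using \<epsilon> by (subst SUP_cong[where D="\<lambda>_. 0"]) auto
        then have "H (fe \<epsilon> x) = 0" using ab by (simp add: H_def)
        then show ?thesis using k0 by (simp add: H_def)
      next
        case 2
        have "fe \<epsilon> x < a" using fe_le[of L] L(3) 2 by simp
        then show ?thesis using k0 by (simp add: H_def)
      next
        case 3
        then show ?thesis using k0 by (simp add: H_def)
      next
        case 4
        have "fe \<epsilon> x \<le> f x + (norm (G x) + \<omega>) * \<epsilon>" using uc[OF 4(1)] by (intro fe_le) auto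
        moreover have "k \<epsilon> \<omega> x = norm (G x) + \<omega>" using 4 by (simp add: k_def)
        moreover have "0 \<le> \<epsilon> * (norm (G x) + \<omega>)" using \<epsilon> \<omega> by simp
        ultimately show ?thesis by (auto simp: H_def mult.commute)
      qed
    qed
    have "(\<integral>\<^sup>+ x. ennreal (H (f x)) \<partial>lborel) + ennreal (c * \<epsilon> * (b - a))
       = (\<integral>\<^sup>+ t\<in>{a<..<b}. emeasure lborel {x. t < f x} \<partial>lborel) + (\<integral>\<^sup>+ t\<in>{a<..<b}. ennreal (c * \<epsilon>) \<partial>lborel)"
      using ab c \<epsilon> by (simp add: cake nn_integral_cmult_indicator ennreal_mult)
    also have "\<dots> = (\<integral>\<^sup>+ t\<in>{a<..<b}. emeasure lborel {x. t < f x} + ennreal (c * \<epsilon>) \<partial>lborel)"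
    proof -
      have "(\<lambda>t. emeasure lborel {x \<in> space lborel. t < f x}) \<in> borel_measurable lborel"
        by (intro lborel.measurable_emeasure) measurable
      then show ?thesis by (subst nn_integral_add[symmetric]) (auto simp: distrib_right)
    qed
    also have "\<dots> \<le> (\<integral>\<^sup>+ t\<in>{a<..<b}. emeasure lborel {x. t < fe \<epsilon> x} \<partial>lborel)"
      using expansion \<epsilon> by (intro nn_integral_mono) (auto split: split_indicator)
    also have "\<dots> = (\<integral>\<^sup>+ x. ennreal (H (fe \<epsilon> x)) \<partial>lborel)" using \<epsilon> by (intro cake) measurable
    also have "\<dots> \<le> (\<integral>\<^sup>+ x. ennreal (H (f x)) + ennreal (\<epsilon> * k \<epsilon> \<omega> x) \<partial>lborel)"
    proof (intro nn_integral_mono)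
      fix x
      have "0 \<le> \<epsilon> * k \<epsilon> \<omega> x" using \<epsilon> \<omega> by (simp add: k_def)
      then show "ennreal (H (fe \<epsilon> x)) \<le> ennreal (H (f x)) + ennreal (\<epsilon> * k \<epsilon> \<omega> x)"
        using ennreal_leI[OF pw[of x]] by (simp add: H_def)
    qed
    also have "\<dots> = (\<integral>\<^sup>+ x. ennreal (H (f x)) \<partial>lborel) + (\<integral>\<^sup>+ x. ennreal (\<epsilon> * k \<epsilon> \<omega> x) \<partial>lborel)"
      unfolding H_def by (intro nn_integral_add) auto
    finally have le: "(\<integral>\<^sup>+ x. ennreal (H (f x)) \<partial>lborel) + ennreal (c * \<epsilon> * (b - a))
      \<le> (\<integral>\<^sup>+ x. ennreal (H (f x)) \<partial>lborel) + (\<integral>\<^sup>+ x. ennreal (\<epsilon> * k \<epsilon> \<omega> x) \<partial>lborel)" .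
    have "(\<integral>\<^sup>+ x. ennreal (H (f x)) \<partial>lborel) \<le> (\<integral>\<^sup>+ x. ennreal (b - a) * indicator (ball 0 1 :: (real^2) set) x \<partial>lborel)"
      using f0 ab by (intro nn_integral_mono) (auto simp: H_def split: split_indicator intro!: ennreal_leI)
    also have "\<dots> < \<infinity>" using emeasure_lborel_ball_finite[of "0 :: real^2" 1]
      by (subst nn_integral_cmult_indicator) (auto simp: ennreal_mult_less_top)
    finally have "(\<integral>\<^sup>+ x. ennreal (H (f x)) \<partial>lborel) < \<infinity>" .
    \<comment> \<open>The common integral is at most \<open>b - a\<close> times the area of the
      disc; its finiteness is what permits the cancellation in \<open>ennreal\<close>.\<close>
    with le have le': "ennreal (c * \<epsilon> * (b - a)) \<le> (\<integral>\<^sup>+ x. ennreal (\<epsilon> * k \<epsilon> \<omega> x) \<partial>lborel)"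
      by (auto simp: ennreal_add_left_cancel_le)
    have k_int: "integrable lborel (k \<epsilon> \<omega>)"
    proof (rule integrable_ball_bounded[OF k_meas])
      show "\<bar>k \<epsilon> \<omega> x\<bar> \<le> (L + 1) * indicator (ball 0 2) x" for x
        using L(3)[of x] L(1) \<omega> by (auto simp: k_def split: split_indicator)
    qed
    have "(\<integral>\<^sup>+ x. ennreal (\<epsilon> * k \<epsilon> \<omega> x) \<partial>lborel) = ennreal (\<integral>x. \<epsilon> * k \<epsilon> \<omega> x \<partial>lborel)"
    proof (intro nn_integral_eq_integral integrable_mult_right k_int AE_I2)
      fix x show "0 \<le> \<epsilon> * k \<epsilon> \<omega> x" using \<epsilon> \<omega> by (simp add: k_def)
    qed
    with le' have "ennreal (c * \<epsilon> * (b - a)) \<le> ennreal (\<integral>x. \<epsilon> * k \<epsilon> \<omega> x \<partial>lborel)" by simp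
    moreover have "0 \<le> (\<integral>x. \<epsilon> * k \<epsilon> \<omega> x \<partial>lborel)"
      using \<epsilon> \<omega> by (intro integral_nonneg_AE AE_I2) (auto simp: k_def)
    ultimately have "c * \<epsilon> * (b - a) \<le> \<epsilon> * (\<integral>x. k \<epsilon> \<omega> x \<partial>lborel)" by simp
    then have "\<epsilon> * (c * (b - a)) \<le> \<epsilon> * (\<integral>x. k \<epsilon> \<omega> x \<partial>lborel)" by (simp add: ac_simps)
    then show ?thesis using \<epsilon> by simp
  qed
  \<comment> \<open>Radius 3 contains all balls of radius at most 1 centred in the disc of radius 2;
    compactness there gives one modulus of continuity for \<open>G\<close>.\<close>
  have ex_\<epsilon>: "\<exists>\<epsilon>. 0 < \<epsilon> \<and> \<epsilon> \<le> \<omega> \<and> (\<forall>x y. x \<in> ball 0 2 \<longrightarrow> y \<in> ball x \<epsilon> \<longrightarrow> norm (G y) \<le> norm (G x) + \<omega>)"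
    if \<omega>: "0 < \<omega>" "\<omega> \<le> 1" for \<omega>
  proof -
    have "uniformly_continuous_on (cball 0 3) G"
      by (intro compact_uniformly_continuous C1_disc_continuous[OF C1]) auto
    then obtain d where d: "0 < d" "\<And>x y. x \<in> cball 0 3 \<Longrightarrow> y \<in> cball 0 3 \<Longrightarrow> dist y x < d \<Longrightarrow> dist (G y) (G x) < \<omega>"
      using \<omega> unfolding uniformly_continuous_on_def by blast
    show ?thesis
    proof (intro exI[of _ "min d \<omega>"] conjI allI impI)
      fix x y :: "real^2" assume x: "x \<in> ball 0 2" and y: "y \<in> ball x (min d \<omega>)"
      have "dist 0 y \<le> 3" using x y \<omega> dist_triangle[of 0 y x] by simp
      then have "dist (G y) (G x) < \<omega>" using x y by (intro d(2)) (auto simp: dist_commute)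
      then show "norm (G y) \<le> norm (G x) + \<omega>"
        using norm_triangle_ineq2[of "G y" "G x"] by (simp add: dist_norm)
    qed (use d \<omega> in auto)
  qed
  define \<omega> where "\<omega> n = inverse (real (Suc n))" for n
  have \<omega>: "0 < \<omega> n" "\<omega> n \<le> 1" for n by (auto simp: \<omega>_def divide_simps)
  obtain \<epsilon> where \<epsilon>: "\<And>n. 0 < \<epsilon> n" "\<And>n. \<epsilon> n \<le> \<omega> n"
    "\<And>n (x :: real^2) y. x \<in> ball 0 2 \<Longrightarrow> y \<in> ball x (\<epsilon> n) \<Longrightarrow> norm (G y) \<le> norm (G x) + \<omega> n"
    using ex_\<epsilon>[OF \<omega>] by metis
  have \<omega>_lim: "\<omega> \<longlonglongrightarrow> 0" unfolding \<omega>_def by (rule LIMSEQ_inverse_real_of_nat)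
  have \<epsilon>_lim: "\<epsilon> \<longlonglongrightarrow> 0"
    by (rule tendsto_sandwich[OF _ _ tendsto_const \<omega>_lim])
      (intro always_eventually allI less_imp_le[OF \<epsilon>(1)] \<epsilon>(2))+
  define k' where "k' x = norm (G x) * indicator {x \<in> ball 0 2. a \<le> f x \<and> f x < b} x" for x
  have "(\<lambda>n. \<integral>x. k (\<epsilon> n) (\<omega> n) x \<partial>lborel) \<longlonglongrightarrow> (\<integral>x. k' x \<partial>lborel)"
  proof (rule integral_dominated_convergence[where w="\<lambda>x. (L + 1) * indicator (ball 0 2 :: (real^2) set) x"])
    show "integrable lborel (\<lambda>x::real^2. (L + 1) * indicator (ball 0 2 :: (real^2) set) x :: real)"
      by (rule integrable_indicator_ball)
    show "AE x in lborel. norm (k (\<epsilon> n) (\<omega> n) x) \<le> (L + 1) * indicator (ball 0 2 :: (real^2) set) x" for n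
    proof (rule AE_I2)
      fix x show "norm (k (\<epsilon> n) (\<omega> n) x) \<le> (L + 1) * indicator (ball 0 2 :: (real^2) set) x"
        using L(3)[of x] L(1) \<omega>[of n] by (auto simp: k_def split: split_indicator)
    qed
    show "AE x in lborel. (\<lambda>n. k (\<epsilon> n) (\<omega> n) x) \<longlonglongrightarrow> k' x"
    proof (rule AE_I2)
      fix x
      have lim: "(\<lambda>n. a - L * \<epsilon> n) \<longlonglongrightarrow> a - L * 0" by (intro tendsto_intros \<epsilon>_lim)
      \<comment> \<open>The lower levels approach \<open>a\<close> from below, so exactly the closed
        condition \<open>a \<le> f x\<close> survives, and each point settles after finitely many
        indices.\<close>
      have ev: "\<forall>\<^sub>F n in sequentially. (indicator {x \<in> ball 0 2. a - L * \<epsilon> n \<le> f x \<and> f x < b} x :: real)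
          = indicator {x \<in> ball 0 2. a \<le> f x \<and> f x < b} x"
      proof (cases "a \<le> f x")
        case True
        then have "a - L * \<epsilon> n \<le> f x" for n using L(1) \<epsilon>(1)[of n] by (smt (verit) mult_pos_pos)
        with True show ?thesis by (auto simp: indicator_def)
      next
        case False
        then have "\<forall>\<^sub>F n in sequentially. f x < a - L * \<epsilon> n" using order_tendstoD(1)[OF lim] by simp
        then show ?thesis by (rule eventually_mono) (use False in \<open>auto simp: indicator_def\<close>)
      qed
      have "(\<lambda>n. (norm (G x) + \<omega> n) * indicator {x \<in> ball 0 2. a \<le> f x \<and> f x < b} x) \<longlonglongrightarrow> (norm (G x) + 0) * indicator {x \<in> ball 0 2. a \<le> f x \<and> f x < b} x"
        by (intro tendsto_intros \<omega>_lim)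
      then show "(\<lambda>n. k (\<epsilon> n) (\<omega> n) x) \<longlonglongrightarrow> k' x"
        unfolding k_def k'_def using ev by (auto elim!: Lim_transform_eventually eventually_mono)
    qed
    show "k' \<in> borel_measurable lborel"
      unfolding k'_def by (intro borel_measurable_times borel_measurable_indicator) (auto simp: region)
  qed simp
  then have "c * (b - a) \<le> (\<integral>x. k' x \<partial>lborel)"
    by (rule LIMSEQ_le_const) (use step[OF \<epsilon>(1) order_trans[OF \<epsilon>(2) \<omega>(2)] \<omega> \<epsilon>(3)] in blast)
  \<comment> \<open>Passing from radius 2 to radius 1 is free because \<open>G\<close> vanishes off
    the unit disc.\<close>
  also have "(\<integral>x. k' x \<partial>lborel) = (LINT x:shell \<phi> a b|lborel. norm (G x))"
    unfolding set_lebesgue_integral_def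
  proof (rule Bochner_Integration.integral_cong)
    fix x
    show "k' x = indicator (shell \<phi> a b) x *\<^sub>R norm (G x)"
      using C1_disc_zero(2)[OF C1, of x] by (cases "x \<in> ball 0 1") (auto simp: k'_def shell_def f_def split: split_indicator)
  qed simp
  finally show ?thesis by (simp add: c_def m_def)
qed

section \<open>Isocapacitary inequality\<close>

lemma set_integral_nonneg:
  fixes f :: "'a \<Rightarrow> real"
  shows "(\<And>x. 0 \<le> f x) \<Longrightarrow> 0 \<le> (LINT x:A|M. f x)"
  unfolding set_lebesgue_integral_def by (intro integral_nonneg_AE AE_I2) simp

lemma set_integrable_shell:
  assumes "C1_disc \<phi> G"
  shows "set_integrable lborel (shell \<phi> a b) (\<lambda>x. norm (G x) ^ n)"
proof -
  note [measurable] = C1_disc_measurable[OF assms] sets_superlevel_shell[OF assms]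
  obtain C where C: "0 < C" "\<And>x. \<bar>\<phi> x\<bar> \<le> C" "\<And>x. norm (G x) \<le> C" using C1_disc_bounded[OF assms] by blast
  show ?thesis unfolding set_integrable_def
  proof (rule integrable_ball_bounded)
    show "\<bar>indicator (shell \<phi> a b) x *\<^sub>R norm (G x) ^ n\<bar> \<le> C ^ n * indicator (ball 0 1) x" for x
      using C(1) power_mono[OF C(3)[of x] norm_ge_zero, of n] by (auto simp: shell_def split: split_indicator)
  qed auto
qed

lemma set_integral_cauchy_schwarz:
  fixes f :: "'a \<Rightarrow> real"
  assumes A: "A \<in> fmeasurable M" and int: "set_integrable M A f" "set_integrable M A (\<lambda>x. (f x)\<^sup>2)"
  shows "(LINT x:A|M. f x)\<^sup>2 \<le> measure M A * (LINT x:A|M. (f x)\<^sup>2)"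
proof -
  let ?I = "LINT x:A|M. f x" and ?E = "LINT x:A|M. (f x)\<^sup>2"
  have intc: "set_integrable M A (\<lambda>x. c)" for c :: real
    using A by (auto simp: set_integrable_def fmeasurable_def less_top intro!: integrable_mult_left)
  have quad: "0 \<le> ?E - 2 * s * ?I + s\<^sup>2 * measure M A" for s
  proof -
    have "0 \<le> (LINT x:A|M. (f x)\<^sup>2 - 2 * s * f x + s\<^sup>2)"
    proof (rule set_integral_nonneg)
      fix x
      have "(f x)\<^sup>2 - 2 * s * f x + s\<^sup>2 = (f x - s)\<^sup>2" by (simp add: power2_diff)
      then show "0 \<le> (f x)\<^sup>2 - 2 * s * f x + s\<^sup>2" by simp
    qed
    also have "\<dots> = ?E - 2 * s * ?I + s\<^sup>2 * measure M A"
      using A int intc[of "s\<^sup>2"] by (simp add: set_integral_add set_integral_diff set_integral_mult_right set_integral_const fmeasurable_def less_top mult.commute)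
    finally show ?thesis .
  qed
  show ?thesis
  proof (cases "measure M A = 0")
    case True
    have "?I = 0"
    proof (rule ccontr)
      assume "?I \<noteq> 0"
      \<comment> \<open>With zero measure the quadratic degenerates to an affine function of
        \<open>s\<close>; this value of \<open>s\<close> makes it equal to -1.\<close>
      then show False using quad[of "(?E + 1) / (2 * ?I)"] True by simp
    qed
    then show ?thesis by (simp add: True)
  next
    case False
    then have pos: "0 < measure M A" using measure_nonneg[of M A] by linarith
    have "0 \<le> ?E - 2 * (?I / measure M A) * ?I + (?I / measure M A)\<^sup>2 * measure M A" by (rule quad)
    also have "\<dots> = ?E - ?I\<^sup>2 / measure M A" using pos by (simp add: power2_eq_square)
    finally show ?thesis using pos by (simp add: field_simps)
  qed
qed

lemma set_integral_shell_split:
  assumes C1: "C1_disc \<phi> G" and "a \<le> b" "b \<le> c"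
  shows "(dirichlet (shell \<phi> a c) G)
    = (dirichlet (shell \<phi> a b) G) + (dirichlet (shell \<phi> b c) G)"
proof -
  have "shell \<phi> a c = shell \<phi> a b \<union> shell \<phi> b c" "shell \<phi> a b \<inter> shell \<phi> b c = {}"
    using assms(2,3) by (auto simp: shell_def)
  then show ?thesis using set_integrable_shell[OF C1] by (simp add: set_integral_Un)
qed

lemma set_integral_shell_sum:
  assumes C1: "C1_disc \<phi> G" and r: "incseq r"
  shows "(dirichlet (shell \<phi> (r 0) (r n)) G)
    = (\<Sum>i<n. (dirichlet (shell \<phi> (r i) (r (Suc i))) G))"
proof (induction n)
  case 0
  then show ?case by (simp add: shell_def set_lebesgue_integral_def)
next
  case (Suc n)
  have "(dirichlet (shell \<phi> (r 0) (r (Suc n))) G)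
    = (dirichlet (shell \<phi> (r 0) (r n)) G) + (dirichlet (shell \<phi> (r n) (r (Suc n))) G)"
    using r by (intro set_integral_shell_split[OF C1]) (auto simp: incseq_def)
  then show ?case by (simp add: Suc.IH)
qed

lemma measure_shell:
  assumes C1: "C1_disc \<phi> G" and "a \<le> b"
  shows "measure lborel (shell \<phi> a b) = measure lborel (superlevel \<phi> a) - measure lborel (superlevel \<phi> b)"
proof -
  have "superlevel \<phi> t \<in> fmeasurable lborel" for t
    using sets_superlevel_shell[OF C1] by (auto intro!: fmeasurable_disc_subset[where r=1] simp: superlevel_def)
  moreover have "shell \<phi> a b = superlevel \<phi> a - superlevel \<phi> b" "superlevel \<phi> b \<subseteq> superlevel \<phi> a"
    using \<open>a \<le> b\<close> by (auto simp: shell_def superlevel_def)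
  ultimately show ?thesis
    using measurable_measure_Diff[of "superlevel \<phi> a" lborel "superlevel \<phi> b"] sets_superlevel_shell[OF C1] by simp
qed

text \<open>Sends the number \<open>N\<close> of pieces to infinity: the relative loss on a
  partition into \<open>N\<close> pieces is \<open>\<Lambda> / (2 * N)\<close>.\<close>

lemma le_of_harmonic_perturbation:
  fixes A B \<Lambda> :: real
  assumes bound: "\<And>N. 0 < N \<Longrightarrow> A * (1 - \<Lambda> / (2 * real N)) \<le> B"
  shows "A \<le> B"
proof -
  have "(\<lambda>N. A * (1 - \<Lambda> / 2 * inverse (real (Suc N)))) \<longlonglongrightarrow> A * (1 - \<Lambda> / 2 * 0)"
    by (intro tendsto_intros LIMSEQ_inverse_real_of_nat)
  moreover have "A * (1 - \<Lambda> / 2 * inverse (real (Suc N))) \<le> B" for N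
  proof -
    have "\<Lambda> / 2 * inverse (real (Suc N)) = \<Lambda> / (2 * real (Suc N))" by (metis divide_divide_eq_left divide_inverse)
    then show ?thesis using bound[of "Suc N"] by (metis zero_less_Suc)
  qed
  ultimately have "A * (1 - \<Lambda> / 2 * 0) \<le> B" using LIMSEQ_le_const2 by blast
  then show ?thesis by simp
qed
text \<open>
  On each piece of a uniform partition one loses the factor \<open>sqrt (q i)\<close>; as \<open>sqrt q \<ge> 1 + ln q / 2\<close> and
  the \<open>- ln (q i)\<close> sum up to \<open>\<Lambda>\<close>, the total loss vanishes with the mesh even if \<open>m\<close> jumps.
\<close>

lemma isocapacitary:
  assumes C1: "C1_disc \<phi> G" and ts: "0 \<le> t" "t < s" and pos: "0 < measure lborel (superlevel \<phi> s)"
  shows "4 * pi * (s - t)\<^sup>2 \<le> (dirichlet (shell \<phi> t s) G)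
     * ln (measure lborel (superlevel \<phi> t) / measure lborel (superlevel \<phi> s))"
proof -
  define m where "m r = measure lborel (superlevel \<phi> r)" for r
  define E where "E a b = (dirichlet (shell \<phi> a b) G)" for a b
  define \<Lambda> where "\<Lambda> = ln (m t / m s)"
  have E_nonneg: "0 \<le> E a b" for a b unfolding E_def by (intro set_integral_nonneg) auto
  have m_anti: "m b \<le> m a" if "a \<le> b" for a b
    using measure_shell[OF C1 that] measure_nonneg[of lborel "shell \<phi> a b"] by (simp add: m_def)
  have ms: "0 < m s" using pos by (simp add: m_def)
  have \<Lambda>: "0 \<le> \<Lambda>" using m_anti[of t s] ts ms by (simp add: \<Lambda>_def)
  have bound: "2 * sqrt pi * (s - t) * (1 - \<Lambda> / (2 * real N)) \<le> sqrt (E t s * \<Lambda>)" if N: "0 < N" for N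
  proof -
    define \<eta> where "\<eta> = (s - t) / N"
    define r where "r i = t + real i * \<eta>" for i
    have \<eta>: "0 < \<eta>" using ts N by (simp add: \<eta>_def)
    have r0: "r 0 = t" and rN: "r N = s" using N by (simp_all add: r_def \<eta>_def)
    have r_Suc: "r (Suc i) - r i = \<eta>" for i by (simp add: r_def algebra_simps)
    have r_inc: "incseq r" using \<eta> by (auto simp: incseq_def r_def intro!: mult_right_mono)
    have r_ge: "0 \<le> r i" for i using ts \<eta> by (simp add: r_def)
    have mpos: "0 < m (r i)" if "i \<le> N" for i using m_anti[of "r i" s] incseqD[OF r_inc that] rN ms by simp
    define q where "q i = m (r (Suc i)) / m (r i)" for i
    have q: "0 < q i" "q i \<le> 1" if "i < N" for i
      using mpos[of i] mpos[of "Suc i"] m_anti[of "r i" "r (Suc i)"] incseqD[OF r_inc, of i "Suc i"] that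
      by (auto simp: q_def)
    \<comment> \<open>The coarea bound on one thin shell, then Cauchy-Schwarz against its area
      \<open>m (r i) - m (r (Suc i))\<close>, then division by
      \<open>sqrt (m (r i))\<close>.\<close>
    have piece: "2 * sqrt pi * \<eta> * sqrt (q i) \<le> sqrt (E (r i) (r (Suc i))) * sqrt (1 - q i)" if i: "i < N" for i
    proof -
      let ?K = "LINT x:shell \<phi> (r i) (r (Suc i))|lborel. norm (G x)"
      have mi: "0 < m (r i)" using mpos i by simp
      have "2 * sqrt pi * sqrt (m (r (Suc i))) * \<eta> \<le> ?K"
        using coarea_isoperimetric[OF C1 r_ge, of i "r (Suc i)"] r_Suc[of i] \<eta> by (simp add: m_def)
      also have "?K \<le> sqrt (measure lborel (shell \<phi> (r i) (r (Suc i))) * E (r i) (r (Suc i)))"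
        unfolding E_def
      proof (intro real_le_rsqrt set_integral_cauchy_schwarz)
        show "shell \<phi> (r i) (r (Suc i)) \<in> fmeasurable lborel"
          using sets_superlevel_shell[OF C1] by (auto intro!: fmeasurable_disc_subset[where r=1] simp: shell_def)
      qed (use set_integrable_shell[OF C1, of _ _ 1] set_integrable_shell[OF C1, of _ _ 2] in simp_all)
      also have "measure lborel (shell \<phi> (r i) (r (Suc i))) = m (r i) - m (r (Suc i))"
        using measure_shell[OF C1, of "r i" "r (Suc i)"] incseqD[OF r_inc, of i "Suc i"] by (simp add: m_def)
      finally have "2 * sqrt pi * sqrt (m (r (Suc i))) * \<eta> / sqrt (m (r i))
          \<le> sqrt ((m (r i) - m (r (Suc i))) * E (r i) (r (Suc i))) / sqrt (m (r i))"
        using mi by (intro divide_right_mono) auto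
      moreover have "2 * sqrt pi * sqrt (m (r (Suc i))) * \<eta> / sqrt (m (r i)) = 2 * sqrt pi * \<eta> * sqrt (q i)"
        by (simp add: q_def real_sqrt_divide)
      moreover have "1 - q i = (m (r i) - m (r (Suc i))) / m (r i)" using mi by (simp add: q_def field_simps)
      ultimately show ?thesis by (simp add: real_sqrt_mult real_sqrt_divide mult.commute)
    qed
    have ln_q: "(\<Sum>i<n. ln (q i)) = ln (m (r n)) - ln (m t)" if "n \<le> N" for n using that
    proof (induction n)
      case (Suc n)
      then show ?case using mpos[of n] mpos[of "Suc n"] by (simp add: q_def ln_div)
    qed (simp add: r0)
    have "ln (m t / m s) = ln (m t) - ln (m s)" using ms m_anti[of t s] ts by (intro ln_divide_pos) auto
    then have sum_ln: "(\<Sum>i<N. - ln (q i)) = \<Lambda>"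
      using ln_q[of N] by (simp add: \<Lambda>_def rN sum_negf)
    have "2 * sqrt pi * (s - t) * (1 - \<Lambda> / (2 * real N)) = 2 * sqrt pi * \<eta> * (real N - \<Lambda> / 2)"
      using N by (simp add: \<eta>_def field_simps)
    also have "\<dots> \<le> 2 * sqrt pi * \<eta> * (\<Sum>i<N. sqrt (q i))"
    proof (rule mult_left_mono)
      have "real N - \<Lambda> / 2 = (\<Sum>i<N. 1 + ln (q i) / 2)"
        using sum_ln by (simp add: sum.distrib sum_divide_distrib[symmetric] sum_negf)
      also have "\<dots> \<le> (\<Sum>i<N. sqrt (q i))"
      proof (rule sum_mono)
        fix i assume "i \<in> {..<N}"
        then have qi: "0 < q i" using q by simp
        then have "0 < sqrt (q i)" by simp
        then have "ln (sqrt (q i)) \<le> sqrt (q i) - 1" by (rule ln_le_minus_one)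
        then show "1 + ln (q i) / 2 \<le> sqrt (q i)" using qi by (simp add: ln_sqrt)
      qed
      finally show "real N - \<Lambda> / 2 \<le> (\<Sum>i<N. sqrt (q i))" .
    qed (use \<eta> in auto)
    also have "\<dots> = (\<Sum>i<N. 2 * sqrt pi * \<eta> * sqrt (q i))" by (simp add: sum_distrib_left)
    also have "\<dots> \<le> (\<Sum>i<N. sqrt (E (r i) (r (Suc i))) * sqrt (1 - q i))" using piece by (intro sum_mono) auto
    \<comment> \<open>Discrete Cauchy-Schwarz separates the factors: the shell energies add up to
      \<open>E t s\<close>, and \<open>1 - q \<le> - ln q\<close> bounds the other sum by
      \<open>\<Lambda>\<close>.\<close>
    also have "\<dots> \<le> sqrt ((\<Sum>i<N. (sqrt (E (r i) (r (Suc i))))\<^sup>2) * (\<Sum>i<N. (sqrt (1 - q i))\<^sup>2))"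
      by (rule real_le_rsqrt[OF Cauchy_Schwarz_ineq_sum])
    also have "\<dots> \<le> sqrt (E t s * \<Lambda>)"
    proof (intro real_sqrt_le_mono mult_mono)
      have "(\<Sum>i<N. (sqrt (E (r i) (r (Suc i))))\<^sup>2) = (\<Sum>i<N. E (r i) (r (Suc i)))" by (simp add: E_nonneg)
      also have "\<dots> = E t s" using set_integral_shell_sum[OF C1 r_inc, of N] by (simp add: E_def r0 rN)
      finally show "(\<Sum>i<N. (sqrt (E (r i) (r (Suc i))))\<^sup>2) \<le> E t s" by simp
      have "(\<Sum>i<N. (sqrt (1 - q i))\<^sup>2) \<le> (\<Sum>i<N. - ln (q i))"
      proof (rule sum_mono)
        fix i assume "i \<in> {..<N}"
        then show "(sqrt (1 - q i))\<^sup>2 \<le> - ln (q i)" using q[of i] ln_le_minus_one[of "q i"] by simp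
      qed
      then show "(\<Sum>i<N. (sqrt (1 - q i))\<^sup>2) \<le> \<Lambda>" by (simp only: sum_ln)
    qed (auto intro: sum_nonneg E_nonneg)
    finally show ?thesis .
  qed
  have "2 * sqrt pi * (s - t) \<le> sqrt (E t s * \<Lambda>)" using bound by (rule le_of_harmonic_perturbation)
  then have "(2 * sqrt pi * (s - t))\<^sup>2 \<le> (sqrt (E t s * \<Lambda>))\<^sup>2"
    using ts by (intro power_mono) auto
  also have "\<dots> = E t s * \<Lambda>" using E_nonneg[of t s] \<Lambda> by simp
  finally show ?thesis by (simp add: power_mult_distrib E_def \<Lambda>_def m_def)
qed

section \<open>The one-dimensional Carleson--Chang inequality\<close>

text \<open>Up to a constant, \<open>e\<close> is the running integral of the squared slope of
  \<open>y\<close>. Recording it through derivatives keeps integrals out of the later arguments, and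
  the finite exceptional set admits the corners of piecewise affine paths.\<close>

definition energy_path :: "(real \<Rightarrow> real) \<Rightarrow> (real \<Rightarrow> real) \<Rightarrow> bool" where
  "energy_path y e \<longleftrightarrow> continuous_on UNIV y \<and> continuous_on UNIV e \<and>
     (\<exists>K. finite K \<and> (\<forall>t. t \<notin> K \<longrightarrow>
        (\<exists>d. (y has_real_derivative d) (at t) \<and> (e has_real_derivative d\<^sup>2) (at t))))"

lemma mono_except_finite:
  fixes g :: "real \<Rightarrow> real"
  assumes "finite K" "a \<le> b" "continuous_on {a..b} g"
    and der: "\<And>x. a < x \<Longrightarrow> x < b \<Longrightarrow> x \<notin> K \<Longrightarrow> \<exists>d\<ge>0. (g has_real_derivative d) (at x)"
  shows "g a \<le> g b"
proof -
  \<comment> \<open>Extending the derivative by 0 at the exceptional points makes it nonnegative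
    everywhere, while the fundamental theorem tolerates those finitely many points.\<close>
  define g' where "g' x = (if a < x \<and> x < b \<and> x \<notin> K
    then (SOME d. d \<ge> 0 \<and> (g has_real_derivative d) (at x)) else 0)" for x
  have g'_der: "g' x \<ge> 0 \<and> (g has_real_derivative g' x) (at x)" if "a < x" "x < b" "x \<notin> K" for x
    using someI_ex[OF der[OF that]] that unfolding g'_def by simp
  have g'_nonneg: "g' x \<ge> 0" for x
    using g'_der[of x] by (cases "a < x \<and> x < b \<and> x \<notin> K") (auto simp: g'_def)
  have "(g' has_integral (g b - g a)) {a..b}"
    using g'_der by (intro fundamental_theorem_of_calculus_interior_strong[OF assms(1,2) _ assms(3)])
      (auto simp: has_real_derivative_iff_has_vector_derivative)
  with g'_nonneg have "0 \<le> g b - g a" using has_integral_nonneg by blast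
  then show ?thesis by simp
qed

text \<open>The endpoint 0 is the point: in \<open>radial_onofri\<close> the quantity
  \<open>1 - R t\<close> vanishes at time 0.\<close>

lemma continuous_on_mult_ln: "continuous_on {0..} (\<lambda>x::real. x * ln x)"
proof (clarsimp simp: continuous_on_eq_continuous_within)
  fix x :: real assume "0 \<le> x"
  show "continuous (at x within {0..}) (\<lambda>x. x * ln x)"
  proof (cases "x = 0")
    case True
    have "((\<lambda>x::real. x * ln x) \<longlongrightarrow> 0) (at_right 0)" by real_asymp
    then show ?thesis using True by (auto simp: continuous_within at_within_Ici_at_right)
  next
    case False
    with \<open>0 \<le> x\<close> have "isCont (\<lambda>x. x * ln x) x" by (intro continuous_intros) auto
    then show ?thesis using continuous_at_imp_continuous_at_within by blast
  qed
qed

text \<open>This expression at \<open>R S\<close> is the final value of the auxiliary function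
  \<open>J\<close> in \<open>radial_onofri\<close>. It comes from \<open>ln z \<le> z - 1\<close> at
  \<open>z = 1 / (1 - x)\<close>.\<close>

lemma entropy_nonneg:
  fixes x :: real assumes "0 < x" "x \<le> 1" shows "0 \<le> x + (1 - x) * ln (1 - x)"
proof (cases "x = 1")
  case False
  with assms have "0 < 1 - x" by simp
  then have "ln (1 / (1 - x)) \<le> 1 / (1 - x) - 1" by (intro ln_le_minus_one) auto
  then have "- ln (1 - x) \<le> x / (1 - x)" using \<open>0 < 1 - x\<close> by (simp add: ln_div field_simps)
  then have "(1 - x) * (- ln (1 - x)) \<le> (1 - x) * (x / (1 - x))"
    using \<open>0 < 1 - x\<close> by (intro mult_left_mono) auto
  with \<open>0 < 1 - x\<close> show ?thesis by simp
qed auto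

lemma nn_integral_exp_tail:
  fixes k S :: real assumes "0 < k"
  shows "(\<integral>\<^sup>+ t\<in>{S..}. ennreal (exp (F - k * t)) \<partial>lborel) = ennreal (exp (F - k * S) / k)"
proof -
  have lim: "((\<lambda>t. - exp (F - k * t) / k) \<longlongrightarrow> - 0 / k) at_top"
    using assms by real_asymp
  have "(\<integral>\<^sup>+ t\<in>{S..}. ennreal (exp (F - k * t)) \<partial>lborel) = ennreal (- 0 / k - (- exp (F - k * S) / k))"
    using assms by (intro nn_integral_FTC_atLeast lim) (auto intro!: derivative_eq_intros)
  then show ?thesis by simp
qed

text \<open>
  With \<open>\<rho> = h / Z\<close> and its tail \<open>R\<close>, the inequality \<open>ln z \<le> z - 1\<close> at \<open>z = k R (1 - R) / \<rho>\<close> shows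
  \<open>J' \<le> c\<^sup>2 e' / k\<close>. The function \<open>J\<close> comes from integrating the dual (entropy) form of the inequality;
  its last bracket is the antiderivative of \<open>ln (R (1 - R))\<close>.
\<close>

lemma radial_onofri:
  assumes "energy_path y e" and k: "0 < k" and S: "0 \<le> S" and const: "\<And>t. S \<le> t \<Longrightarrow> y t = y S"
  shows "(\<integral>\<^sup>+ t\<in>{0..}. ennreal (exp (2 * c * (y t - y 0) - k * t)) \<partial>lborel)
         \<le> ennreal (exp (1 + c\<^sup>2 * (e S - e 0) / k) / k)"
proof -
  from assms(1) obtain K where cy: "continuous_on UNIV y" and ce: "continuous_on UNIV e" and K: "finite K"
    and der: "\<And>t. t \<notin> K \<Longrightarrow> \<exists>d. (y has_real_derivative d) (at t) \<and> (e has_real_derivative d\<^sup>2) (at t)"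
    unfolding energy_path_def by auto
  have [measurable]: "y \<in> borel_measurable borel" using cy by (rule borel_measurable_continuous_onI)
  have cont_y: "continuous_on A y" and cont_e: "continuous_on A e" for A
    using cy ce continuous_on_subset by blast+
  define f where "f t = 2 * c * (y t - y 0)" for t
  define h where "h s = exp (f s - k * s)" for s
  define P where "P t = integral {0..t} h" for t
  \<comment> \<open>Beyond \<open>S\<close> the path is constant and the mass is the explicit second
    summand. So \<open>Z\<close> is the whole integral to be bounded, and \<open>R t\<close> is the
    fraction of it beyond \<open>t\<close>, equal to 1 at time 0 and still positive at
    \<open>S\<close>.\<close>
  define Z where "Z = P S + exp (f S - k * S) / k"
  define R where "R t = (Z - P t) / Z" for t
  define J where "J t = R t * (f t - k * t) - R t * (ln Z + ln k + 1)
     - (R t * ln (R t) - (1 - R t) * ln (1 - R t) - 2 * R t)" for t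
  have cont_h: "continuous_on A h" for A unfolding h_def f_def by (intro continuous_intros cont_y)
  have h_int: "h integrable_on {a..b}" for a b using cont_h by (rule integrable_continuous_real)
  have h_pos: "0 < h s" for s by (simp add: h_def)
  have P_mono: "P a < P b" if "0 \<le> a" "a < b" for a b
  proof -
    have "P b = P a + integral {a..b} h"
      unfolding P_def using that by (subst Henstock_Kurzweil_Integration.integral_combine) (auto intro: h_int)
    moreover have "integral {a..b} h > 0"
      using integral_less_real[OF continuous_on_const[of _ 0] cont_h, of a b] that h_pos by auto
    ultimately show ?thesis by simp
  qed
  have P0: "P 0 = 0" by (simp add: P_def)
  have Z_gt: "P S < Z" using k by (simp add: Z_def)
  have PS: "0 \<le> P S" using P_mono[of 0 S] S P0 by (cases "S = 0") auto
  have Z: "0 < Z" using Z_gt PS by simp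
  have R0: "R 0 = 1" using Z by (simp add: R_def P0)
  have RS: "R S = exp (f S - k * S) / (k * Z)" by (simp add: R_def Z_def)
  have R_pos: "0 < R t" if "0 \<le> t" "t \<le> S" for t
    using that P_mono[of t S] Z_gt Z by (cases "t = S") (auto simp: R_def)
  have R_lt: "R t < 1" if "0 < t" "t \<le> S" for t
    using that P_mono[of 0 t] Z P0 by (auto simp: R_def field_simps)
  have R_le: "R t \<le> 1" if "0 \<le> t" "t \<le> S" for t using R_lt[of t] R0 that by (cases "t = 0") auto
  have cont_P: "continuous_on {0..S} P" unfolding P_def by (rule indefinite_integral_continuous_1[OF h_int])
  have cont_R: "continuous_on {0..S} R" unfolding R_def by (intro continuous_intros cont_P) (use Z in auto)
  have cont_1: "continuous_on {0..S} (\<lambda>t. R t * ln (R t))"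
    using R_pos by (intro continuous_on_compose2[OF continuous_on_mult_ln cont_R]) (auto intro: less_imp_le)
  have cont_2: "continuous_on {0..S} (\<lambda>t. (1 - R t) * ln (1 - R t))"
    using R_le by (intro continuous_on_compose2[OF continuous_on_mult_ln] continuous_on_diff continuous_on_const cont_R) auto
  have cont_J: "continuous_on {0..S} J"
    unfolding J_def f_def by (intro continuous_on_diff continuous_on_add continuous_on_mult
      continuous_on_const continuous_on_id cont_1 cont_2 cont_R cont_y)
  have main: "J S - J 0 \<le> c\<^sup>2 / k * e S - c\<^sup>2 / k * e 0"
  proof -
    have "c\<^sup>2 / k * e 0 - J 0 \<le> c\<^sup>2 / k * e S - J S"
    proof (rule mono_except_finite[OF K S, where g="\<lambda>t. c\<^sup>2 / k * e t - J t"])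
      show "continuous_on {0..S} (\<lambda>t. c\<^sup>2 / k * e t - J t)" by (intro continuous_intros cont_e cont_J)
      fix t assume t: "0 < t" "t < S" "t \<notin> K"
      then obtain d where d: "(y has_real_derivative d) (at t)" "(e has_real_derivative d\<^sup>2) (at t)"
        using der by blast
      have Rt: "0 < R t" "R t < 1" using R_pos R_lt t by auto
      define \<rho> where "\<rho> = h t / Z"
      have \<rho>: "0 < \<rho>" using h_pos Z by (simp add: \<rho>_def)
      have "(P has_real_derivative h t) (at t within {0..S})"
        unfolding P_def using t by (intro integral_has_real_derivative cont_h) auto
      then have dP: "(P has_real_derivative h t) (at t)" using t at_within_Icc_at[of 0 t S] by simp
      have dR: "(R has_real_derivative - \<rho>) (at t)"
        unfolding R_def \<rho>_def using DERIV_cdivide[OF DERIV_diff[OF DERIV_const dP], of Z Z] by simp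
      have df: "(f has_real_derivative 2 * c * d) (at t)"
        using DERIV_cmult[OF DERIV_diff[OF d(1) DERIV_const], of "2 * c" "y 0"] by (simp add: f_def[abs_def])
      define J' where "J' = - \<rho> * (f t - k * t) + R t * (2 * c * d - k) + \<rho> * (ln Z + ln k + 1)
         + \<rho> * (ln (R t) + ln (1 - R t))"
      have dJ: "(J has_real_derivative J') (at t)"
      proof -
        have dl: "((\<lambda>t. ln (R t)) has_real_derivative - \<rho> / R t) (at t)"
          "((\<lambda>t. ln (1 - R t)) has_real_derivative \<rho> / (1 - R t)) (at t)"
          using DERIV_chain2[OF DERIV_ln_divide[OF Rt(1)] dR] Rt
            DERIV_chain2[OF DERIV_ln_divide[of "1 - R t"] DERIV_diff[OF DERIV_const dR, of 1]] by simp_all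
        have "(J has_real_derivative (- \<rho> * (f t - k * t) + (2 * c * d - k) * R t) - - \<rho> * (ln Z + ln k + 1)
          - (((- \<rho> * ln (R t) + - \<rho> / R t * R t) - ((0 - - \<rho>) * ln (1 - R t) + \<rho> / (1 - R t) * (1 - R t))) - 2 * - \<rho>)) (at t)"
          unfolding J_def
          by (intro DERIV_diff DERIV_mult DERIV_cmult DERIV_cmult_right DERIV_const dR df dl DERIV_cmult_Id)
        moreover have "- \<rho> / R t * R t = - \<rho>" "\<rho> / (1 - R t) * (1 - R t) = \<rho>" using Rt by auto
        ultimately show ?thesis unfolding J'_def by (simp add: algebra_simps)
      qed
      have "ln \<rho> = f t - k * t - ln Z" using Z by (simp add: \<rho>_def h_def ln_div)
      then have ft: "f t - k * t = ln \<rho> + ln Z" by simp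
      have "ln (k * R t * (1 - R t) / \<rho>) \<le> k * R t * (1 - R t) / \<rho> - 1"
        using k Rt \<rho> by (intro ln_le_minus_one) auto
      then have "\<rho> * ln (k * R t * (1 - R t) / \<rho>) \<le> \<rho> * (k * R t * (1 - R t) / \<rho> - 1)"
        using \<rho> by (intro mult_left_mono) auto
      also have "\<dots> = k * R t * (1 - R t) - \<rho>" using \<rho> by (simp add: field_simps)
      finally have 1: "\<rho> * (ln k + ln (R t) + ln (1 - R t) - ln \<rho>) \<le> k * R t * (1 - R t) - \<rho>"
        using k Rt \<rho> by (simp add: ln_div ln_mult)
      \<comment> \<open>After the logarithmic inequality, \<open>J'\<close> is at most
        \<open>2 * c * d * R t - k * (R t)\<^sup>2\<close>; completing the square trades this for
        the energy density. Equality in the logarithmic step would mean the logistic law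
        \<open>\<rho> = k * R * (1 - R)\<close>.\<close>
      have "0 \<le> (c * d - k * R t)\<^sup>2 / k" using k by simp
      also have "\<dots> = c\<^sup>2 * d\<^sup>2 / k - 2 * c * d * R t + k * (R t)\<^sup>2"
        using k by (simp add: power2_eq_square field_simps)
      finally have 2: "2 * c * d * R t - k * (R t)\<^sup>2 \<le> c\<^sup>2 / k * d\<^sup>2" by simp
      have "J' \<le> c\<^sup>2 / k * d\<^sup>2"
        using 1 2 unfolding J'_def ft by (simp add: algebra_simps power2_eq_square)
      moreover have "((\<lambda>t. c\<^sup>2 / k * e t - J t) has_real_derivative c\<^sup>2 / k * d\<^sup>2 - J') (at t)"
        by (intro DERIV_diff DERIV_cmult d dJ)
      ultimately show "\<exists>x\<ge>0. ((\<lambda>t. c\<^sup>2 / k * e t - J t) has_real_derivative x) (at t)"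
        by (intro exI[of _ "c\<^sup>2 / k * d\<^sup>2 - J'"]) auto
    qed
    then show ?thesis by simp
  qed
  \<comment> \<open>At \<open>S\<close> the logarithm of \<open>Z\<close> drops out of
    \<open>J\<close>, whereas \<open>J 0\<close> still contains it; the difference therefore bounds
    \<open>ln Z\<close>.\<close>
  have "ln (R S) = f S - k * S - ln k - ln Z" using RS k Z by (simp add: ln_div ln_mult)
  then have "f S - k * S = ln (R S) + (ln Z + ln k)" by simp
  then have "J S = R S + (1 - R S) * ln (1 - R S)" unfolding J_def by (simp add: ring_distribs)
  then have "0 \<le> J S" using entropy_nonneg[OF R_pos[OF S order.refl] R_le[OF S order.refl]] by linarith
  moreover have "J 0 = 1 - ln Z - ln k" by (simp add: J_def R0 f_def)
  moreover have "c\<^sup>2 / k * e S - c\<^sup>2 / k * e 0 = c\<^sup>2 * (e S - e 0) / k" using k by (simp add: field_simps)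
  ultimately have "ln Z \<le> 1 + c\<^sup>2 * (e S - e 0) / k - ln k" using main by linarith
  then have "exp (ln Z) \<le> exp (1 + c\<^sup>2 * (e S - e 0) / k - ln k)" by simp
  then have Z_le: "Z \<le> exp (1 + c\<^sup>2 * (e S - e 0) / k) / k" using Z k by (simp add: exp_diff)
  have [measurable]: "f \<in> borel_measurable borel" "h \<in> borel_measurable borel" unfolding f_def h_def by measurable
  have fS: "f t = f S" if "S \<le> t" for t using const[OF that] by (simp add: f_def)
  have "(\<integral>\<^sup>+ t\<in>{0..}. ennreal (h t) \<partial>lborel)
      \<le> (\<integral>\<^sup>+ t. ennreal (h t) * indicator {0..S} t + ennreal (exp (f S - k * t)) * indicator {S..} t \<partial>lborel)"
  proof (intro nn_integral_mono)
    fix t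
    show "ennreal (h t) * indicator {0..} t
        \<le> ennreal (h t) * indicator {0..S} t + ennreal (exp (f S - k * t)) * indicator {S..} t"
      using fS[of t] by (cases "t \<le> S") (auto simp: h_def split: split_indicator)
  qed
  also have "\<dots> = (\<integral>\<^sup>+ t\<in>{0..S}. ennreal (h t) \<partial>lborel) + (\<integral>\<^sup>+ t\<in>{S..}. ennreal (exp (f S - k * t)) \<partial>lborel)"
    by (intro nn_integral_add) auto
  also have "(\<integral>\<^sup>+ t\<in>{0..S}. ennreal (h t) \<partial>lborel) = ennreal (P S)"
  proof -
    have "(h has_integral P S) {0..S}" unfolding P_def by (rule integrable_integral[OF h_int])
    from nn_integral_has_integral_lebesgue'[OF _ this] show ?thesis using less_imp_le[OF h_pos] by blast
  qed
  also have "(\<integral>\<^sup>+ t\<in>{S..}. ennreal (exp (f S - k * t)) \<partial>lborel) = ennreal (exp (f S - k * S) / k)"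
    by (rule nn_integral_exp_tail[OF k])
  also have "ennreal (P S) + ennreal (exp (f S - k * S) / k) = ennreal Z" using PS k by (simp add: Z_def)
  also have "\<dots> \<le> ennreal (exp (1 + c\<^sup>2 * (e S - e 0) / k) / k)" using Z_le by (rule ennreal_leI)
  finally show ?thesis unfolding h_def f_def .
qed

section \<open>Estimates along paths of bounded energy\<close>

abbreviation (input) moser_path :: "(real \<Rightarrow> real) \<Rightarrow> ennreal" where
  "moser_path y \<equiv> \<integral>\<^sup>+ t\<in>{0..}. ennreal (exp ((y t)\<^sup>2 - t)) \<partial>lborel"

text \<open>Cauchy-Schwarz in linearised form: for a fixed slope \<open>\<kappa>\<close> the
  difference of the two sides has derivative \<open>(\<kappa> - d)\<^sup>2\<close>. Taking
  \<open>\<kappa> = 0\<close> gives monotonicity of \<open>e\<close>, and taking the mean slope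
  gives the quadratic inequality.\<close>

lemma energy_path_ineq:
  assumes "energy_path y e" "s \<le> t"
  shows "2 * \<kappa> * (y t - y s) \<le> \<kappa>\<^sup>2 * (t - s) + (e t - e s)"
proof -
  from assms(1) obtain K where cont: "continuous_on UNIV y" "continuous_on UNIV e" and K: "finite K"
    and der: "\<And>t. t \<notin> K \<Longrightarrow> \<exists>d. (y has_real_derivative d) (at t) \<and> (e has_real_derivative d\<^sup>2) (at t)"
    unfolding energy_path_def by auto
  have "\<kappa>\<^sup>2 * s + e s - 2 * \<kappa> * y s \<le> \<kappa>\<^sup>2 * t + e t - 2 * \<kappa> * y t"
  proof (rule mono_except_finite[OF K assms(2), where g="\<lambda>t. \<kappa>\<^sup>2 * t + e t - 2 * \<kappa> * y t"])
    show "continuous_on {s..t} (\<lambda>t. \<kappa>\<^sup>2 * t + e t - 2 * \<kappa> * y t)"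
      by (intro continuous_intros) (use cont continuous_on_subset in blast)+
    fix x assume "x \<notin> K"
    then obtain d where d: "(y has_real_derivative d) (at x)" "(e has_real_derivative d\<^sup>2) (at x)"
      using der by blast
    have "((\<lambda>t. \<kappa>\<^sup>2 * t + e t - 2 * \<kappa> * y t) has_real_derivative \<kappa>\<^sup>2 + d\<^sup>2 - 2 * \<kappa> * d) (at x)"
      by (intro DERIV_diff DERIV_add DERIV_cmult_Id DERIV_cmult d)
    moreover have "\<kappa>\<^sup>2 + d\<^sup>2 - 2 * \<kappa> * d = (\<kappa> - d)\<^sup>2" by (simp add: power2_diff)
    ultimately show "\<exists>d\<ge>0. ((\<lambda>t. \<kappa>\<^sup>2 * t + e t - 2 * \<kappa> * y t) has_real_derivative d) (at x)"
      by (metis zero_le_power2)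
  qed
  then show ?thesis by (simp add: algebra_simps)
qed

lemma energy_path_mono: "energy_path y e \<Longrightarrow> s \<le> t \<Longrightarrow> e s \<le> e t"
  using energy_path_ineq[of y e s t 0] by simp

lemma energy_path_cauchy_schwarz:
  assumes "energy_path y e" "s \<le> t"
  shows "(y t - y s)\<^sup>2 \<le> (t - s) * (e t - e s)"
proof (cases "s = t")
  case False
  with assms have st: "0 < t - s" by simp
  define \<kappa> where "\<kappa> = (y t - y s) / (t - s)"
  have "(y t - y s)\<^sup>2 / (t - s) = 2 * \<kappa> * (y t - y s) - \<kappa>\<^sup>2 * (t - s)"
    using st by (simp add: \<kappa>_def power2_eq_square)
  also have "\<dots> \<le> e t - e s" using energy_path_ineq[OF assms, of \<kappa>] by simp
  finally show ?thesis using st by (simp add: field_simps)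
qed auto

lemma energy_path_shift:
  assumes "energy_path y e"
  shows "energy_path (\<lambda>s. y (a + s)) (\<lambda>s. e (a + s))"
proof -
  from assms obtain K where cont: "continuous_on UNIV y" "continuous_on UNIV e" and K: "finite K"
    and der: "\<And>t. t \<notin> K \<Longrightarrow> \<exists>d. (y has_real_derivative d) (at t) \<and> (e has_real_derivative d\<^sup>2) (at t)"
    unfolding energy_path_def by auto
  have sh: "((\<lambda>s. f (a + s)) has_real_derivative d) (at s)" if "(f has_real_derivative d) (at (a + s))" for f d s
    using that DERIV_shift[of f d s a] by (simp add: add.commute)
  show ?thesis unfolding energy_path_def
  proof (intro conjI exI[of _ "(\<lambda>t. t - a) ` K"] allI impI)
    show "continuous_on UNIV (\<lambda>s. y (a + s))" "continuous_on UNIV (\<lambda>s. e (a + s))"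
      by (auto intro!: continuous_on_compose2[OF cont(1)] continuous_on_compose2[OF cont(2)] continuous_intros)
    fix t assume "t \<notin> (\<lambda>t. t - a) ` K"
    then have "a + t \<notin> K" by (force simp: image_iff)
    from der[OF this] show "\<exists>d. ((\<lambda>s. y (a + s)) has_real_derivative d) (at t) \<and> ((\<lambda>s. e (a + s)) has_real_derivative d\<^sup>2) (at t)"
      using sh by blast
  qed (use K in auto)
qed

lemma energy_path_measurable: "energy_path y e \<Longrightarrow> y \<in> borel_measurable borel"
  unfolding energy_path_def by (auto intro: borel_measurable_continuous_onI)

text \<open>Expand the square of \<open>y\<close> around \<open>y a\<close>. The squared increment
  over time \<open>s\<close> is at most \<open>s * \<delta>\<close> and is absorbed into the drift,
  whose rate falls from 1 to \<open>k = 1 - \<delta>\<close>. What remains is linear in the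
  increment, the situation of \<open>radial_onofri\<close> with \<open>c = y a\<close>.\<close>

lemma carleson_chang_tail:
  assumes ye: "energy_path y e" and S: "a \<le> S" and const: "\<And>t. S \<le> t \<Longrightarrow> y t = y S \<and> e t = e S"
    and lt: "e S - e a < 1"
  shows "(\<integral>\<^sup>+ t\<in>{a..}. ennreal (exp ((y t)\<^sup>2 - t)) \<partial>lborel)
      \<le> ennreal (exp (1 + (y a)\<^sup>2 / (1 - (e S - e a)) - a) / (1 - (e S - e a)))"
proof -
  define \<delta> where "\<delta> = e S - e a"
  define k where "k = 1 - \<delta>"
  have \<delta>: "0 \<le> \<delta>" using energy_path_mono[OF ye S] by (simp add: \<delta>_def)
  have k: "0 < k" using lt by (simp add: k_def \<delta>_def)
  note [measurable] = energy_path_measurable[OF ye]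
  have e_le: "e t \<le> e S" for t using energy_path_mono[OF ye, of t S] const[of t] by (cases "t \<le> S") auto
  have "(\<integral>\<^sup>+ t\<in>{a..}. ennreal (exp ((y t)\<^sup>2 - t)) \<partial>lborel)
      = (\<integral>\<^sup>+ s. ennreal (exp ((y (a + s))\<^sup>2 - (a + s))) * indicator {a..} (a + s) \<partial>lborel)"
    using nn_integral_real_affine[of "\<lambda>t. ennreal (exp ((y t)\<^sup>2 - t)) * indicator {a..} t" 1 a] by simp
  also have "\<dots> \<le> (\<integral>\<^sup>+ s. ennreal (exp ((y a)\<^sup>2 - a)) *
      (ennreal (exp (2 * y a * (y (a + s) - y (a + 0)) - k * s)) * indicator {0..} s) \<partial>lborel)"
  proof (intro nn_integral_mono)
    fix s
    show "ennreal (exp ((y (a + s))\<^sup>2 - (a + s))) * indicator {a..} (a + s) \<le> ennreal (exp ((y a)\<^sup>2 - a)) *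
      (ennreal (exp (2 * y a * (y (a + s) - y (a + 0)) - k * s)) * indicator {0..} s)"
    proof (cases "0 \<le> s")
      case True
      have "(y (a + s) - y a)\<^sup>2 \<le> s * (e (a + s) - e a)"
        using energy_path_cauchy_schwarz[OF ye, of a "a + s"] True by simp
      also have "\<dots> \<le> s * \<delta>" using True e_le[of "a + s"] by (intro mult_left_mono) (auto simp: \<delta>_def)
      finally have "(y (a + s))\<^sup>2 - (a + s) \<le> ((y a)\<^sup>2 - a) + (2 * y a * (y (a + s) - y a) - k * s)"
        by (simp add: k_def power2_eq_square algebra_simps)
      then have "exp ((y (a + s))\<^sup>2 - (a + s)) \<le> exp ((y a)\<^sup>2 - a) * exp (2 * y a * (y (a + s) - y a) - k * s)"
        by (simp add: exp_add[symmetric])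
      then show ?thesis using True by (simp add: ennreal_mult[symmetric] ennreal_leI)
    qed auto
  qed
  also have "\<dots> = ennreal (exp ((y a)\<^sup>2 - a)) *
      (\<integral>\<^sup>+ s\<in>{0..}. ennreal (exp (2 * y a * (y (a + s) - y (a + 0)) - k * s)) \<partial>lborel)"
    by (intro nn_integral_cmult) measurable
  also have "\<dots> \<le> ennreal (exp ((y a)\<^sup>2 - a)) *
      ennreal (exp (1 + (y a)\<^sup>2 * (e (a + (S - a)) - e (a + 0)) / k) / k)"
  proof (rule mult_left_mono)
    show "(\<integral>\<^sup>+ s\<in>{0..}. ennreal (exp (2 * y a * (y (a + s) - y (a + 0)) - k * s)) \<partial>lborel)
      \<le> ennreal (exp (1 + (y a)\<^sup>2 * (e (a + (S - a)) - e (a + 0)) / k) / k)"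
    proof (rule radial_onofri[OF energy_path_shift[OF ye] k])
      show "0 \<le> S - a" using S by simp
      show "y (a + t) = y (a + (S - a))" if "S - a \<le> t" for t using const[of "a + t"] that by simp
    qed
  qed auto
  also have "\<dots> = ennreal (exp ((y a)\<^sup>2 - a + (1 + (y a)\<^sup>2 * \<delta> / k)) / k)"
    using k by (simp add: ennreal_mult[symmetric] exp_add \<delta>_def)
  also have "(y a)\<^sup>2 - a + (1 + (y a)\<^sup>2 * \<delta> / k) = 1 + (y a)\<^sup>2 / k - a"
  proof -
    have "(y a)\<^sup>2 + (y a)\<^sup>2 * \<delta> / k = (y a)\<^sup>2 * (k + \<delta>) / k" using k by (simp add: field_simps)
    also have "k + \<delta> = 1" by (simp add: k_def)
    finally show ?thesis by simp
  qed
  finally show ?thesis by (simp add: k_def \<delta>_def)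
qed

lemma nn_integral_inverse_square_tail:
  fixes M :: real assumes "0 < M"
  shows "(\<integral>\<^sup>+ t\<in>{M..}. ennreal (1 / t\<^sup>2) \<partial>lborel) = ennreal (1 / M)"
proof -
  have "(\<integral>\<^sup>+ t\<in>{M..}. ennreal (1 / t\<^sup>2) \<partial>lborel) = ennreal (0 - (- inverse M))"
  proof (rule nn_integral_FTC_atLeast)
    show "((\<lambda>t. - inverse t) has_real_derivative 1 / t\<^sup>2) (at t)" if "M \<le> t" for t
      using DERIV_minus[OF DERIV_inverse[of t]] assms that
      by (simp add: power2_eq_square divide_inverse numeral_2_eq_2)
    have "((\<lambda>t::real. - inverse t) \<longlongrightarrow> - 0) at_top"
      by (intro tendsto_minus tendsto_inverse_0_at_top filterlim_ident)
    then show "((\<lambda>t::real. - inverse t) \<longlongrightarrow> 0) at_top" by simp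
  qed auto
  then show ?thesis by (simp add: divide_inverse)
qed

text \<open>The error is split into thirds. \<open>\<eta>\<close> is chosen so that the initial
  interval contributes at most \<open>1 + \<epsilon> / 3\<close>, \<open>\<theta>\<close> so that
  the tail bound \<open>exp 1 / (1 - \<theta>)\<close> equals \<open>exp 1 + \<epsilon> / 3\<close>,
  and \<open>M\<close> so that the middle part costs at most
  \<open>1 / M \<le> \<epsilon> / 3\<close>. None of these depends on the path.\<close>

theorem carleson_chang:
  fixes \<epsilon> :: real assumes \<epsilon>: "0 < \<epsilon>"
  obtains M \<eta> :: real where "0 < M" "0 < \<eta>"
    "\<And>y e S. energy_path y e \<Longrightarrow> y 0 = 0 \<Longrightarrow> e 0 = 0 \<Longrightarrow> (\<And>t. S \<le> t \<Longrightarrow> y t = y S \<and> e t = e S) \<Longrightarrow> e S \<le> 1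
      \<Longrightarrow> (\<And>t. 0 \<le> t \<Longrightarrow> t \<le> M \<Longrightarrow> \<bar>y t\<bar> \<le> \<eta>)
      \<Longrightarrow> (moser_path y) \<le> ennreal (1 + exp 1 + \<epsilon>)"
proof -
  define \<eta> where "\<eta> = min 1 (sqrt (ln (1 + \<epsilon> / 3)))"
  have \<eta>: "0 < \<eta>" "\<eta> \<le> 1" using \<epsilon> by (auto simp: \<eta>_def)
  have "\<eta>\<^sup>2 \<le> (sqrt (ln (1 + \<epsilon> / 3)))\<^sup>2" using \<eta> by (intro power_mono) (auto simp: \<eta>_def)
  then have "\<eta>\<^sup>2 \<le> ln (1 + \<epsilon> / 3)" using \<epsilon> by simp
  then have exp_\<eta>: "exp (\<eta>\<^sup>2) \<le> 1 + \<epsilon> / 3" using \<epsilon> by (metis exp_le_cancel_iff exp_ln add_pos_pos zero_less_one divide_pos_pos zero_less_numeral)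
  define \<theta> where "\<theta> = \<epsilon> / 3 / (exp 1 + \<epsilon> / 3)"
  have e\<epsilon>: "0 < exp 1 + \<epsilon> / 3" using \<epsilon> by (simp add: add_pos_pos)
  have \<theta>: "0 < \<theta>" "\<theta> < 1" using \<epsilon> e\<epsilon> by (auto simp: \<theta>_def field_simps)
  have "1 - \<theta> = exp 1 / (exp 1 + \<epsilon> / 3)" using e\<epsilon> by (simp add: \<theta>_def field_simps)
  then have exp_\<theta>: "exp 1 / (1 - \<theta>) = exp 1 + \<epsilon> / 3" by simp
  have "\<forall>\<^sub>F a :: real in at_top. ln a / a < \<theta> / 2"
    using order_tendstoD(2)[OF ln_x_over_x_tendsto_0, of "\<theta> / 2"] \<theta> by simp
  then obtain N :: real where N: "\<And>a. N \<le> a \<Longrightarrow> ln a / a < \<theta> / 2"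
    by (auto simp: eventually_at_top_linorder)
  \<comment> \<open>Beyond \<open>N\<close>, a path that has reached the barrier has at most the
    fraction \<open>\<theta>\<close> of its energy left.\<close>
  define M where "M = max N (max (3 / \<epsilon>) (2 / (1 - \<theta>)))"
  have "2 / (1 - \<theta>) \<le> M" by (simp add: M_def)
  then have M2: "2 \<le> M * (1 - \<theta>)" using \<theta> by (simp add: field_simps)
  have M: "0 < M" "1 / M \<le> \<epsilon> / 3"
  proof -
    have "0 < 3 / \<epsilon>" "3 / \<epsilon> \<le> M" using \<epsilon> by (auto simp: M_def)
    then show "0 < M" by linarith
    with \<open>3 / \<epsilon> \<le> M\<close> \<epsilon> show "1 / M \<le> \<epsilon> / 3" by (simp add: field_simps)
  qed
  have M_ln: "2 * ln a / a \<le> \<theta>" "a * (1 - \<theta>) \<le> a - 2 * ln a" if "M \<le> a" for a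
  proof -
    have "ln a / a < \<theta> / 2" using N that by (simp add: M_def)
    then show "2 * ln a / a \<le> \<theta>" by (simp add: mult.commute)
    then show "a * (1 - \<theta>) \<le> a - 2 * ln a" using that M by (simp add: field_simps)
  qed
  show thesis
  proof (rule that[OF \<open>0 < M\<close> \<open>0 < \<eta>\<close>])
    fix y e S
    assume ye: "energy_path y e" and y0: "y 0 = 0" and e0: "e 0 = 0"
      and const: "\<And>t. S \<le> t \<Longrightarrow> y t = y S \<and> e t = e S" and eS: "e S \<le> 1"
      and small: "\<And>t. 0 \<le> t \<Longrightarrow> t \<le> M \<Longrightarrow> \<bar>y t\<bar> \<le> \<eta>"
    note [measurable] = energy_path_measurable[OF ye]
    let ?F = "\<lambda>t. ennreal (exp ((y t)\<^sup>2 - t))"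
    have initial: "(\<integral>\<^sup>+ t\<in>{0..M}. ?F t \<partial>lborel) \<le> ennreal (1 + \<epsilon> / 3)"
    proof -
      have "(\<integral>\<^sup>+ t\<in>{0..M}. ?F t \<partial>lborel) \<le> (\<integral>\<^sup>+ t\<in>{0..}. ennreal (exp (\<eta>\<^sup>2 - 1 * t)) \<partial>lborel)"
      proof (intro nn_integral_mono)
        fix t
        have "(y t)\<^sup>2 \<le> \<eta>\<^sup>2" if "0 \<le> t" "t \<le> M"
          using small[OF that] \<eta> by (metis abs_le_square_iff abs_of_pos)
        then show "?F t * indicator {0..M} t \<le> ennreal (exp (\<eta>\<^sup>2 - 1 * t)) * indicator {0..} t"
          by (auto split: split_indicator intro!: ennreal_leI)
      qed
      also have "\<dots> = ennreal (exp (\<eta>\<^sup>2))" by (subst nn_integral_exp_tail) auto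
      finally show ?thesis using exp_\<eta> by (meson ennreal_leI order_trans)
    qed
    have middle: "(\<integral>\<^sup>+ t\<in>A. ?F t \<partial>lborel) \<le> ennreal (\<epsilon> / 3)"
      if A: "\<And>t. t \<in> A \<Longrightarrow> M \<le> t \<and> (y t)\<^sup>2 \<le> t - 2 * ln t" for A
    proof -
      have "(\<integral>\<^sup>+ t\<in>A. ?F t \<partial>lborel) \<le> (\<integral>\<^sup>+ t\<in>{M..}. ennreal (1 / t\<^sup>2) \<partial>lborel)"
      proof (intro nn_integral_mono)
        fix t
        have "exp ((y t)\<^sup>2 - t) \<le> 1 / t\<^sup>2" if "t \<in> A"
        proof -
          have t: "0 < t" "(y t)\<^sup>2 - t \<le> - (2 * ln t)" using A[OF that] M by auto
          have "exp ((y t)\<^sup>2 - t) \<le> exp (- (2 * ln t))" using t by simp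
          also have "\<dots> = 1 / t\<^sup>2" using t by (simp add: exp_minus exp_double divide_inverse)
          finally show ?thesis .
        qed
        then show "?F t * indicator A t \<le> ennreal (1 / t\<^sup>2) * indicator {M..} t"
          using A[of t] by (auto split: split_indicator intro!: ennreal_leI)
      qed
      also have "\<dots> = ennreal (1 / M)" by (rule nn_integral_inverse_square_tail[OF \<open>0 < M\<close>])
      finally show ?thesis using M(2) by (meson ennreal_leI order_trans)
    qed
    have yM: "(y M)\<^sup>2 < M - 2 * ln M"
    proof -
      have "(y M)\<^sup>2 \<le> 1" using small[of M] \<eta> M by (simp add: abs_square_le_1)
      then show ?thesis using M_ln(2)[of M] M2 by simp
    qed
    show "(\<integral>\<^sup>+ t\<in>{0..}. ?F t \<partial>lborel) \<le> ennreal (1 + exp 1 + \<epsilon>)"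
    proof (cases "\<forall>t\<ge>M. (y t)\<^sup>2 \<le> t - 2 * ln t")
      case True
      have "(\<integral>\<^sup>+ t\<in>{0..}. ?F t \<partial>lborel) \<le> (\<integral>\<^sup>+ t. ?F t * indicator {0..M} t + ?F t * indicator {M..} t \<partial>lborel)"
        by (intro nn_integral_mono) (auto split: split_indicator)
      also have "\<dots> = (\<integral>\<^sup>+ t\<in>{0..M}. ?F t \<partial>lborel) + (\<integral>\<^sup>+ t\<in>{M..}. ?F t \<partial>lborel)"
        by (intro nn_integral_add) auto
      also have "\<dots> \<le> ennreal (1 + \<epsilon> / 3) + ennreal (\<epsilon> / 3)"
        using True by (intro add_mono initial middle) auto
      also have "\<dots> \<le> ennreal (1 + exp 1 + \<epsilon>)"
      proof -
        have "1 + \<epsilon> / 3 + \<epsilon> / 3 \<le> 1 + exp 1 + \<epsilon>" using \<epsilon> exp_ge_zero[of 1] by linarith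
        then show ?thesis using \<epsilon> by (simp add: ennreal_plus[symmetric] ennreal_leI del: ennreal_plus)
      qed
      finally show ?thesis .
    next
      case False
      then obtain b where b: "M \<le> b" "b - 2 * ln b \<le> (y b)\<^sup>2" by force
      have "continuous_on {M..b} (\<lambda>t. (y t)\<^sup>2 - (t - 2 * ln t))"
        using M ye unfolding energy_path_def by (intro continuous_intros) (auto intro: continuous_on_subset)
      \<comment> \<open>The points of \<open>{M..b}\<close> at or above the barrier form a compact
        set, so there is a first one, and the path stays below the barrier between \<open>M\<close>
        and that time.\<close>
      then have "closed ({M..b} \<inter> (\<lambda>t. (y t)\<^sup>2 - (t - 2 * ln t)) -` {0..})"
        by (intro continuous_closed_preimage) auto
      then have "compact ({M..b} \<inter> (\<lambda>t. (y t)\<^sup>2 - (t - 2 * ln t)) -` {0..})"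
        by (simp add: compact_eq_bounded_closed bounded_Int)
      moreover have "{M..b} \<inter> (\<lambda>t. (y t)\<^sup>2 - (t - 2 * ln t)) -` {0..} \<noteq> {}" using b by auto
      ultimately obtain a where a': "a \<in> {M..b} \<inter> (\<lambda>t. (y t)\<^sup>2 - (t - 2 * ln t)) -` {0..}"
        and least': "\<forall>t\<in>{M..b} \<inter> (\<lambda>t. (y t)\<^sup>2 - (t - 2 * ln t)) -` {0..}. a \<le> t"
        using compact_attains_inf by blast
      from a' have a: "M \<le> a" "a - 2 * ln a \<le> (y a)\<^sup>2" and ab: "a \<le> b" by auto
      have least: "a \<le> t" if "M \<le> t" "t \<le> b" "t - 2 * ln t \<le> (y t)\<^sup>2" for t
        using least' that by auto
      have a0: "0 < a" using a M by simp
      \<comment> \<open>The path may have stopped before \<open>a\<close>; the tail estimate wants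
        an end time not earlier than \<open>a\<close>.\<close>
      define S' where "S' = max S a"
      have S': "a \<le> S'" "e S' = e S" using const[of S'] by (auto simp: S'_def)
      have const': "y t = y S' \<and> e t = e S'" if "S' \<le> t" for t
        using const[of t] const[of S'] that by (auto simp: S'_def)
      define \<delta> where "\<delta> = e S' - e a"
      \<comment> \<open>This one inequality is used in both directions. Combined with the barrier it
        forces \<open>1 - e a \<le> 2 * ln a / a\<close>, so the remaining energy
        \<open>\<delta>\<close> is at most \<open>\<theta>\<close>. Combined with
        \<open>e a \<le> 1 - \<delta>\<close> it gives
        \<open>(y a)\<^sup>2 / (1 - \<delta>) \<le> a\<close>, exactly what cancels
        \<open>- a\<close> in the exponent of the tail bound.\<close>
      have CS: "(y a)\<^sup>2 \<le> a * e a" using energy_path_cauchy_schwarz[OF ye, of 0 a] a0 y0 e0 by simp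
      have "a - 2 * ln a \<le> a * e a" using a CS by simp
      then have "1 - e a \<le> 2 * ln a / a" using a0 by (simp add: field_simps)
      then have \<delta>\<theta>: "\<delta> \<le> \<theta>" using M_ln(1)[OF a(1)] eS S' by (simp add: \<delta>_def)
      have "a * e a \<le> a * (1 - \<delta>)" using a0 eS S' by (intro mult_left_mono) (auto simp: \<delta>_def)
      with CS have "(y a)\<^sup>2 / (1 - \<delta>) \<le> a" using \<delta>\<theta> \<theta> by (simp add: field_simps)
      then have *: "exp (1 + (y a)\<^sup>2 / (1 - \<delta>) - a) \<le> exp 1" by simp
      have "exp (1 + (y a)\<^sup>2 / (1 - \<delta>) - a) / (1 - \<delta>) \<le> exp 1 / (1 - \<theta>)"
        using \<delta>\<theta> \<theta> * by (intro frac_le) auto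
      with exp_\<theta> have ** : "exp (1 + (y a)\<^sup>2 / (1 - \<delta>) - a) / (1 - \<delta>) \<le> exp 1 + \<epsilon> / 3" by simp
      have "(\<integral>\<^sup>+ t\<in>{a..}. ?F t \<partial>lborel) \<le> ennreal (exp (1 + (y a)\<^sup>2 / (1 - \<delta>) - a) / (1 - \<delta>))"
        unfolding \<delta>_def using \<delta>\<theta> \<theta> by (intro carleson_chang_tail ye S' const') (auto simp: \<delta>_def)
      with ** have tail: "(\<integral>\<^sup>+ t\<in>{a..}. ?F t \<partial>lborel) \<le> ennreal (exp 1 + \<epsilon> / 3)"
        by (meson ennreal_leI order_trans)
      have "(\<integral>\<^sup>+ t\<in>{0..}. ?F t \<partial>lborel) \<le>
          (\<integral>\<^sup>+ t. (?F t * indicator {0..M} t + ?F t * indicator {M..<a} t) + ?F t * indicator {a..} t \<partial>lborel)"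
        by (intro nn_integral_mono) (auto split: split_indicator)
      also have "\<dots> = (\<integral>\<^sup>+ t. ?F t * indicator {0..M} t + ?F t * indicator {M..<a} t \<partial>lborel) + (\<integral>\<^sup>+ t\<in>{a..}. ?F t \<partial>lborel)"
        by (intro nn_integral_add) auto
      also have "(\<integral>\<^sup>+ t. ?F t * indicator {0..M} t + ?F t * indicator {M..<a} t \<partial>lborel)
          = (\<integral>\<^sup>+ t\<in>{0..M}. ?F t \<partial>lborel) + (\<integral>\<^sup>+ t\<in>{M..<a}. ?F t \<partial>lborel)"
        by (intro nn_integral_add) auto
      also have "\<dots> + (\<integral>\<^sup>+ t\<in>{a..}. ?F t \<partial>lborel) \<le> ennreal (1 + \<epsilon> / 3) + ennreal (\<epsilon> / 3) + ennreal (exp 1 + \<epsilon> / 3)"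
      proof (intro add_mono initial middle tail)
        fix t assume "t \<in> {M..<a}"
        then show "M \<le> t \<and> (y t)\<^sup>2 \<le> t - 2 * ln t" using least[of t] ab by force
      qed
      also have "\<dots> = ennreal (1 + exp 1 + \<epsilon>)"
        using \<epsilon> by (simp add: ennreal_plus[symmetric] add_nonneg_nonneg del: ennreal_plus)
      finally show ?thesis .
    qed
  qed
qed

section \<open>From level sets to paths\<close>

lemma chain_mono:
  fixes T :: "nat \<Rightarrow> real"
  assumes "\<And>i. i < n \<Longrightarrow> T i < T (Suc i)" "i \<le> j" "j \<le> n"
  shows "T i \<le> T j" using assms(2,3)
proof (induction j rule: dec_induct)
  case (step j)
  then show ?case using assms(1)[of j] by simp
qed simp

text \<open>The affine interpolation through the nodes \<open>(T i, Y i)\<close>, constant after the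
  last one. Its energy on a piece is the squared increment divided by the elapsed time, which the
  hypothesis bounds by \<open>\<epsilon> i\<close>.\<close>

lemma energy_path_interpolation:
  fixes T Y \<epsilon> :: "nat \<Rightarrow> real"
  assumes T0: "T 0 = 0" and T: "\<And>i. i < n \<Longrightarrow> T i < T (Suc i)"
    and Y0: "Y 0 = 0" and Y: "\<And>i. i < n \<Longrightarrow> Y i \<le> Y (Suc i)"
    and energy: "\<And>i. i < n \<Longrightarrow> (Y (Suc i) - Y i)\<^sup>2 \<le> \<epsilon> i * (T (Suc i) - T i)" and total: "(\<Sum>i<n. \<epsilon> i) \<le> 1"
  obtains y e where "energy_path y e" "y 0 = 0" "e 0 = 0"
    "\<And>t. T n \<le> t \<Longrightarrow> y t = y (T n) \<and> e t = e (T n)" "e (T n) \<le> 1"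
    "\<And>i. i \<le> n \<Longrightarrow> y (T i) = Y i" "mono y"
proof -
  define s where "s i = (Y (Suc i) - Y i) / (T (Suc i) - T i)" for i
  \<comment> \<open>For ordered nodes, \<open>cl i t\<close> is the time spent in the
    \<open>i\<close>-th interval up to \<open>t\<close>, and 0 before it. As finite sums of such
    clamps, \<open>y\<close> and \<open>e\<close> can be differentiated term by term away from the
    nodes.\<close>
  define cl where "cl i t = min t (T (Suc i)) - min t (T i)" for i t
  define y where "y t = (\<Sum>i<n. s i * cl i t)" for t
  define e where "e t = (\<Sum>i<n. (s i)\<^sup>2 * cl i t)" for t
  have mono_T: "T i \<le> T j" if "i \<le> j" "j \<le> n" for i j using chain_mono[of n T i j] T that by simp
  have T_nonneg: "0 \<le> T i" if "i \<le> n" for i using mono_T[of 0 i] that T0 by simp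
  have cl_node: "cl i (T j) = (if i < j then T (Suc i) - T i else 0)" if "i < n" "j \<le> n" for i j
  proof (cases "i < j")
    case True
    then have "T i \<le> T j" "T (Suc i) \<le> T j" using mono_T[of i j] mono_T[of "Suc i" j] that by auto
    with True show ?thesis by (simp add: cl_def)
  next
    case False
    then have "T j \<le> T i" "T j \<le> T (Suc i)" using mono_T[of j i] mono_T[of j "Suc i"] that by auto
    with False show ?thesis by (simp add: cl_def)
  qed
  have cl_end: "cl i t = cl i (T n)" if "i < n" "T n \<le> t" for i t
  proof -
    have "T i \<le> T n" "T (Suc i) \<le> T n" using mono_T[of i n] mono_T[of "Suc i" n] that by auto
    then show ?thesis using that by (simp add: cl_def)
  qed
  have cl_mono: "cl i t \<le> cl i t'" if "i < n" "t \<le> t'" for i t t'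
    using T[OF that(1)] that(2) by (auto simp: cl_def min_def)
  have s_nonneg: "0 \<le> s i" if "i < n" for i using T[OF that] Y[OF that] by (simp add: s_def)
  have sum_node: "(\<Sum>i<n. g i * cl i (T j)) = (\<Sum>i<j. g i * (T (Suc i) - T i))" if "j \<le> n" for g :: "nat \<Rightarrow> real" and j
  proof -
    have "(\<Sum>i<n. g i * cl i (T j)) = (\<Sum>i<n. if i < j then g i * (T (Suc i) - T i) else 0)"
      using that by (intro sum.cong) (auto simp: cl_node)
    also have "\<dots> = (\<Sum>i<j. g i * (T (Suc i) - T i))"
      using that by (intro sum.mono_neutral_cong_right) auto
    finally show ?thesis .
  qed
  show thesis
  proof (rule that[of y e])
    show "energy_path y e" unfolding energy_path_def
    proof (intro conjI exI[of _ "T ` {..n}"] allI impI)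
      show "continuous_on UNIV y" "continuous_on UNIV e"
        unfolding y_def e_def cl_def by (intro continuous_intros)+
      fix t assume t: "t \<notin> T ` {..n}"
      define b where "b i = (if T i < t \<and> t < T (Suc i) then 1 else 0 :: real)" for i
      have dmin: "((\<lambda>t. min t a) has_real_derivative (if t < a then 1 else 0)) (at t)" if "t \<noteq> a" for a
      proof (cases "t < a")
        case True
        have "((\<lambda>t. t) has_real_derivative 1) (at t)" by (rule DERIV_ident)
        then have "((\<lambda>t. min t a) has_real_derivative 1) (at t)"
          by (rule has_field_derivative_transform_within_open[where S="{..<a}"]) (use True in auto)
        with True show ?thesis by simp
      next
        case False
        have "((\<lambda>t. a) has_real_derivative 0) (at t)" by (rule DERIV_const)
        then have "((\<lambda>t. min t a) has_real_derivative 0) (at t)"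
          by (rule has_field_derivative_transform_within_open[where S="{a<..}"]) (use False that in auto)
        with False show ?thesis by simp
      qed
      have dcl: "(cl i has_real_derivative b i) (at t)" if "i < n" for i
      proof -
        have ne: "t \<noteq> T i" "t \<noteq> T (Suc i)" using t that by auto
        have "(cl i has_real_derivative (if t < T (Suc i) then 1 else 0) - (if t < T i then 1 else 0)) (at t)"
          unfolding cl_def by (intro DERIV_diff dmin ne)
        also have "(if t < T (Suc i) then 1 else 0) - (if t < T i then 1 else 0) = b i"
          using ne T[OF that] by (auto simp: b_def)
        finally show ?thesis .
      qed
      \<comment> \<open>At most one interval contains \<open>t\<close>, so squaring commutes with
        the sum of slopes.\<close>
      have sum_b: "(\<Sum>i<n. (s i)\<^sup>2 * b i) = (\<Sum>i<n. s i * b i)\<^sup>2"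
      proof (cases "\<exists>k<n. T k < t \<and> t < T (Suc k)")
        case True
        then obtain k where k: "k < n" "T k < t" "t < T (Suc k)" by auto
        have "b i = (if k = i then 1 else 0)" if "i < n" for i
        proof (rule linorder_cases[of i k])
          assume "i < k"
          then have "T (Suc i) \<le> T k" using mono_T[of "Suc i" k] k by auto
          then show ?thesis using k \<open>i < k\<close> by (auto simp: b_def)
        next
          assume "k < i"
          then have "T (Suc k) \<le> T i" using mono_T[of "Suc k" i] that by auto
          then show ?thesis using k \<open>k < i\<close> by (auto simp: b_def)
        qed (use k in \<open>auto simp: b_def\<close>)
        then have "(\<Sum>i<n. g i * b i) = (\<Sum>i<n. if k = i then g i else 0)" for g :: "nat \<Rightarrow> real"
          by (intro sum.cong) auto
        then have "(\<Sum>i<n. g i * b i) = g k" for g using k by simp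
        then show ?thesis by simp
      next
        case False
        then have "b i = 0" if "i < n" for i using that by (auto simp: b_def)
        then show ?thesis by simp
      qed
      show "\<exists>d. (y has_real_derivative d) (at t) \<and> (e has_real_derivative d\<^sup>2) (at t)"
      proof (intro exI conjI)
        show "(y has_real_derivative (\<Sum>i<n. s i * b i)) (at t)"
          unfolding y_def by (intro DERIV_sum DERIV_cmult dcl) auto
        show "(e has_real_derivative (\<Sum>i<n. s i * b i)\<^sup>2) (at t)"
          unfolding e_def sum_b[symmetric] by (intro DERIV_sum DERIV_cmult dcl) auto
      qed
    qed simp
    show "y 0 = 0" "e 0 = 0" using sum_node[of 0 s] sum_node[of 0 "\<lambda>i. (s i)\<^sup>2"] by (simp_all add: y_def e_def T0)
    show "y t = y (T n) \<and> e t = e (T n)" if "T n \<le> t" for t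
      using cl_end[OF _ that] by (simp add: y_def e_def)
    have "e (T n) = (\<Sum>i<n. (s i)\<^sup>2 * (T (Suc i) - T i))" using sum_node[of n "\<lambda>i. (s i)\<^sup>2"] by (simp add: e_def)
    also have "\<dots> \<le> (\<Sum>i<n. \<epsilon> i)"
    proof (rule sum_mono)
      fix i assume "i \<in> {..<n}"
      then have d: "0 < T (Suc i) - T i" and en: "(Y (Suc i) - Y i)\<^sup>2 \<le> \<epsilon> i * (T (Suc i) - T i)"
        using T energy by auto
      have "(s i)\<^sup>2 * (T (Suc i) - T i) = (Y (Suc i) - Y i)\<^sup>2 / (T (Suc i) - T i)"
        using d by (simp add: s_def power2_eq_square)
      also have "\<dots> \<le> \<epsilon> i" using d en by (simp add: divide_le_eq)
      finally show "(s i)\<^sup>2 * (T (Suc i) - T i) \<le> \<epsilon> i" .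
    qed
    finally show "e (T n) \<le> 1" using total by simp
    show "y (T j) = Y j" if "j \<le> n" for j
    proof -
      have "y (T j) = (\<Sum>i<j. s i * (T (Suc i) - T i))" using sum_node[OF that, of s] by (simp add: y_def)
      also have "\<dots> = (\<Sum>i<j. Y (Suc i) - Y i)"
      proof (rule sum.cong)
        fix i assume "i \<in> {..<j}"
        then show "s i * (T (Suc i) - T i) = Y (Suc i) - Y i" using T[of i] that by (simp add: s_def)
      qed simp
      also have "\<dots> = Y j" by (simp add: sum_lessThan_telescope Y0)
      finally show ?thesis .
    qed
    show "mono y" unfolding y_def by (intro monoI sum_mono mult_left_mono cl_mono s_nonneg) auto
  qed
qed

text \<open>A downward closed predicate cuts the sum off at its last index not exceeding
  \<open>n\<close>, where it telescopes. It evaluates a staircase both at a point of the disc, by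
  level, and at a point of the time axis.\<close>

lemma sum_increments_below_level:
  fixes a :: "nat \<Rightarrow> real"
  assumes "P 0" "\<And>i. P (Suc i) \<Longrightarrow> P i"
  obtains j where "j \<le> n" "P j" "j = n \<or> \<not> P (Suc j)"
    "(\<Sum>i<n. (a (Suc i) - a i) * of_bool (P (Suc i))) = a j - a 0"
proof -
  have "\<exists>j\<le>n. P j \<and> (j = n \<or> \<not> P (Suc j)) \<and> (\<Sum>i<n. (a (Suc i) - a i) * of_bool (P (Suc i))) = a j - a 0"
  proof (induction n)
    case 0
    then show ?case using assms(1) by simp
  next
    case (Suc n)
    then obtain j where j: "j \<le> n" "P j" "j = n \<or> \<not> P (Suc j)"
      "(\<Sum>i<n. (a (Suc i) - a i) * of_bool (P (Suc i))) = a j - a 0" by blast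
    have down: "P k" if "P l" "k \<le> l" for k l
      using that(2,1) by (induction l rule: dec_induct) (use assms(2) in auto)
    show ?case
    proof (cases "P (Suc n)")
      case True
      have "j = n"
      proof (rule ccontr)
        assume "j \<noteq> n"
        then have "\<not> P (Suc j)" "Suc j \<le> Suc n" using j by auto
        with down[OF True] show False by blast
      qed
      then show ?thesis using j True by (intro exI[of _ "Suc n"]) auto
    next
      case False
      then show ?thesis using j by (intro exI[of _ j]) auto
    qed
  qed
  then show thesis using that by blast
qed

text \<open>The bathtub bound: the right side is the weighted area of the centred disc with the area
  of \<open>A\<close>. By layers, the part of \<open>A\<close> where the weight exceeds
  \<open>t\<close> has area at most the smaller of that of \<open>A\<close> and that of the disc
  where the weight exceeds \<open>t\<close>.\<close>

lemma weighted_measure_le: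
  fixes A :: "(real^2) set"
  assumes \<alpha>: "-1 < \<alpha>" "\<alpha> \<le> 0" and A: "A \<in> sets borel" "A \<subseteq> ball 0 1"
  shows "(\<integral>\<^sup>+ x\<in>A. ennreal (norm x powr (2 * \<alpha>)) \<partial>lborel)
    \<le> ennreal (pi / (1 + \<alpha>) * (measure lborel A / pi) powr (1 + \<alpha>))"
proof -
  define \<mu> where "\<mu> = measure lborel A"
  have fmA: "A \<in> fmeasurable lborel" using A by (rule fmeasurable_disc_subset)
  have emA: "emeasure lborel A = ennreal \<mu>" using fmA by (simp add: \<mu>_def emeasure_eq_measure2)
  have \<mu>: "0 \<le> \<mu>" by (simp add: \<mu>_def)
  note [measurable] = A(1)
  consider "\<mu> = 0" | "0 < \<mu>" "\<alpha> = 0" | "0 < \<mu>" "\<alpha> < 0" using \<mu> \<alpha> by linarith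
  then show ?thesis
  proof cases
    case 1
    then have "A \<in> null_sets lborel" using emA by (auto simp: null_sets_def)
    then have "AE x in lborel. x \<notin> A" by (rule AE_not_in)
    then have "(\<integral>\<^sup>+ x\<in>A. ennreal (norm x powr (2 * \<alpha>)) \<partial>lborel) = (\<integral>\<^sup>+ x. 0 \<partial>(lborel :: (real^2) measure))"
      by (intro nn_integral_cong_AE) auto
    then show ?thesis by simp
  next
    case 2
    \<comment> \<open>The weight is 1 except at the origin, where \<open>0 powr 0\<close> is 0 by
      convention; an inequality suffices.\<close>
    have "(\<integral>\<^sup>+ x\<in>A. ennreal (norm x powr (2 * \<alpha>)) \<partial>lborel) \<le> (\<integral>\<^sup>+ x. indicator A x \<partial>lborel)"
      using 2 by (intro nn_integral_mono) (auto simp: powr_def split: split_indicator)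
    also have "\<dots> = ennreal \<mu>" by (simp add: emA)
    finally show ?thesis using 2 by (simp add: \<mu>_def)
  next
    case 3
    define r where "r = \<mu> / pi"
    \<comment> \<open>The height at which the two competing bounds agree: the disc where the weight
      exceeds \<open>s0\<close> has area \<open>\<mu>\<close>.\<close>
    define s0 where "s0 = r powr \<alpha>"
    have r: "0 < r" using 3 by (simp add: r_def)
    have s0: "0 < s0" using r by (simp add: s0_def)
    define f where "f x = norm x powr (2 * \<alpha>) * indicator A x" for x
    have [measurable]: "f \<in> borel_measurable borel" unfolding f_def by measurable
    have "(\<integral>\<^sup>+ x\<in>A. ennreal (norm x powr (2 * \<alpha>)) \<partial>lborel) = (\<integral>\<^sup>+ x. emeasure lborel ({0<..} \<inter> {..<f x}) \<partial>lborel)"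
    proof (intro nn_integral_cong)
      fix x
      have "{0<..} \<inter> {..<f x} = {0<..<f x}" by auto
      moreover have "0 \<le> f x" by (simp add: f_def)
      ultimately have "emeasure lborel ({0<..} \<inter> {..<f x}) = ennreal (f x)" by simp
      then show "ennreal (norm x powr (2 * \<alpha>)) * indicator A x = emeasure lborel ({0<..} \<inter> {..<f x})"
        by (auto simp: f_def split: split_indicator)
    qed
    also have "\<dots> = (\<integral>\<^sup>+ t\<in>{0<..}. emeasure lborel {x \<in> space lborel. t < f x} \<partial>lborel)"
      by (intro layer_cake lborel.sigma_finite_measure_axioms) auto
    also have "\<dots> \<le> (\<integral>\<^sup>+ t. ennreal \<mu> * indicator {0..s0} t + ennreal (pi * t powr (1 / \<alpha>)) * indicator {s0..} t \<partial>lborel)"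
    proof (intro nn_integral_mono)
      fix t :: real
      show "emeasure lborel {x \<in> space lborel. t < f x} * indicator {0<..} t
        \<le> ennreal \<mu> * indicator {0..s0} t + ennreal (pi * t powr (1 / \<alpha>)) * indicator {s0..} t"
      proof (cases "0 < t")
        case True
        have 1: "emeasure lborel {x \<in> space lborel. t < f x} \<le> ennreal \<mu>"
          unfolding emA[symmetric] using True by (intro emeasure_mono) (auto simp: f_def indicator_def split: if_splits)
        have sub: "{x \<in> space lborel. t < f x} \<subseteq> ball 0 (t powr (1 / (2 * \<alpha>)))"
        proof
          fix x assume "x \<in> {x \<in> space lborel. t < f x}"
          then have lt: "t < norm x powr (2 * \<alpha>)" using True by (cases "x \<in> A") (auto simp: f_def)
          then have x: "norm x \<noteq> 0" using True by auto
          have "(norm x powr (2 * \<alpha>)) powr (1 / (2 * \<alpha>)) < t powr (1 / (2 * \<alpha>))"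
            using lt True 3 by (intro powr_less_mono2_neg) (auto simp: divide_neg_neg field_simps)
          then show "x \<in> ball 0 (t powr (1 / (2 * \<alpha>)))" using 3 x by (simp add: powr_powr)
        qed
        have "emeasure lborel {x \<in> space lborel. t < f x} \<le> emeasure lborel (ball 0 (t powr (1 / (2 * \<alpha>))) :: (real^2) set)"
          using sub by (intro emeasure_mono) auto
        also have "\<dots> = ennreal (pi * (t powr (1 / (2 * \<alpha>)))\<^sup>2)"
          by (simp add: emeasure_ball unit_ball_vol_2)
        also have "(t powr (1 / (2 * \<alpha>)))\<^sup>2 = t powr (1 / \<alpha>)"
          using True 3 by (simp add: powr_powr flip: powr_numeral)
        finally have 2: "emeasure lborel {x \<in> space lborel. t < f x} \<le> ennreal (pi * t powr (1 / \<alpha>))" .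
        show ?thesis using 1 2 True by (auto split: split_indicator intro: add_increasing2)
      qed auto
    qed
    also have "\<dots> = (\<integral>\<^sup>+ t\<in>{0..s0}. ennreal \<mu> \<partial>lborel) + (\<integral>\<^sup>+ t\<in>{s0..}. ennreal (pi * t powr (1 / \<alpha>)) \<partial>lborel)"
      by (intro nn_integral_add) auto
    also have "(\<integral>\<^sup>+ t\<in>{0..s0}. ennreal \<mu> \<partial>lborel) = ennreal (\<mu> * s0)"
      using \<mu> s0 by (simp add: nn_integral_cmult_indicator ennreal_mult)
    also have "(\<integral>\<^sup>+ t\<in>{s0..}. ennreal (pi * t powr (1 / \<alpha>)) \<partial>lborel)
        = ennreal (0 - pi * s0 powr (1 / \<alpha> + 1) / (1 / \<alpha> + 1))"
    proof (rule nn_integral_FTC_atLeast)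
      \<comment> \<open>Here \<open>-1 < \<alpha>\<close> enters: it makes the layers integrable at
        infinite height, that is, the weight integrable at the origin.\<close>
      have p: "1 / \<alpha> + 1 < 0" using 3 \<alpha> by (simp add: field_simps)
      show "((\<lambda>t. pi * t powr (1 / \<alpha> + 1) / (1 / \<alpha> + 1)) has_real_derivative pi * t powr (1 / \<alpha>)) (at t)"
        if "s0 \<le> t" for t
      proof -
        have "((\<lambda>t. pi * t powr (1 / \<alpha> + 1) / (1 / \<alpha> + 1)) has_real_derivative pi * ((1 / \<alpha> + 1) * t powr (1 / \<alpha> + 1 - 1)) / (1 / \<alpha> + 1)) (at t)"
          using s0 that by (intro DERIV_cdivide DERIV_cmult has_real_derivative_powr) auto
        then show ?thesis using p by (simp add: mult.left_commute)
      qed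
      have "((\<lambda>t. pi * t powr (1 / \<alpha> + 1) / (1 / \<alpha> + 1)) \<longlongrightarrow> pi * 0 / (1 / \<alpha> + 1)) at_top"
        using p by (intro tendsto_intros tendsto_neg_powr filterlim_ident) auto
      then show "((\<lambda>t. pi * t powr (1 / \<alpha> + 1) / (1 / \<alpha> + 1)) \<longlongrightarrow> 0) at_top" by simp
    qed auto
    also have "s0 powr (1 / \<alpha> + 1) = r powr (1 + \<alpha>)"
    proof -
      have "\<alpha> * (1 / \<alpha> + 1) = 1 + \<alpha>" using 3 by (simp add: field_simps)
      then show ?thesis by (simp only: s0_def powr_powr)
    qed
    also have "\<mu> * s0 = pi * r powr (1 + \<alpha>)" using r 3 by (simp add: s0_def r_def powr_add)
    also have "ennreal (pi * r powr (1 + \<alpha>)) + ennreal (0 - pi * r powr (1 + \<alpha>) / (1 / \<alpha> + 1))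
        = ennreal (pi * r powr (1 + \<alpha>) + (0 - pi * r powr (1 + \<alpha>) / (1 / \<alpha> + 1)))"
    proof (intro ennreal_plus[symmetric])
      have "1 / \<alpha> + 1 < 0" using 3 \<alpha> by (simp add: field_simps)
      then have "pi * r powr (1 + \<alpha>) / (1 / \<alpha> + 1) \<le> 0" by (intro divide_nonneg_neg) auto
      then show "0 \<le> 0 - pi * r powr (1 + \<alpha>) / (1 / \<alpha> + 1)" by simp
    qed simp
    also have "pi * r powr (1 + \<alpha>) + (0 - pi * r powr (1 + \<alpha>) / (1 / \<alpha> + 1)) = pi / (1 + \<alpha>) * r powr (1 + \<alpha>)"
      using 3 \<alpha> by (simp add: field_simps)
    finally show ?thesis by (simp add: r_def \<mu>_def)
  qed
qed

lemma measure_disc: "measure lborel (ball 0 1 :: (real^2) set) = pi"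
  by (simp add: content_ball unit_ball_vol_2)

lemma superlevel_anti: "s \<le> t \<Longrightarrow> superlevel \<phi> t \<subseteq> superlevel \<phi> s"
  by (auto simp: superlevel_def)

lemma fmeasurable_superlevel: "C1_disc \<phi> G \<Longrightarrow> superlevel \<phi> t \<in> fmeasurable lborel"
  using sets_superlevel_shell by (auto intro!: fmeasurable_disc_subset[where r=1] simp: superlevel_def)

text \<open>Level \<open>k * \<eta>\<close> becomes a node with time \<open>T k\<close> and height
  \<open>Y k\<close>, and the isocapacitary inequality is precisely the energy bound between nodes.
  The functional is dominated by a staircase in the levels; the bathtub bound and
  \<open>exp (- s)\<close> as a tail integral turn it into a staircase in time below the exponential
  of \<open>y\<close> squared. The two statements on \<open>y\<close> at levels allow smallness of a
  level set to be read as smallness of the path.\<close>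

lemma moser_functional_le_path:
  fixes \<alpha> \<eta> C :: real
  defines "c \<equiv> 4 * pi * (1 + \<alpha>)"
  assumes \<alpha>: "-1 < \<alpha>" "\<alpha> \<le> 0" and C1: "C1_disc \<phi> G"
    and energy: "(dirichlet (ball 0 1) G) \<le> 1"
    and \<eta>: "0 < \<eta>" and C: "\<And>x. \<bar>\<phi> x\<bar> \<le> C"
  obtains y e S where "energy_path y e" "y 0 = 0" "e 0 = 0"
    "\<And>t. S \<le> t \<Longrightarrow> y t = y S \<and> e t = e S" "e S \<le> 1" "mono y"
    "\<And>k. 0 < measure lborel (superlevel \<phi> (real k * \<eta>)) \<Longrightarrow>
        y ((1 + \<alpha>) * ln (pi / measure lborel (superlevel \<phi> (real k * \<eta>)))) = sqrt c * (real k * \<eta>)"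
    "\<And>k t. measure lborel (superlevel \<phi> (real k * \<eta>)) = 0 \<Longrightarrow> y t \<le> sqrt c * (real k * \<eta>)"
    "(\<integral>\<^sup>+ x\<in>ball 0 1. ennreal (norm x powr (2 * \<alpha>) * exp (c * (\<phi> x)\<^sup>2)) \<partial>lborel)
      \<le> ennreal (exp (c * (2 * C * \<eta> + \<eta>\<^sup>2)) * (pi / (1 + \<alpha>))) * (moser_path y)"
proof -
  have c: "0 < c" using \<alpha> by (simp add: c_def)
  have C0: "0 \<le> C" using C[of 0] by linarith
  note [measurable] = C1_disc_measurable[OF C1] sets_superlevel_shell[OF C1]
  define r where "r k = real k * \<eta>" for k
  define m where "m k = measure lborel (superlevel \<phi> (r k))" for k
  \<comment> \<open>The last level with positive measure; it exists because \<open>m 0\<close> is pi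
    and \<open>\<phi>\<close> is bounded. Nodes stop there: a null level would correspond to
    infinite time, while division by zero would put it at time 0.\<close>
  define n where "n = (GREATEST k. 0 < m k)"
  have r_Suc: "r (Suc k) = r k + \<eta>" for k by (simp add: r_def algebra_simps)
  have r_nonneg: "0 \<le> r k" for k using \<eta> by (simp add: r_def)
  have m0: "m 0 = pi"
  proof -
    have "superlevel \<phi> (r 0) = ball 0 1" by (auto simp: superlevel_def r_def)
    then show ?thesis by (simp add: m_def measure_disc)
  qed
  have r_le_C: "r k \<le> C" if "0 < m k" for k
  proof (rule ccontr)
    assume "\<not> r k \<le> C"
    then have "superlevel \<phi> (r k) = {}" using C by (auto simp: superlevel_def not_le) (meson not_le order_trans order_less_le_trans)
    with that show False by (simp add: m_def)
  qed
  have bound: "k \<le> nat \<lceil>C / \<eta>\<rceil>" if "0 < m k" for k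
  proof -
    have "real k \<le> C / \<eta>" using r_le_C[OF that] \<eta> by (simp add: r_def field_simps)
    then show ?thesis by linarith
  qed
  have mn: "0 < m n" unfolding n_def by (rule GreatestI_nat[of _ 0 "nat \<lceil>C / \<eta>\<rceil>"]) (use bound m0 in auto)
  have n_max: "k \<le> n" if "0 < m k" for k
    unfolding n_def by (rule Greatest_le_nat[of _ k "nat \<lceil>C / \<eta>\<rceil>"]) (use bound that in auto)
  have m_anti: "m l \<le> m k" if "k \<le> l" for k l unfolding m_def using that \<eta>
    by (intro measure_mono_fmeasurable superlevel_anti fmeasurable_superlevel[OF C1]) (auto simp: r_def)
  have m_pos: "0 < m k" if "k \<le> n" for k using m_anti[OF that] mn by simp
  define E where "E k = (dirichlet (shell \<phi> (r k) (r (Suc k))) G)" for k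
  define T where "T k = (1 + \<alpha>) * ln (pi / m k)" for k
  define Y where "Y k = sqrt c * r k" for k
  have step: "c * \<eta>\<^sup>2 \<le> E k * (T (Suc k) - T k)" if k: "k < n" for k
  proof -
    have mk: "0 < m k" "0 < m (Suc k)" using m_pos k by auto
    have "4 * pi * \<eta>\<^sup>2 \<le> E k * ln (m k / m (Suc k))"
      using isocapacitary[OF C1 r_nonneg, of k "r (Suc k)"] mk \<eta> by (simp add: E_def m_def r_Suc)
    then have "(1 + \<alpha>) * (4 * pi * \<eta>\<^sup>2) \<le> (1 + \<alpha>) * (E k * ln (m k / m (Suc k)))"
      using \<alpha> by (intro mult_left_mono) auto
    also have "\<dots> = E k * (T (Suc k) - T k)" using mk by (simp add: T_def ln_div algebra_simps)
    also have "(1 + \<alpha>) * (4 * pi * \<eta>\<^sup>2) = c * \<eta>\<^sup>2" by (simp add: c_def)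
    finally show ?thesis .
  qed
  have E_nonneg: "0 \<le> E k" for k unfolding E_def by (rule set_integral_nonneg) simp
  \<comment> \<open>Strictness comes from the isocapacitary inequality itself: the product of
    \<open>E k\<close> and the time step is positive and \<open>E k\<close> is nonnegative, so no
    two nodes coincide.\<close>
  have T_less: "T k < T (Suc k)" if "k < n" for k
  proof -
    have "0 < E k * (T (Suc k) - T k)" using step[OF that] c \<eta> by (smt (verit) mult_pos_pos zero_less_power)
    then show ?thesis using E_nonneg[of k] by (simp add: zero_less_mult_iff)
  qed
  have E_total: "(\<Sum>k<n. E k) \<le> 1"
  proof -
    have "incseq r" using \<eta> by (auto simp: incseq_def r_def intro!: mult_right_mono)
    then have "(\<Sum>k<n. E k) = (dirichlet (shell \<phi> 0 (r n)) G)"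
      using set_integral_shell_sum[OF C1, of r n] by (simp add: E_def r_def)
    \<comment> \<open>The last shell ends at \<open>C + 1\<close>, strictly above all values of
      \<bar>\<phi>\<bar>, because shells exclude their upper level; together they exhaust the
      disc.\<close>
    also have "\<dots> \<le> (dirichlet (shell \<phi> 0 (r n)) G) + (dirichlet (shell \<phi> (r n) (C + 1)) G)"
      by (simp add: set_integral_nonneg)
    also have "\<dots> = (dirichlet (shell \<phi> 0 (C + 1)) G)"
      using r_nonneg[of n] r_le_C[OF mn] by (intro set_integral_shell_split[OF C1, symmetric]) auto
    also have "shell \<phi> 0 (C + 1) = ball 0 1" by (auto simp: shell_def intro!: le_less_trans[OF C])
    finally show ?thesis using energy by simp
  qed
  obtain y e where path: "energy_path y e" "y 0 = 0" "e 0 = 0"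
    "\<And>t. T n \<le> t \<Longrightarrow> y t = y (T n) \<and> e t = e (T n)" "e (T n) \<le> 1"
    and node: "\<And>i. i \<le> n \<Longrightarrow> y (T i) = Y i" and mono: "mono y"
  proof (rule energy_path_interpolation[of T n Y E])
    show "T 0 = 0" by (simp add: T_def m0)
    show "Y 0 = 0" by (simp add: Y_def r_def)
    show "Y i \<le> Y (Suc i)" for i using c \<eta> by (simp add: Y_def r_Suc)
    show "(Y (Suc i) - Y i)\<^sup>2 \<le> E i * (T (Suc i) - T i)" if "i < n" for i
    proof -
      have "Y (Suc i) - Y i = sqrt c * \<eta>" by (simp add: Y_def r_Suc distrib_left)
      then have "(Y (Suc i) - Y i)\<^sup>2 = c * \<eta>\<^sup>2" using c by (simp add: power_mult_distrib)
      then show ?thesis using step[OF that] by simp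
    qed
    show "T i < T (Suc i)" if "i < n" for i by (rule T_less[OF that])
    show "(\<Sum>i<n. E i) \<le> 1" by (rule E_total)
  qed blast
  note [measurable] = energy_path_measurable[OF path(1)]
  define a where "a k = exp (c * (r k)\<^sup>2)" for k
  have a0: "a 0 = 1" by (simp add: a_def r_def)
  have a_mono: "a k \<le> a (Suc k)" for k
    unfolding a_def using c \<eta> r_nonneg[of k] by (auto simp: r_Suc intro!: mult_left_mono power_mono)
  \<comment> \<open>The largest ratio of consecutive staircase values, using that the lower level is
    at most \<open>C\<close>. It tends to 1 as the mesh shrinks.\<close>
  define Q where "Q = exp (c * (2 * C * \<eta> + \<eta>\<^sup>2))"
  have Q: "0 < Q" by (simp add: Q_def)
  have a_Suc: "a (Suc k) \<le> Q * a k" if "k \<le> n" for k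
  proof -
    have "(r (Suc k))\<^sup>2 \<le> (2 * C * \<eta> + \<eta>\<^sup>2) + (r k)\<^sup>2"
      using r_le_C[OF m_pos[OF that]] \<eta> by (simp add: r_Suc power2_eq_square algebra_simps)
    then have "c * (r (Suc k))\<^sup>2 \<le> c * ((2 * C * \<eta> + \<eta>\<^sup>2) + (r k)\<^sup>2)" using c by (intro mult_left_mono) auto
    then show ?thesis by (simp add: a_def Q_def exp_add[symmetric] distrib_left)
  qed
  let ?w = "\<lambda>x::real^2. norm x powr (2 * \<alpha>)"
  \<comment> \<open>Level \<open>n + 1\<close> is reached at most on a null set, hence the pointwise
    staircase bound holds only almost everywhere.\<close>
  have null_top: "AE x in lborel. x \<notin> superlevel \<phi> (r (Suc n))"
  proof -
    have "\<not> 0 < m (Suc n)" using n_max[of "Suc n"] by auto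
    then have "m (Suc n) = 0" using measure_nonneg[of lborel "superlevel \<phi> (r (Suc n))"] unfolding m_def by linarith
    then have "superlevel \<phi> (r (Suc n)) \<in> null_sets lborel"
      using fmeasurable_superlevel[OF C1, of "r (Suc n)"] by (auto simp: null_sets_def m_def emeasure_eq_measure2)
    then show ?thesis by (rule AE_not_in)
  qed
  \<comment> \<open>Discrete layer cake: the staircase is its initial value 1 plus its increments,
    each carried by one superlevel set.\<close>
  have upper: "AE x in lborel. ennreal (?w x * exp (c * (\<phi> x)\<^sup>2)) * indicator (ball 0 1) x
    \<le> ennreal Q * (ennreal (?w x) * indicator (superlevel \<phi> (r 0)) x
        + (\<Sum>i<n. ennreal (a (Suc i) - a i) * (ennreal (?w x) * indicator (superlevel \<phi> (r (Suc i))) x)))"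
    using null_top
  proof eventually_elim
    case (elim x)
    show ?case
    proof (cases "x \<in> ball 0 1")
      case True
      obtain j where j: "j \<le> n" "r j \<le> \<bar>\<phi> x\<bar>" "j = n \<or> \<not> r (Suc j) \<le> \<bar>\<phi> x\<bar>"
        "(\<Sum>i<n. (a (Suc i) - a i) * of_bool (r (Suc i) \<le> \<bar>\<phi> x\<bar>)) = a j - a 0"
      proof (rule sum_increments_below_level[of "\<lambda>i. r i \<le> \<bar>\<phi> x\<bar>" n a])
        show "r 0 \<le> \<bar>\<phi> x\<bar>" by (simp add: r_def)
        show "r i \<le> \<bar>\<phi> x\<bar>" if "r (Suc i) \<le> \<bar>\<phi> x\<bar>" for i using that \<eta> by (simp add: r_Suc)
      qed blast
      have "\<bar>\<phi> x\<bar> < r (Suc j)" using j(3) elim True by (auto simp: superlevel_def)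
      then have "(\<phi> x)\<^sup>2 \<le> (r (Suc j))\<^sup>2" using power_mono[of "\<bar>\<phi> x\<bar>" "r (Suc j)" 2] by simp
      then have "exp (c * (\<phi> x)\<^sup>2) \<le> a (Suc j)" using c by (simp add: a_def)
      also have "\<dots> \<le> Q * a j" by (rule a_Suc[OF j(1)])
      also have "a j = 1 + (\<Sum>i<n. (a (Suc i) - a i) * of_bool (r (Suc i) \<le> \<bar>\<phi> x\<bar>))" using j(4) a0 by simp
      finally have le: "exp (c * (\<phi> x)\<^sup>2) \<le> Q * (1 + (\<Sum>i<n. (a (Suc i) - a i) * of_bool (r (Suc i) \<le> \<bar>\<phi> x\<bar>)))" .
      have "?w x * exp (c * (\<phi> x)\<^sup>2) \<le> Q * (?w x * (1 + (\<Sum>i<n. (a (Suc i) - a i) * of_bool (r (Suc i) \<le> \<bar>\<phi> x\<bar>))))"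
        using mult_left_mono[OF le, of "?w x"] by (simp add: mult_ac)
      also have "?w x * (1 + (\<Sum>i<n. (a (Suc i) - a i) * of_bool (r (Suc i) \<le> \<bar>\<phi> x\<bar>)))
        = ?w x + (\<Sum>i<n. (a (Suc i) - a i) * (?w x * indicator (superlevel \<phi> (r (Suc i))) x))"
        unfolding distrib_left sum_distrib_left mult_1_right
        by (intro arg_cong2[where f="(+)"] refl sum.cong) (use True in \<open>auto simp: superlevel_def\<close>)
      finally have "ennreal (?w x * exp (c * (\<phi> x)\<^sup>2))
        \<le> ennreal (Q * (?w x + (\<Sum>i<n. (a (Suc i) - a i) * (?w x * indicator (superlevel \<phi> (r (Suc i))) x))))"
        by (rule ennreal_leI)
      also have "\<dots> = ennreal Q * (ennreal (?w x) + (\<Sum>i<n. ennreal (a (Suc i) - a i) * (ennreal (?w x) * indicator (superlevel \<phi> (r (Suc i))) x)))"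
        using Q a_mono by (simp add: ennreal_mult' ennreal_plus sum_nonneg ennreal_indicator flip: sum_ennreal)
      finally show ?thesis using True r_nonneg by (simp add: superlevel_def r_def)
    qed simp
  qed
  have weighted: "(\<integral>\<^sup>+ x\<in>superlevel \<phi> (r i). ennreal (?w x) \<partial>lborel) \<le> ennreal (pi / (1 + \<alpha>)) * ennreal (exp (- T i))" if "i \<le> n" for i
  proof -
    have "(\<integral>\<^sup>+ x\<in>superlevel \<phi> (r i). ennreal (?w x) \<partial>lborel) \<le> ennreal (pi / (1 + \<alpha>) * (m i / pi) powr (1 + \<alpha>))"
      unfolding m_def by (intro weighted_measure_le \<alpha> sets_superlevel_shell[OF C1]) (auto simp: superlevel_def)
    also have "(m i / pi) powr (1 + \<alpha>) = exp (- T i)"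
      using m_pos[OF that] by (simp add: powr_def T_def ln_div algebra_simps)
    also have "ennreal (pi / (1 + \<alpha>) * exp (- T i)) = ennreal (pi / (1 + \<alpha>)) * ennreal (exp (- T i))"
      using \<alpha> by (intro ennreal_mult) auto
    finally show ?thesis .
  qed
  define B where "B = 1 + (\<Sum>i<n. ennreal (a (Suc i) - a i) * ennreal (exp (- T (Suc i))))"
  have I_le: "(\<integral>\<^sup>+ x\<in>ball 0 1. ennreal (?w x * exp (c * (\<phi> x)\<^sup>2)) \<partial>lborel) \<le> ennreal (Q * (pi / (1 + \<alpha>))) * B"
  proof -
    have "(\<integral>\<^sup>+ x\<in>ball 0 1. ennreal (?w x * exp (c * (\<phi> x)\<^sup>2)) \<partial>lborel)
      \<le> (\<integral>\<^sup>+ x. ennreal Q * (ennreal (?w x) * indicator (superlevel \<phi> (r 0)) x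
        + (\<Sum>i<n. ennreal (a (Suc i) - a i) * (ennreal (?w x) * indicator (superlevel \<phi> (r (Suc i))) x))) \<partial>lborel)"
      using upper by (rule nn_integral_mono_AE)
    also have "\<dots> = ennreal Q * ((\<integral>\<^sup>+ x\<in>superlevel \<phi> (r 0). ennreal (?w x) \<partial>lborel)
        + (\<Sum>i<n. ennreal (a (Suc i) - a i) * (\<integral>\<^sup>+ x\<in>superlevel \<phi> (r (Suc i)). ennreal (?w x) \<partial>lborel)))"
      by (simp add: nn_integral_cmult nn_integral_add nn_integral_sum)
    also have "\<dots> \<le> ennreal Q * (ennreal (pi / (1 + \<alpha>)) * ennreal (exp (- T 0))
        + (\<Sum>i<n. ennreal (a (Suc i) - a i) * (ennreal (pi / (1 + \<alpha>)) * ennreal (exp (- T (Suc i))))))"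
      by (intro mult_left_mono add_mono sum_mono weighted) auto
    also have "\<dots> = ennreal Q * (ennreal (pi / (1 + \<alpha>)) * B)"
      by (simp add: B_def T_def m0 distrib_left sum_distrib_left mult_ac)
    also have "\<dots> = ennreal (Q * (pi / (1 + \<alpha>))) * B"
      using Q \<alpha> by (subst ennreal_mult) (auto simp: mult.assoc)
    finally show ?thesis .
  qed
  \<comment> \<open>Each \<open>exp (- T k)\<close> is the integral of \<open>exp (- t)\<close> from
    \<open>T k\<close> on. At time \<open>t\<close> the resulting staircase has the value
    \<open>a j\<close> for the last node \<open>j\<close> passed, and monotonicity of
    \<open>y\<close> gives \<open>Y j \<le> y t\<close>.\<close>
  have B_le: "B \<le> (moser_path y)"
  proof -
    have tail: "(\<integral>\<^sup>+ t\<in>{s..}. ennreal (exp (- t)) \<partial>lborel) = ennreal (exp (- s))" for s :: real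
      using nn_integral_exp_tail[of 1 0 s] by simp
    have T_nonneg: "0 \<le> T k" if "k \<le> n" for k
      using chain_mono[of n T 0 k] T_less that by (simp add: T_def m0)
    have "B = (\<integral>\<^sup>+ t\<in>{0..}. ennreal (exp (- t)) \<partial>lborel)
        + (\<Sum>i<n. ennreal (a (Suc i) - a i) * (\<integral>\<^sup>+ t\<in>{T (Suc i)..}. ennreal (exp (- t)) \<partial>lborel))"
      by (simp add: B_def tail)
    also have "\<dots> = (\<integral>\<^sup>+ t. ennreal (exp (- t)) * indicator {0..} t
        + (\<Sum>i<n. ennreal (a (Suc i) - a i) * (ennreal (exp (- t)) * indicator {T (Suc i)..} t)) \<partial>lborel)"
      by (simp add: nn_integral_cmult nn_integral_add nn_integral_sum)
    also have "\<dots> \<le> (moser_path y)"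
    proof (intro nn_integral_mono)
      fix t :: real
      show "ennreal (exp (- t)) * indicator {0..} t
          + (\<Sum>i<n. ennreal (a (Suc i) - a i) * (ennreal (exp (- t)) * indicator {T (Suc i)..} t))
        \<le> ennreal (exp ((y t)\<^sup>2 - t)) * indicator {0..} t"
      proof (cases "0 \<le> t")
        case True
        obtain j where j: "j \<le> n" "j \<le> n \<and> T j \<le> t"
          "(\<Sum>i<n. (a (Suc i) - a i) * of_bool (Suc i \<le> n \<and> T (Suc i) \<le> t)) = a j - a 0"
        proof (rule sum_increments_below_level[of "\<lambda>i. i \<le> n \<and> T i \<le> t" n a])
          show "0 \<le> n \<and> T 0 \<le> t" using True by (simp add: T_def m0)
          show "i \<le> n \<and> T i \<le> t" if "Suc i \<le> n \<and> T (Suc i) \<le> t" for i using T_less[of i] that by auto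
        qed blast
        have "Y j \<le> y t" using node[OF j(1)] monoD[OF mono, of "T j" t] j(2) by simp
        moreover have "0 \<le> Y j" using c r_nonneg by (simp add: Y_def)
        ultimately have "(Y j)\<^sup>2 \<le> (y t)\<^sup>2" by (intro power_mono)
        moreover have "(Y j)\<^sup>2 = c * (r j)\<^sup>2" using c by (simp add: Y_def power_mult_distrib)
        ultimately have "a j \<le> exp ((y t)\<^sup>2)" by (simp add: a_def)
        moreover have "(\<Sum>i<n. (a (Suc i) - a i) * of_bool (Suc i \<le> n \<and> T (Suc i) \<le> t))
            = (\<Sum>i<n. (a (Suc i) - a i) * of_bool (T (Suc i) \<le> t))"
          by (intro sum.cong) auto
        then have "a j = 1 + (\<Sum>i<n. (a (Suc i) - a i) * of_bool (T (Suc i) \<le> t))"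
          using j(3) a0 by linarith
        ultimately have "exp (- t) * (1 + (\<Sum>i<n. (a (Suc i) - a i) * of_bool (T (Suc i) \<le> t))) \<le> exp (- t) * exp ((y t)\<^sup>2)"
          by (intro mult_left_mono) auto
        also have "exp (- t) * exp ((y t)\<^sup>2) = exp ((y t)\<^sup>2 - t)" by (simp add: exp_add[symmetric])
        also have "exp (- t) * (1 + (\<Sum>i<n. (a (Suc i) - a i) * of_bool (T (Suc i) \<le> t)))
           = exp (- t) + (\<Sum>i<n. (a (Suc i) - a i) * (exp (- t) * indicator {T (Suc i)..} t))"
          unfolding distrib_left sum_distrib_left mult_1_right
          by (intro arg_cong2[where f="(+)"] refl sum.cong) auto
        finally have "ennreal (exp (- t) + (\<Sum>i<n. (a (Suc i) - a i) * (exp (- t) * indicator {T (Suc i)..} t))) \<le> ennreal (exp ((y t)\<^sup>2 - t))"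
          by (rule ennreal_leI)
        then show ?thesis using True a_mono
          by (simp add: ennreal_mult' ennreal_plus sum_nonneg ennreal_indicator flip: sum_ennreal)
      next
        case False
        then have "\<not> T (Suc i) \<le> t" if "i < n" for i using T_nonneg[of "Suc i"] that by simp
        then show ?thesis using False by (simp add: indicator_def)
      qed
    qed
    finally show ?thesis .
  qed
  show thesis
  proof (rule that[OF path mono])
    show "y ((1 + \<alpha>) * ln (pi / measure lborel (superlevel \<phi> (real k * \<eta>)))) = sqrt c * (real k * \<eta>)"
      if "0 < measure lborel (superlevel \<phi> (real k * \<eta>))" for k
      using node[of k] n_max[of k] that by (simp add: T_def Y_def m_def r_def)
    show "y t \<le> sqrt c * (real k * \<eta>)" if "measure lborel (superlevel \<phi> (real k * \<eta>)) = 0" for k t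
    proof -
      have "m k = 0" using that by (simp add: m_def r_def)
      then have "n \<le> k" using m_pos[of k] by (cases "k \<le> n") auto
      have "y t \<le> y (T n)" using path(4)[of t] monoD[OF mono, of t "T n"] by (cases "T n \<le> t") auto
      also have "\<dots> = sqrt c * (real n * \<eta>)" using node[of n] by (simp add: Y_def r_def)
      also have "\<dots> \<le> sqrt c * (real k * \<eta>)" using \<open>n \<le> k\<close> c \<eta> by (intro mult_left_mono mult_right_mono) auto
      finally show ?thesis .
    qed
    show "(\<integral>\<^sup>+ x\<in>ball 0 1. ennreal (?w x * exp (c * (\<phi> x)\<^sup>2)) \<partial>lborel)
      \<le> ennreal (exp (c * (2 * C * \<eta> + \<eta>\<^sup>2)) * (pi / (1 + \<alpha>))) * (moser_path y)"
      using I_le mult_left_mono[OF B_le, of "ennreal (Q * (pi / (1 + \<alpha>)))"] unfolding Q_def by (auto intro: order_trans)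
  qed
qed

section \<open>Functions small in the mean square sense\<close>

lemma C1_disc_integrable_square:
  assumes "C1_disc \<phi> G" shows "integrable lborel (\<lambda>x. (\<phi> x)\<^sup>2)"
proof -
  note [measurable] = C1_disc_measurable[OF assms]
  obtain C where C: "0 < C" "\<And>x. \<bar>\<phi> x\<bar> \<le> C" "\<And>x. norm (G x) \<le> C" using C1_disc_bounded[OF assms] by blast
  show ?thesis
  proof (rule integrable_ball_bounded)
    show "\<bar>(\<phi> x)\<^sup>2\<bar> \<le> C\<^sup>2 * indicator (ball 0 1) x" for x
      using power_mono[OF C(2)[of x], of 2] C1_disc_zero(1)[OF assms, of x] by (auto split: split_indicator)
  qed auto
qed

lemma superlevel_chebyshev:
  assumes C1: "C1_disc \<phi> G" and "0 \<le> \<tau>"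
  shows "\<tau>\<^sup>2 * measure lborel (superlevel \<phi> \<tau>) \<le> (\<integral>x. (\<phi> x)\<^sup>2 \<partial>lborel)"
proof -
  have fm: "superlevel \<phi> \<tau> \<in> fmeasurable lborel" by (rule fmeasurable_superlevel[OF C1])
  have "\<tau>\<^sup>2 * measure lborel (superlevel \<phi> \<tau>) = (\<integral>x. \<tau>\<^sup>2 * indicator (superlevel \<phi> \<tau>) x \<partial>lborel)"
    using fm by simp
  also have "\<dots> \<le> (\<integral>x. (\<phi> x)\<^sup>2 \<partial>lborel)"
  proof (rule integral_mono[OF _ C1_disc_integrable_square[OF C1]])
    show "integrable lborel (\<lambda>x. \<tau>\<^sup>2 * indicator (superlevel \<phi> \<tau>) x :: real)"
      using fm by (intro integrable_mult_right integrable_real_indicator) (auto simp: fmeasurable_def)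
    fix x
    show "\<tau>\<^sup>2 * indicator (superlevel \<phi> \<tau>) x \<le> (\<phi> x)\<^sup>2"
      using power_mono[of \<tau> "\<bar>\<phi> x\<bar>" 2] assms(2) by (auto simp: superlevel_def split: split_indicator)
  qed
  finally show ?thesis .
qed

text \<open>If the integral of the square of \<phi> is small, Chebyshev makes the superlevel set at
  \<open>\<tau>\<close> so small that the path reaches the corresponding height only after time
  \<open>M\<close>; being monotone, it is small up to \<open>M\<close>, as
  \<open>carleson_chang\<close> asks. The sup bound \<open>C\<close> of \<phi> enters only through
  the mesh factor, so \<open>\<delta>\<close> does not depend on it.\<close>

theorem moser_functional_small_L2:
  fixes \<alpha> \<epsilon> :: real
  assumes \<alpha>: "-1 < \<alpha>" "\<alpha> \<le> 0" and \<epsilon>: "0 < \<epsilon>"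
  obtains \<delta> where "0 < \<delta>" "\<And>\<phi> G. C1_disc \<phi> G \<Longrightarrow> (dirichlet (ball 0 1) G) \<le> 1 \<Longrightarrow>
    (\<integral>x. (\<phi> x)\<^sup>2 \<partial>lborel) \<le> \<delta> \<Longrightarrow>
    (\<integral>\<^sup>+ x\<in>ball 0 1. ennreal (norm x powr (2 * \<alpha>) * exp (4 * pi * (1 + \<alpha>) * (\<phi> x)\<^sup>2)) \<partial>lborel)
      \<le> ennreal (pi / (1 + \<alpha>) * (1 + exp 1 + \<epsilon>))"
proof -
  define c where "c = 4 * pi * (1 + \<alpha>)"
  have c: "0 < c" using \<alpha> by (simp add: c_def)
  obtain M \<eta>\<^sub>0 where M: "0 < M" and \<eta>\<^sub>0: "0 < \<eta>\<^sub>0"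
    and CC: "\<And>y e S. energy_path y e \<Longrightarrow> y 0 = 0 \<Longrightarrow> e 0 = 0 \<Longrightarrow> (\<And>t. S \<le> t \<Longrightarrow> y t = y S \<and> e t = e S) \<Longrightarrow> e S \<le> 1
      \<Longrightarrow> (\<And>t. 0 \<le> t \<Longrightarrow> t \<le> M \<Longrightarrow> \<bar>y t\<bar> \<le> \<eta>\<^sub>0)
      \<Longrightarrow> (moser_path y) \<le> ennreal (1 + exp 1 + \<epsilon>)"
  proof (rule carleson_chang[OF \<epsilon>], goal_cases)
    case (1 M \<eta>)
    show ?case by (rule 1(1)[of M \<eta>], rule 1(2), rule 1(3), rule 1(4))
  qed
  \<comment> \<open>The level of \<phi> that corresponds to path height
    \<open>\<eta>\<^sub>0\<close>.\<close>
  define \<tau> where "\<tau> = \<eta>\<^sub>0 / sqrt c"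
  have \<tau>: "0 < \<tau>" "sqrt c * \<tau> = \<eta>\<^sub>0" using c \<eta>\<^sub>0 by (simp_all add: \<tau>_def)
  \<comment> \<open>A superlevel set of area pi times this exponential has time exactly
    \<open>M\<close>; the factor \<open>\<tau>\<^sup>2\<close> is that of Chebyshev's
    inequality.\<close>
  define \<delta> where "\<delta> = \<tau>\<^sup>2 * (pi * exp (- (M / (1 + \<alpha>))))"
  define B where "B = pi / (1 + \<alpha>) * (1 + exp 1 + \<epsilon>)"
  show thesis
  proof (rule that[of \<delta>])
    show "0 < \<delta>" using \<tau> by (simp add: \<delta>_def)
    fix \<phi> G
    assume C1: "C1_disc \<phi> G" and energy: "(dirichlet (ball 0 1) G) \<le> 1"
      and small: "(\<integral>x. (\<phi> x)\<^sup>2 \<partial>lborel) \<le> \<delta>"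
    obtain C where C: "0 < C" "\<And>x. \<bar>\<phi> x\<bar> \<le> C" "\<And>x. norm (G x) \<le> C" using C1_disc_bounded[OF C1] by blast
    let ?m = "measure lborel (superlevel \<phi> \<tau>)"
    let ?I = "\<integral>\<^sup>+ x\<in>ball 0 1. ennreal (norm x powr (2 * \<alpha>) * exp (c * (\<phi> x)\<^sup>2)) \<partial>(lborel :: (real^2) measure)"
    have "\<tau>\<^sup>2 * ?m \<le> \<tau>\<^sup>2 * (pi * exp (- (M / (1 + \<alpha>))))"
      using order_trans[OF superlevel_chebyshev[OF C1 less_imp_le[OF \<tau>(1)]] small] unfolding \<delta>_def .
    moreover have "0 < \<tau>\<^sup>2" using \<tau> by simp
    ultimately have m_le: "?m \<le> pi * exp (- (M / (1 + \<alpha>)))" by (rule mult_left_le_imp_le)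
    have M_le: "M \<le> (1 + \<alpha>) * ln (pi / ?m)" if "0 < ?m"
    proof -
      have "exp (M / (1 + \<alpha>)) \<le> pi / ?m" using m_le that by (simp add: exp_minus field_simps)
      then have "M / (1 + \<alpha>) \<le> ln (pi / ?m)" using that by (simp add: ln_ge_iff)
      then show ?thesis using \<alpha> by (simp add: field_simps)
    qed
    have bound: "?I \<le> ennreal (exp (c * (2 * C * (\<tau> * inverse (real (Suc k))) + (\<tau> * inverse (real (Suc k)))\<^sup>2)) * B)" for k
    proof -
      \<comment> \<open>The mesh divides \<open>\<tau>\<close>, so \<open>\<tau>\<close> is itself a
        grid level and the node statements apply to it. Refinement then removes the factor in
        front.\<close>
      define \<eta> where "\<eta> = \<tau> * inverse (real (Suc k))"
      have \<eta>: "0 < \<eta>" "real (Suc k) * \<eta> = \<tau>" using \<tau> by (simp_all add: \<eta>_def)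
      obtain y e S where path: "energy_path y e" "y 0 = 0" "e 0 = 0"
        "\<And>t. S \<le> t \<Longrightarrow> y t = y S \<and> e t = e S" "e S \<le> 1" and mono: "mono y"
        and pos: "0 < measure lborel (superlevel \<phi> (real (Suc k) * \<eta>)) \<Longrightarrow>
            y ((1 + \<alpha>) * ln (pi / measure lborel (superlevel \<phi> (real (Suc k) * \<eta>)))) = sqrt c * (real (Suc k) * \<eta>)"
        and zero: "\<And>t. measure lborel (superlevel \<phi> (real (Suc k) * \<eta>)) = 0 \<Longrightarrow> y t \<le> sqrt c * (real (Suc k) * \<eta>)"
        and le: "?I \<le> ennreal (exp (c * (2 * C * \<eta> + \<eta>\<^sup>2)) * (pi / (1 + \<alpha>))) * (moser_path y)"
        by (rule moser_functional_le_path[OF \<alpha> C1 energy \<eta>(1) C(2)], unfold c_def[symmetric]) (rule that)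
      have "(moser_path y) \<le> ennreal (1 + exp 1 + \<epsilon>)"
      proof (rule CC[OF path])
        fix t assume t: "0 \<le> t" "t \<le> M"
        have "y t \<le> \<eta>\<^sub>0"
        proof (cases "?m = 0")
          case True
          then show ?thesis using zero[of t] \<eta>(2) \<tau>(2) by simp
        next
          case False
          then have m: "0 < ?m" using measure_nonneg[of lborel "superlevel \<phi> \<tau>"] by linarith
          have "y t \<le> y ((1 + \<alpha>) * ln (pi / ?m))" using t M_le[OF m] by (intro monoD[OF mono]) simp
          also have "\<dots> = \<eta>\<^sub>0" using pos m unfolding \<eta>(2) by (simp add: \<tau>(2))
          finally show ?thesis .
        qed
        moreover have "0 \<le> y t" using monoD[OF mono t(1)] path(2) by simp
        ultimately show "\<bar>y t\<bar> \<le> \<eta>\<^sub>0" by simp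
      qed
      then have "?I \<le> ennreal (exp (c * (2 * C * \<eta> + \<eta>\<^sup>2)) * (pi / (1 + \<alpha>))) * ennreal (1 + exp 1 + \<epsilon>)"
        using le by (meson mult_left_mono order_trans zero_le)
      also have "\<dots> = ennreal (exp (c * (2 * C * \<eta> + \<eta>\<^sup>2)) * B)"
        using \<alpha> \<epsilon> by (subst ennreal_mult[symmetric]) (auto simp: B_def mult.assoc add_nonneg_nonneg)
      finally show ?thesis by (simp add: \<eta>_def)
    qed
    have "(\<lambda>k. exp (c * (2 * C * (\<tau> * inverse (real (Suc k))) + (\<tau> * inverse (real (Suc k)))\<^sup>2)) * B)
        \<longlonglongrightarrow> exp (c * (2 * C * (\<tau> * 0) + (\<tau> * 0)\<^sup>2)) * B"
      by (intro tendsto_intros LIMSEQ_inverse_real_of_nat)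
    then have "(\<lambda>k. ennreal (exp (c * (2 * C * (\<tau> * inverse (real (Suc k))) + (\<tau> * inverse (real (Suc k)))\<^sup>2)) * B)) \<longlonglongrightarrow> ennreal B"
      by (intro tendsto_ennrealI) simp
    then have "?I \<le> ennreal B" by (rule LIMSEQ_le_const) (use bound in blast)
    then show "(\<integral>\<^sup>+ x\<in>ball 0 1. ennreal (norm x powr (2 * \<alpha>) * exp (4 * pi * (1 + \<alpha>) * (\<phi> x)\<^sup>2)) \<partial>lborel)
      \<le> ennreal (pi / (1 + \<alpha>) * (1 + exp 1 + \<epsilon>))" unfolding c_def B_def .
  qed
qed

section \<open>Compactness\<close>

lemma square_integral_le:
  fixes g :: "real \<Rightarrow> real"
  assumes "continuous_on {0..1} g"
  shows "(integral {0..1} g)\<^sup>2 \<le> integral {0..1} (\<lambda>s. (g s)\<^sup>2)"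
proof -
  define a where "a = integral {0..1} g"
  have i: "g integrable_on {0..1}" "(\<lambda>s. (g s)\<^sup>2) integrable_on {0..1}"
    using assms by (auto intro!: integrable_continuous_real continuous_intros)
  have "((\<lambda>s. (g s)\<^sup>2 - 2 * a * g s + a\<^sup>2) has_integral integral {0..1} (\<lambda>s. (g s)\<^sup>2) - 2 * a * a + a\<^sup>2 * (1 - 0)) {0..1}"
    using has_integral_const_real[of "a\<^sup>2" 0 1]
    by (intro has_integral_add has_integral_diff has_integral_mult_right integrable_integral[OF i(2)])
      (use integrable_integral[OF i(1)] in \<open>auto simp: a_def\<close>)
  then have "0 \<le> integral {0..1} (\<lambda>s. (g s)\<^sup>2) - 2 * a * a + a\<^sup>2 * (1 - 0)"
  proof (rule has_integral_nonneg)
    fix s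
    have "(g s)\<^sup>2 - 2 * a * g s + a\<^sup>2 = (g s - a)\<^sup>2" by (simp add: power2_diff)
    then show "0 \<le> (g s)\<^sup>2 - 2 * a * g s + a\<^sup>2" by simp
  qed
  then show ?thesis unfolding a_def[symmetric] by (simp add: power2_eq_square)
qed

lemma nn_integral_translate:
  fixes f :: "'a::euclidean_space \<Rightarrow> ennreal"
  assumes [measurable]: "f \<in> borel_measurable borel"
  shows "(\<integral>\<^sup>+ x. f (x + v) \<partial>lborel) = (\<integral>\<^sup>+ x. f x \<partial>lborel)"
proof -
  have "(\<integral>\<^sup>+ x. f x \<partial>lborel) = (\<integral>\<^sup>+ x. f x \<partial>(distr lborel borel ((+) v)))" by (simp add: lborel_distr_plus)
  also have "\<dots> = (\<integral>\<^sup>+ x. f (v + x) \<partial>lborel)" by (subst nn_integral_distr) auto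
  finally show ?thesis by (simp add: add.commute)
qed

text \<open>The increment is the mean of \<open>G \<bullet> v\<close> along the segment. Jensen and
  Cauchy-Schwarz give a pointwise bound; after Fubini each parameter \<open>s\<close> contributes
  the same energy, since Lebesgue measure is translation invariant.\<close>

lemma translation_estimate:
  assumes C1: "C1_disc \<phi> G"
  shows "(nn_square lborel (\<lambda>x. \<phi> x - \<phi> (x + v))) \<le> ennreal ((norm v)\<^sup>2) * (nn_square lborel (\<lambda>x. norm (G x)))"
proof -
  note [measurable] = C1_disc_measurable[OF C1]
  have pw: "ennreal ((\<phi> x - \<phi> (x + v))\<^sup>2)
      \<le> ennreal ((norm v)\<^sup>2) * (\<integral>\<^sup>+ s\<in>{0..1}. ennreal ((norm (G (x + s *\<^sub>R v)))\<^sup>2) \<partial>lborel)" for x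
  proof -
    define g where "g s = G (x + s *\<^sub>R v) \<bullet> v" for s
    have cont: "continuous_on {0..1} (\<lambda>s. G (x + s *\<^sub>R v))"
      by (intro continuous_on_compose2[OF C1_disc_continuous(2)[OF C1, of UNIV]] continuous_intros) auto
    have cont_g: "continuous_on {0..1} g" unfolding g_def by (intro continuous_intros cont)
    have "(g has_integral (\<phi> (x + 1 *\<^sub>R v) - \<phi> (x + 0 *\<^sub>R v))) {0..1}"
    proof (rule fundamental_theorem_of_calculus)
      fix s :: real
      have d1: "((\<lambda>s. x + s *\<^sub>R v) has_derivative (\<lambda>h. h *\<^sub>R v)) (at s within {0..1})"
        by (auto intro!: derivative_eq_intros)
      have d2: "(\<phi> has_derivative (\<lambda>h. G (x + s *\<^sub>R v) \<bullet> h)) (at (x + s *\<^sub>R v) within (\<lambda>s. x + s *\<^sub>R v) ` {0..1})"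
        using C1 unfolding C1_disc_def by (auto intro: has_derivative_at_withinI)
      have "((\<lambda>s. \<phi> (x + s *\<^sub>R v)) has_derivative (\<lambda>h. G (x + s *\<^sub>R v) \<bullet> (h *\<^sub>R v))) (at s within {0..1})"
        by (rule has_derivative_in_compose[OF d1 d2])
      then show "((\<lambda>s. \<phi> (x + s *\<^sub>R v)) has_vector_derivative g s) (at s within {0..1})"
        by (simp add: has_vector_derivative_def g_def)
    qed simp
    then have "(\<phi> x - \<phi> (x + v))\<^sup>2 = (integral {0..1} g)\<^sup>2"
      by (simp add: integral_unique power2_commute)
    also have "\<dots> \<le> integral {0..1} (\<lambda>s. (g s)\<^sup>2)" by (rule square_integral_le[OF cont_g])
    also have "\<dots> \<le> integral {0..1} (\<lambda>s. (norm v)\<^sup>2 * (norm (G (x + s *\<^sub>R v)))\<^sup>2)"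
    proof (rule integral_le)
      show "(\<lambda>s. (g s)\<^sup>2) integrable_on {0..1}"
        by (intro integrable_continuous_real continuous_intros cont_g)
      show "(\<lambda>s. (norm v)\<^sup>2 * (norm (G (x + s *\<^sub>R v)))\<^sup>2) integrable_on {0..1}"
        by (intro integrable_continuous_real continuous_intros cont)
      fix s
      show "(g s)\<^sup>2 \<le> (norm v)\<^sup>2 * (norm (G (x + s *\<^sub>R v)))\<^sup>2"
        using power_mono[OF Cauchy_Schwarz_ineq2[of "G (x + s *\<^sub>R v)" v], of 2] by (simp add: g_def power_mult_distrib mult.commute)
    qed
    finally have le: "(\<phi> x - \<phi> (x + v))\<^sup>2 \<le> (norm v)\<^sup>2 * integral {0..1} (\<lambda>s. (norm (G (x + s *\<^sub>R v)))\<^sup>2)" by simp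
    have "((\<lambda>s. (norm (G (x + s *\<^sub>R v)))\<^sup>2) has_integral integral {0..1} (\<lambda>s. (norm (G (x + s *\<^sub>R v)))\<^sup>2)) {0..1}"
      by (intro integrable_integral integrable_continuous_real continuous_intros cont)
    from nn_integral_has_integral_lebesgue'[OF _ this]
    have eq: "(\<integral>\<^sup>+ s\<in>{0..1}. ennreal ((norm (G (x + s *\<^sub>R v)))\<^sup>2) \<partial>lborel) = ennreal (integral {0..1} (\<lambda>s. (norm (G (x + s *\<^sub>R v)))\<^sup>2))"
      by simp
    show ?thesis using ennreal_leI[OF le] unfolding eq by (simp add: ennreal_mult')
  qed
  have "(nn_square lborel (\<lambda>x. \<phi> x - \<phi> (x + v)))
    \<le> (\<integral>\<^sup>+ x. ennreal ((norm v)\<^sup>2) * (\<integral>\<^sup>+ s\<in>{0..1}. ennreal ((norm (G (x + s *\<^sub>R v)))\<^sup>2) \<partial>lborel) \<partial>lborel)"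
    using pw by (rule nn_integral_mono)
  also have "\<dots> = ennreal ((norm v)\<^sup>2) * (\<integral>\<^sup>+ x. (\<integral>\<^sup>+ s\<in>{0..1}. ennreal ((norm (G (x + s *\<^sub>R v)))\<^sup>2) \<partial>lborel) \<partial>lborel)"
    by (rule nn_integral_cmult) measurable
  also have "(\<integral>\<^sup>+ x. (\<integral>\<^sup>+ s\<in>{0..1}. ennreal ((norm (G (x + s *\<^sub>R v)))\<^sup>2) \<partial>lborel) \<partial>lborel)
      = (\<integral>\<^sup>+ s. (\<integral>\<^sup>+ x. ennreal ((norm (G (x + s *\<^sub>R v)))\<^sup>2) * indicator {0..1} s \<partial>lborel) \<partial>lborel)"
    by (rule lborel_pair.Fubini'[symmetric]) measurable
  also have "\<dots> = (\<integral>\<^sup>+ s\<in>{0..1::real}. (nn_square lborel (\<lambda>x. norm (G x))) \<partial>lborel)"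
  proof (intro nn_integral_cong)
    fix s :: real
    have "(nn_square lborel (\<lambda>x. norm (G (x + s *\<^sub>R v)))) = (nn_square lborel (\<lambda>x. norm (G x)))"
      by (rule nn_integral_translate) measurable
    then show "(\<integral>\<^sup>+ x. ennreal ((norm (G (x + s *\<^sub>R v)))\<^sup>2) * indicator {0..1} s \<partial>lborel)
      = (nn_square lborel (\<lambda>x. norm (G x))) * indicator {0..1} s"
      by (simp add: nn_integral_multc)
  qed
  also have "\<dots> = (nn_square lborel (\<lambda>x. norm (G x)))" by (simp add: nn_integral_cmult_indicator)
  finally show ?thesis .
qed

text \<open>
  A translation by a vector of length 2 moves the disc off itself.
\<close>

lemma C1_disc_poincare:
  assumes C1: "C1_disc \<phi> G"
  shows "(nn_square lborel \<phi>) \<le> 4 * (nn_square lborel (\<lambda>x. norm (G x)))"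
proof -
  define v where "v = (axis 1 2 :: real^2)"
  have v: "norm v = 2" by (simp add: v_def norm_eq_sqrt_inner inner_axis)
  have "(nn_square lborel \<phi>) \<le> (nn_square lborel (\<lambda>x. \<phi> x - \<phi> (x + v)))"
  proof (rule nn_integral_mono)
    fix x
    show "ennreal ((\<phi> x)\<^sup>2) \<le> ennreal ((\<phi> x - \<phi> (x + v))\<^sup>2)"
    proof (cases "x \<in> ball 0 1")
      case True
      have "x + v \<notin> ball 0 1" using True v norm_triangle_ineq4[of "x + v" x] by auto
      then show ?thesis using C1_disc_zero(1)[OF C1] by simp
    next
      case False
      then show ?thesis using C1_disc_zero(1)[OF C1] by simp
    qed
  qed
  also have "\<dots> \<le> ennreal ((norm v)\<^sup>2) * (nn_square lborel (\<lambda>x. norm (G x)))"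
    by (rule translation_estimate[OF C1])
  finally show ?thesis by (simp add: v)
qed

lemma sets_borel_ball [measurable]: "ball a r \<in> sets borel"
  by (rule borel_open[OF open_ball])

lemma set_integral_ball_translate:
  fixes \<phi> :: "'a::euclidean_space \<Rightarrow> real"
  assumes [measurable]: "\<phi> \<in> borel_measurable borel"
  shows "(LINT z:ball x h|lborel. \<phi> z) = (LINT v:ball 0 h|lborel. \<phi> (x + v))"
proof -
  have "(LINT z:ball x h|lborel. \<phi> z) = (\<integral>z. indicator (ball x h) z *\<^sub>R \<phi> z \<partial>(distr lborel borel ((+) x)))"
    by (simp add: lborel_distr_plus set_lebesgue_integral_def)
  also have "\<dots> = (\<integral>v. indicator (ball x h) (x + v) *\<^sub>R \<phi> (x + v) \<partial>lborel)"
    by (rule integral_distr) (auto intro!: borel_measurable_times borel_measurable_indicator assms)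
  also have "\<dots> = (LINT v:ball 0 h|lborel. \<phi> (x + v))"
    unfolding set_lebesgue_integral_def by (intro Bochner_Integration.integral_cong) (auto simp: dist_norm split: split_indicator)
  finally show ?thesis .
qed

lemma set_integrable_ball_bounded:
  fixes f :: "'a::euclidean_space \<Rightarrow> real"
  assumes [measurable]: "f \<in> borel_measurable borel" and "\<And>x. \<bar>f x\<bar> \<le> C"
  shows "set_integrable lborel (ball a r) f" unfolding set_integrable_def
proof (rule integrable_ball_bounded)
  show "\<bar>indicator (ball a r) x *\<^sub>R f x\<bar> \<le> C * indicator (ball a r) x" for x
    using assms(2)[of x] by (auto split: split_indicator)
qed (auto intro!: borel_measurable_times borel_measurable_indicator assms)

lemma set_nn_integral_eq_set_lebesgue_integral:
  fixes f :: "'a \<Rightarrow> real"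
  assumes "set_integrable M A f" and nonneg: "\<And>x. 0 \<le> f x"
  shows "(\<integral>\<^sup>+ x\<in>A. ennreal (f x) \<partial>M) = ennreal (LINT x:A|M. f x)"
proof -
  have "(\<integral>\<^sup>+ x\<in>A. ennreal (f x) \<partial>M) = (\<integral>\<^sup>+ x. ennreal (indicator A x *\<^sub>R f x) \<partial>M)"
    by (intro nn_integral_cong) (auto split: split_indicator)
  also have "\<dots> = ennreal (LINT x:A|M. f x)"
    using assms unfolding set_lebesgue_integral_def set_integrable_def by (intro nn_integral_eq_integral) auto
  finally show ?thesis .
qed

text \<open>No subsequence is extracted. By the translation estimate, \<phi> differs from its mean
  over a ball of radius \<open>h\<close> by order \<open>h\<close> in the mean square, uniformly in
  \<open>n\<close>; for fixed \<open>h\<close> the ball integrals tend to 0 pointwise and are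
  bounded, so dominated convergence applies.\<close>

lemma rellich:
  fixes K :: real
  assumes C1: "\<And>n. C1_disc (\<phi> n) (G n)"
    and energy: "\<And>n. (nn_square lborel (\<lambda>x. norm (G n x))) \<le> ennreal K" and K: "0 \<le> K"
    and weak: "\<And>x h. (\<lambda>n. LINT z:ball x h|lborel. \<phi> n z) \<longlonglongrightarrow> 0"
  shows "(\<lambda>n. \<integral>x. (\<phi> n x)\<^sup>2 \<partial>lborel) \<longlonglongrightarrow> 0"
proof -
  have [measurable]: "\<phi> n \<in> borel_measurable borel" "G n \<in> borel_measurable borel" for n
    using C1_disc_measurable[OF C1] by auto
  define N where "N n = (\<integral>x. (\<phi> n x)\<^sup>2 \<partial>lborel)" for n
  have N_eq: "(nn_square lborel (\<phi> n)) = ennreal (N n)" for n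
    unfolding N_def by (intro nn_integral_eq_integral C1_disc_integrable_square[OF C1]) auto
  have N_nonneg: "0 \<le> N n" for n by (simp add: N_def)
  have N_le: "N n \<le> 4 * K" for n
  proof -
    have "ennreal (N n) \<le> 4 * ennreal K"
      unfolding N_eq[symmetric] using C1_disc_poincare[OF C1, of n] mult_left_mono[OF energy[of n], of 4] by (auto intro: order_trans)
    also have "\<dots> = ennreal (4 * K)" using K by (simp add: ennreal_mult')
    finally show ?thesis using K by simp
  qed
  \<comment> \<open>The integral over the ball, not divided by its area; hence the factor
    \<open>1 / (pi * h\<^sup>2)\<^sup>2\<close> in \<open>main\<close>.\<close>
  define b where "b n h x = (LINT v:ball 0 h|lborel. \<phi> n (x + v))" for n h x
  define bsq where "bsq n h = (\<integral>x. (b n h x)\<^sup>2 * indicator (ball 0 1 :: (real^2) set) x \<partial>lborel)" for n h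
  have bsq_nonneg: "0 \<le> bsq n h" for n h by (simp add: bsq_def)
  have b_lim: "(\<lambda>n. b n h x) \<longlonglongrightarrow> 0" for h x
  proof -
    have "(\<lambda>n. LINT z:ball x h|lborel. \<phi> n z) = (\<lambda>n. b n h x)"
      unfolding b_def by (intro ext set_integral_ball_translate) measurable
    then show ?thesis using weak[of x h] by simp
  qed
  have b_meas [measurable]: "b n h \<in> borel_measurable borel" for n h
    unfolding b_def set_lebesgue_integral_def by measurable
  have area: "measure lborel (ball 0 h :: (real^2) set) = pi * h\<^sup>2" if "0 < h" for h
    using that by (simp add: content_ball unit_ball_vol_2)
  have int_shift: "set_integrable lborel (ball 0 h) (\<lambda>v. \<phi> n (x + v))" "set_integrable lborel (ball 0 h) (\<lambda>v. (\<phi> n (x + v))\<^sup>2)"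
    "set_integrable lborel (ball 0 h) (\<lambda>v. k)" for n x h and k :: real
  proof -
    obtain C where C: "0 < C" "\<And>x. \<bar>\<phi> n x\<bar> \<le> C" "\<And>x. norm (G n x) \<le> C" using C1_disc_bounded[OF C1] by blast
    show "set_integrable lborel (ball 0 h) (\<lambda>v. \<phi> n (x + v))" using C by (intro set_integrable_ball_bounded[of _ C]) auto
    show "set_integrable lborel (ball 0 h) (\<lambda>v. (\<phi> n (x + v))\<^sup>2)"
    proof (rule set_integrable_ball_bounded[of _ "C\<^sup>2"])
      fix v show "\<bar>(\<phi> n (x + v))\<^sup>2\<bar> \<le> C\<^sup>2" using power_mono[OF C(2)[of "x + v"], of 2] by simp
    qed simp
    show "set_integrable lborel (ball 0 h) (\<lambda>v. k)" by (rule set_integrable_ball_bounded[of _ "\<bar>k\<bar>"]) auto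
  qed
  have set_const: "(LINT v:ball (0 :: real^2) h|lborel. k) = k * (pi * h\<^sup>2)" if "0 < h" for h k :: real
  proof -
    have "(LINT v:ball (0 :: real^2) h|lborel. k) = measure lborel (ball (0 :: real^2) h) *\<^sub>R k"
      using emeasure_lborel_ball_finite[of "0 :: real^2" h] by (intro set_integral_const) auto
    then show ?thesis using area[OF that] by (simp add: mult.commute)
  qed
  have shift_square_le: "(LINT v:ball 0 h|lborel. (\<phi> n (x + v))\<^sup>2) \<le> N n" for n h x
  proof -
    have "(LINT v:ball 0 h|lborel. (\<phi> n (x + v))\<^sup>2) = (LINT z:ball x h|lborel. (\<phi> n z)\<^sup>2)"
      by (rule set_integral_ball_translate[symmetric]) measurable
    also have "\<dots> \<le> N n" unfolding N_def set_lebesgue_integral_def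
      by (intro integral_mono C1_disc_integrable_square[OF C1] integrable_mult_indicator[of _ lborel "\<lambda>z. (\<phi> n z)\<^sup>2"]) (auto split: split_indicator)
    finally show ?thesis .
  qed
  have b_bound: "\<bar>b n h x\<bar> \<le> pi * h\<^sup>2 + 4 * K" if h: "0 < h" for n h x
  proof -
    have "\<bar>b n h x\<bar> \<le> (LINT v:ball 0 h|lborel. \<bar>\<phi> n (x + v)\<bar>)"
      using set_integral_norm_bound[OF int_shift(1)[of h n x]] by (simp add: b_def)
    also have "\<dots> \<le> (LINT v:ball 0 h|lborel. 1 + (\<phi> n (x + v))\<^sup>2)"
    proof (rule set_integral_mono)
      show "set_integrable lborel (ball 0 h) (\<lambda>v. \<bar>\<phi> n (x + v)\<bar>)" by (rule set_integrable_abs[OF int_shift(1)])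
      show "set_integrable lborel (ball 0 h) (\<lambda>v. 1 + (\<phi> n (x + v))\<^sup>2)" by (intro set_integral_add(1) int_shift)
      fix v
      have "0 \<le> (\<bar>\<phi> n (x + v)\<bar> - 1)\<^sup>2 + \<bar>\<phi> n (x + v)\<bar>\<^sup>2 + 1" by simp
      then show "\<bar>\<phi> n (x + v)\<bar> \<le> 1 + (\<phi> n (x + v))\<^sup>2" by (simp add: power2_eq_square algebra_simps abs_mult_self)
    qed
    also have "\<dots> = 1 * (pi * h\<^sup>2) + (LINT v:ball 0 h|lborel. (\<phi> n (x + v))\<^sup>2)"
      by (simp only: set_integral_add(2)[OF int_shift(3,2)] set_const[OF h])
    also have "\<dots> \<le> pi * h\<^sup>2 + 4 * K" using shift_square_le[of h n x] N_le[of n] by simp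
    finally show ?thesis .
  qed
  have b_sq_le: "\<bar>(b n h x)\<^sup>2 * indicator (ball 0 1) x\<bar> \<le> (pi * h\<^sup>2 + 4 * K)\<^sup>2 * indicator (ball 0 1 :: (real^2) set) x"
    if h: "0 < h" for n h x
    using power_mono[OF b_bound[OF h, of n x], of 2] by (auto split: split_indicator)
  have int_b: "integrable lborel (\<lambda>x. (b n h x)\<^sup>2 * indicator (ball 0 1 :: (real^2) set) x)" if h: "0 < h" for n h
    by (rule integrable_ball_bounded[OF _ b_sq_le[OF h]]) simp
  have b2_lim: "(\<lambda>n. bsq n h) \<longlonglongrightarrow> (\<integral>x. 0 \<partial>(lborel :: (real^2) measure))" if h: "0 < h" for h
    unfolding bsq_def
  proof (rule integral_dominated_convergence[OF _ _ integrable_indicator_ball[of "(pi * h\<^sup>2 + 4 * K)\<^sup>2" 0 1]])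
    show "AE x in lborel. (\<lambda>n. (b n h x)\<^sup>2 * indicator (ball 0 1) x) \<longlonglongrightarrow> 0"
    proof (rule AE_I2)
      fix x :: "real^2"
      have "(\<lambda>n. (b n h x)\<^sup>2 * indicator (ball 0 1) x) \<longlonglongrightarrow> 0\<^sup>2 * indicator (ball 0 1) x"
        by (intro tendsto_intros b_lim)
      then show "(\<lambda>n. (b n h x)\<^sup>2 * indicator (ball 0 1) x) \<longlonglongrightarrow> 0" by simp
    qed
    show "AE x in lborel. norm ((b n h x)\<^sup>2 * indicator (ball 0 1) x) \<le> (pi * h\<^sup>2 + 4 * K)\<^sup>2 * indicator (ball 0 1 :: (real^2) set) x" for n
      using b_sq_le[OF h, of n] by (intro AE_I2) (simp only: real_norm_def)
  qed auto
  have main: "N n \<le> 2 * h\<^sup>2 * K + 4 / (pi * h\<^sup>2)\<^sup>2 * (bsq n h)"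
    if h: "0 < h" for n h
  proof -
    define A where "A = pi * h\<^sup>2"
    have A: "0 < A" using h by (simp add: A_def)
    \<comment> \<open>Integrate the squared difference over the ball, expand it, drop the integral
      of the squared translate, and split the cross term by Young's inequality so that half of the
      main term remains.\<close>
    have pw: "ennreal (A * (\<phi> n x)\<^sup>2) \<le> 2 * (\<integral>\<^sup>+ v\<in>ball 0 h. ennreal ((\<phi> n x - \<phi> n (x + v))\<^sup>2) \<partial>lborel)
        + ennreal (4 / A * ((b n h x)\<^sup>2 * indicator (ball 0 1) x))" for x
    proof (cases "x \<in> ball 0 1")
      case True
      have eq: "(\<phi> n x - \<phi> n (x + v))\<^sup>2 = (\<phi> n x)\<^sup>2 - 2 * \<phi> n x * \<phi> n (x + v) + (\<phi> n (x + v))\<^sup>2" for v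
        by (simp add: power2_diff)
      have int: "set_integrable lborel (ball 0 h) (\<lambda>v. (\<phi> n x - \<phi> n (x + v))\<^sup>2)"
        unfolding eq by (intro set_integral_add(1) set_integral_diff(1) set_integrable_mult_right int_shift)
      have J: "(LINT v:ball 0 h|lborel. (\<phi> n x - \<phi> n (x + v))\<^sup>2)
          = A * (\<phi> n x)\<^sup>2 - 2 * \<phi> n x * b n h x + (LINT v:ball 0 h|lborel. (\<phi> n (x + v))\<^sup>2)"
      proof -
        have i: "set_integrable lborel (ball 0 h) (\<lambda>v. 2 * \<phi> n x * \<phi> n (x + v))"
          by (intro set_integrable_mult_right int_shift)
        have "(LINT v:ball 0 h|lborel. (\<phi> n x - \<phi> n (x + v))\<^sup>2)
            = (LINT v:ball (0 :: real^2) h|lborel. (\<phi> n x)\<^sup>2) - (LINT v:ball 0 h|lborel. 2 * \<phi> n x * \<phi> n (x + v))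
              + (LINT v:ball 0 h|lborel. (\<phi> n (x + v))\<^sup>2)"
          unfolding eq set_integral_add(2)[OF set_integral_diff(1)[OF int_shift(3) i] int_shift(2)]
            set_integral_diff(2)[OF int_shift(3) i] ..
        then show ?thesis by (simp add: set_const[OF h] A_def b_def)
      qed
      have "0 \<le> (LINT v:ball 0 h|lborel. (\<phi> n (x + v))\<^sup>2)"
        unfolding set_lebesgue_integral_def by (intro integral_nonneg_AE AE_I2) simp
      moreover have "2 * \<phi> n x * b n h x \<le> A * (\<phi> n x)\<^sup>2 / 2 + 2 / A * (b n h x)\<^sup>2"
      proof -
        have "0 \<le> (A * \<phi> n x - 2 * b n h x)\<^sup>2 / (2 * A)" using A by simp
        also have "\<dots> = A * (\<phi> n x)\<^sup>2 / 2 - 2 * \<phi> n x * b n h x + 2 / A * (b n h x)\<^sup>2"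
          using A by (simp add: power2_eq_square field_simps)
        finally show ?thesis by simp
      qed
      ultimately have "A * (\<phi> n x)\<^sup>2 \<le> 2 * (LINT v:ball 0 h|lborel. (\<phi> n x - \<phi> n (x + v))\<^sup>2) + 4 / A * (b n h x)\<^sup>2"
        unfolding J by simp
      moreover have "(\<integral>\<^sup>+ v\<in>ball 0 h. ennreal ((\<phi> n x - \<phi> n (x + v))\<^sup>2) \<partial>lborel)
          = ennreal (LINT v:ball 0 h|lborel. (\<phi> n x - \<phi> n (x + v))\<^sup>2)"
        by (intro set_nn_integral_eq_set_lebesgue_integral int) auto
      moreover have "0 \<le> (LINT v:ball 0 h|lborel. (\<phi> n x - \<phi> n (x + v))\<^sup>2)"
        unfolding set_lebesgue_integral_def by (intro integral_nonneg_AE AE_I2) simp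
      ultimately show ?thesis using True A
        by (simp add: ennreal_leI flip: ennreal_plus ennreal_numeral ennreal_mult')
    next
      case False
      then show ?thesis using C1_disc_zero(1)[OF C1] by simp
    qed
    have "ennreal (A * N n) = (\<integral>\<^sup>+ x. ennreal (A * (\<phi> n x)\<^sup>2) \<partial>lborel)"
      using A by (simp add: ennreal_mult' nn_integral_cmult N_eq)
    also have "\<dots> \<le> (\<integral>\<^sup>+ x. 2 * (\<integral>\<^sup>+ v\<in>ball 0 h. ennreal ((\<phi> n x - \<phi> n (x + v))\<^sup>2) \<partial>lborel)
        + ennreal (4 / A * ((b n h x)\<^sup>2 * indicator (ball 0 1) x)) \<partial>lborel)"
      using pw by (rule nn_integral_mono)
    also have "\<dots> = 2 * (\<integral>\<^sup>+ x. (\<integral>\<^sup>+ v\<in>ball 0 h. ennreal ((\<phi> n x - \<phi> n (x + v))\<^sup>2) \<partial>lborel) \<partial>lborel)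
        + (\<integral>\<^sup>+ x. ennreal (4 / A * ((b n h x)\<^sup>2 * indicator (ball 0 1) x)) \<partial>lborel)"
      by (subst nn_integral_add, measurable, subst nn_integral_cmult, measurable)
    also have "(\<integral>\<^sup>+ x. (\<integral>\<^sup>+ v\<in>ball 0 h. ennreal ((\<phi> n x - \<phi> n (x + v))\<^sup>2) \<partial>lborel) \<partial>lborel)
       = (\<integral>\<^sup>+ v. (\<integral>\<^sup>+ x. ennreal ((\<phi> n x - \<phi> n (x + v))\<^sup>2) * indicator (ball 0 h) v \<partial>lborel) \<partial>lborel)"
      by (rule lborel_pair.Fubini'[symmetric]) measurable
    also have "\<dots> \<le> (\<integral>\<^sup>+ v\<in>ball 0 h :: (real^2) set. ennreal (h\<^sup>2 * K) \<partial>lborel)"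
    proof (rule nn_integral_mono)
      fix v :: "real^2"
      show "(\<integral>\<^sup>+ x. ennreal ((\<phi> n x - \<phi> n (x + v))\<^sup>2) * indicator (ball 0 h) v \<partial>lborel) \<le> ennreal (h\<^sup>2 * K) * indicator (ball 0 h) v"
      proof (cases "v \<in> ball 0 h")
        case True
        have "(nn_square lborel (\<lambda>x. \<phi> n x - \<phi> n (x + v))) \<le> ennreal ((norm v)\<^sup>2) * (nn_square lborel (\<lambda>x. norm (G n x)))"
          by (rule translation_estimate[OF C1])
        also have "\<dots> \<le> ennreal (h\<^sup>2) * ennreal K"
          using True by (intro mult_mono ennreal_leI energy power_mono) auto
        finally show ?thesis using True by (simp add: ennreal_mult')
      qed simp
    qed
    also have "\<dots> = ennreal (h\<^sup>2 * K * A)"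
    proof -
      have "emeasure lborel (ball 0 h :: (real^2) set) = ennreal A"
        using h by (simp add: emeasure_ball unit_ball_vol_2 A_def)
      then show ?thesis using K A by (simp add: nn_integral_cmult_indicator ennreal_mult)
    qed
    also have "(\<integral>\<^sup>+ x. ennreal (4 / A * ((b n h x)\<^sup>2 * indicator (ball 0 1) x)) \<partial>lborel)
        = ennreal (4 / A * (bsq n h))"
      using int_b[OF h, of n] A by (subst nn_integral_eq_integral) (auto simp: bsq_def)
    finally have "ennreal (A * N n) \<le> 2 * ennreal (h\<^sup>2 * K * A) + ennreal (4 / A * (bsq n h))"
      by (simp add: mult_left_mono add_right_mono)
    also have "\<dots> = ennreal (2 * (h\<^sup>2 * K * A) + 4 / A * (bsq n h))"
      using K A bsq_nonneg by (simp flip: ennreal_plus ennreal_numeral ennreal_mult')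
    finally have "A * N n \<le> 2 * (h\<^sup>2 * K * A) + 4 / A * (bsq n h)"
      using K A bsq_nonneg by (subst (asm) ennreal_le_iff) auto
    then have "N n \<le> (2 * (h\<^sup>2 * K * A) + 4 / A * (bsq n h)) / A"
      using A by (simp add: pos_le_divide_eq mult.commute)
    also have "\<dots> = 2 * h\<^sup>2 * K + 4 / A\<^sup>2 * (bsq n h)"
      using A by (simp add: add_divide_distrib power2_eq_square)
    finally show ?thesis by (simp add: A_def)
  qed
  show ?thesis unfolding N_def[symmetric]
  proof (rule LIMSEQ_I)
    fix \<epsilon> :: real assume \<epsilon>: "0 < \<epsilon>"
    \<comment> \<open>Chosen so that \<open>2 * h\<^sup>2 * K \<le> \<epsilon> / 2\<close>;
      \<open>K + 1\<close> in place of \<open>K\<close> allows \<open>K = 0\<close>.\<close>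
    define h where "h = sqrt (\<epsilon> / (4 * (K + 1)))"
    have h: "0 < h" using \<epsilon> K by (simp add: h_def)
    have "h\<^sup>2 = \<epsilon> / (4 * (K + 1))" using \<epsilon> K by (simp add: h_def)
    then have "\<epsilon> / 2 - 2 * h\<^sup>2 * K = 2 * h\<^sup>2" using K by (simp add: field_simps)
    then have hK: "2 * h\<^sup>2 * K \<le> \<epsilon> / 2" using zero_le_power2[of h] by linarith
    have "(\<lambda>n. 4 / (pi * h\<^sup>2)\<^sup>2 * (bsq n h)) \<longlonglongrightarrow> 4 / (pi * h\<^sup>2)\<^sup>2 * (\<integral>x. 0 \<partial>(lborel :: (real^2) measure))"
      by (intro tendsto_mult tendsto_const b2_lim[OF h])
    then have "\<forall>\<^sub>F n in sequentially. 4 / (pi * h\<^sup>2)\<^sup>2 * (bsq n h) < \<epsilon> / 2"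
      using \<epsilon> by (intro order_tendstoD(2)) auto
    then have "\<forall>\<^sub>F n in sequentially. N n < \<epsilon>"
    proof eventually_elim
      case (elim n)
      then show ?case using main[OF h, of n] hK by linarith
    qed
    then show "\<exists>n0. \<forall>n\<ge>n0. norm (N n - 0) < \<epsilon>"
      using N_nonneg by (simp add: eventually_sequentially)
  qed
qed

section \<open>Passage to the Sobolev space\<close>

lemma test_fun_C1_disc:
  assumes "test_fun (ball 0 1) f"
  shows "C1_disc f (pgrad f)" unfolding C1_disc_def
proof (intro conjI allI impI)
  have "Ck 1 f" using assms by (simp add: test_fun_def smooth_fun_def)
  then have diff: "f differentiable (at x)"
    and partial: "continuous_on UNIV (\<lambda>x. frechet_derivative f (at x) (axis i 1))" for x i
    by (auto simp: One_nat_def differentiable_on_def)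
  show der: "(f has_derivative (\<lambda>h. pgrad f x \<bullet> h)) (at x)" for x
  proof -
    have d: "(f has_derivative frechet_derivative f (at x)) (at x)" using diff frechet_derivative_works by blast
    have "frechet_derivative f (at x) h = pgrad f x \<bullet> h" for h
    proof -
      have lin: "linear (frechet_derivative f (at x))" using d has_derivative_linear by blast
      have "frechet_derivative f (at x) h = frechet_derivative f (at x) (\<Sum>i\<in>UNIV. h $ i *\<^sub>R axis i 1)"
        by (simp add: basis_expansion flip: scalar_mult_eq_scaleR)
      also have "\<dots> = (\<Sum>i\<in>UNIV. h $ i * frechet_derivative f (at x) (axis i 1))"
        using lin by (simp add: linear_sum linear_scale)
      also have "\<dots> = pgrad f x \<bullet> h" by (simp add: inner_vec_def pgrad_def mult.commute)
      finally show ?thesis .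
    qed
    then show ?thesis using d by presburger
  qed
  show "continuous_on UNIV (pgrad f)" unfolding pgrad_def by (intro continuous_on_vec_lambda partial)
  fix x assume "x \<notin> ball (0 :: real^2) 1"
  then have x: "x \<in> - closure {x. f x \<noteq> 0}" using assms by (auto simp: test_fun_def)
  have zero: "f y = 0" if "y \<in> - closure {x. f x \<noteq> 0}" for y
    using that closure_subset[of "{x. f x \<noteq> 0}"] by auto
  show "f x = 0" by (rule zero[OF x])
  have "((\<lambda>x. 0) has_derivative (\<lambda>h. 0)) (at x)" by simp
  then have "(f has_derivative (\<lambda>h. 0)) (at x)"
  proof (rule has_derivative_transform_within_open[OF _ _ x])
    show "0 = f y" if "y \<in> - closure {x. f x \<noteq> 0}" for y using zero[OF that] by (rule sym)
  qed (rule open_Compl[OF closed_closure])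
  then have "(\<lambda>h. pgrad f x \<bullet> h) = (\<lambda>h. 0)" using der by (metis has_derivative_unique)
  then have "pgrad f x \<bullet> pgrad f x = 0" by meson
  then show "pgrad f x = 0" by simp
qed

lemma square_sum_le: "(a + b)\<^sup>2 \<le> 2 * a\<^sup>2 + 2 * (b::real)\<^sup>2"
  using zero_le_power2[of "a - b"] by (simp add: power2_eq_square algebra_simps)

text \<open>The factor on \<open>b\<close> can be kept as close to 1 as desired; the large factor
  falls on a difference that is made small. A cruder splitting would lose the critical energy
  bound.\<close>

lemma norm_square_young:
  fixes a b :: "'a::real_normed_vector"
  assumes "0 < \<theta>"
  shows "(norm a)\<^sup>2 \<le> (1 + \<theta>) * (norm b)\<^sup>2 + (1 + 1 / \<theta>) * (norm (a - b))\<^sup>2"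
proof -
  define p q where "p = norm b" and "q = norm (a - b)"
  have "norm a \<le> p + q" unfolding p_def q_def by (metis add.commute diff_add_cancel norm_triangle_ineq)
  then have "(norm a)\<^sup>2 \<le> (p + q)\<^sup>2" by (intro power_mono) auto
  also have "\<dots> \<le> (1 + \<theta>) * p\<^sup>2 + (1 + 1 / \<theta>) * q\<^sup>2"
  proof -
    have "0 \<le> (\<theta> * p - q)\<^sup>2 / \<theta>" using assms by simp
    also have "\<dots> = \<theta> * p\<^sup>2 - 2 * p * q + q\<^sup>2 / \<theta>" using assms by (simp add: power2_eq_square field_simps)
    finally show ?thesis by (simp add: power2_eq_square algebra_simps)
  qed
  finally show ?thesis by (simp add: p_def q_def)
qed

lemma C1_disc_energy:
  assumes C1: "C1_disc \<phi> G"
  shows "(\<integral>\<^sup>+ x\<in>ball 0 1. ennreal ((norm (G x))\<^sup>2) \<partial>lborel) = ennreal (dirichlet (ball 0 1) G)"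
    and "(nn_square lborel (\<lambda>x. norm (G x))) = ennreal (dirichlet (ball 0 1) G)"
proof -
  note [measurable] = C1_disc_measurable[OF C1]
  obtain C where C: "0 < C" "\<And>x. \<bar>\<phi> x\<bar> \<le> C" "\<And>x. norm (G x) \<le> C" using C1_disc_bounded[OF C1] by blast
  show 1: "(\<integral>\<^sup>+ x\<in>ball 0 1. ennreal ((norm (G x))\<^sup>2) \<partial>lborel) = ennreal (dirichlet (ball 0 1) G)"
  proof (intro set_nn_integral_eq_set_lebesgue_integral set_integrable_ball_bounded[of _ "C\<^sup>2"])
    fix x show "\<bar>(norm (G x))\<^sup>2\<bar> \<le> C\<^sup>2" using power_mono[OF C(3)[of x], of 2] by simp
  qed auto
  have "(nn_square lborel (\<lambda>x. norm (G x))) = (\<integral>\<^sup>+ x\<in>ball 0 1. ennreal ((norm (G x))\<^sup>2) \<partial>lborel)"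
    using C1_disc_zero(2)[OF C1] by (intro nn_integral_cong) (auto split: split_indicator)
  with 1 show "(nn_square lborel (\<lambda>x. norm (G x))) = ennreal (dirichlet (ball 0 1) G)" by simp
qed

lemma C1_disc_nn_square:
  assumes C1: "C1_disc \<phi> G"
  shows "(nn_square lebesgue \<phi>) = ennreal (\<integral>x. (\<phi> x)\<^sup>2 \<partial>lborel)"
  unfolding nn_integral_completion by (intro nn_integral_eq_integral C1_disc_integrable_square[OF C1]) auto

lemma nn_integral_square_le:
  fixes f h :: "'a \<Rightarrow> real"
  assumes [measurable]: "f \<in> borel_measurable M" "h \<in> borel_measurable M"
  shows "(nn_square M f) \<le> 2 * (nn_square M (\<lambda>x. h x - f x)) + 2 * (nn_square M h)"
proof -
  have "(nn_square M f) \<le> (\<integral>\<^sup>+ x. 2 * ennreal ((h x - f x)\<^sup>2) + 2 * ennreal ((h x)\<^sup>2) \<partial>M)"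
  proof (rule nn_integral_mono)
    fix x
    have "(f x)\<^sup>2 \<le> 2 * (h x - f x)\<^sup>2 + 2 * (h x)\<^sup>2"
      using square_sum_le[of "f x - h x" "h x"] by (simp add: power2_commute)
    then have "ennreal ((f x)\<^sup>2) \<le> ennreal (2 * (h x - f x)\<^sup>2 + 2 * (h x)\<^sup>2)" by (rule ennreal_leI)
    then show "ennreal ((f x)\<^sup>2) \<le> 2 * ennreal ((h x - f x)\<^sup>2) + 2 * ennreal ((h x)\<^sup>2)"
      by (simp add: ennreal_plus ennreal_mult')
  qed
  also have "\<dots> = 2 * (nn_square M (\<lambda>x. h x - f x)) + 2 * (nn_square M h)"
    by (simp add: nn_integral_add nn_integral_cmult)
  finally show ?thesis .
qed

lemma C1_disc_measurable_lebesgue: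
  "C1_disc \<phi> G \<Longrightarrow> \<phi> \<in> borel_measurable lebesgue" "C1_disc \<phi> G \<Longrightarrow> G \<in> borel_measurable lebesgue"
  using C1_disc_measurable by (auto intro: measurable_completion)

text \<open>An approximant cannot be expected to keep the energy at most 1, only at most
  \<open>1 + \<rho>\<close>. The bound on \<open>g\<close> concerns the disc alone, which suffices
  because the gradient of the approximant vanishes elsewhere.\<close>

lemma H10_approx:
  assumes H: "H10_grad (ball 0 1) u g"
    and energy: "(\<integral>\<^sup>+ x\<in>ball 0 1. ennreal ((norm (g x))\<^sup>2) \<partial>lebesgue) \<le> 1" and \<rho>: "0 < \<rho>"
  obtains \<phi> G where "C1_disc \<phi> G" "(dirichlet (ball 0 1) G) \<le> 1 + \<rho>"
    "(nn_square lebesgue (\<lambda>x. \<phi> x - u x)) \<le> ennreal \<rho>"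
proof -
  from H obtain \<phi> where u [measurable]: "u \<in> borel_measurable lebesgue" "g \<in> borel_measurable lebesgue"
    and test: "\<And>k. test_fun (ball 0 1) (\<phi> k)"
    and lim: "(\<lambda>k. \<integral>\<^sup>+ x. ennreal ((\<phi> k x - u x)\<^sup>2) \<partial>lebesgue) \<longlonglongrightarrow> 0"
      "(\<lambda>k. \<integral>\<^sup>+ x. ennreal ((norm (pgrad (\<phi> k) x - g x))\<^sup>2) \<partial>lebesgue) \<longlonglongrightarrow> 0"
    unfolding H10_grad_def by blast
  \<comment> \<open>Half of the excess \<open>\<rho>\<close> comes from the factor
    \<open>1 + \<theta>\<close>, the other half from \<open>\<kappa>\<close> times a gradient error
    below \<open>\<rho> / 2 / \<kappa>\<close>.\<close>
  define \<theta> where "\<theta> = \<rho> / 2"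
  define \<kappa> where "\<kappa> = (1 + 1 / \<theta>)"
  have \<theta>: "0 < \<theta>" "0 < \<kappa>" using \<rho> by (auto simp: \<theta>_def \<kappa>_def add_pos_pos)
  have "\<forall>\<^sub>F k in sequentially. (nn_square lebesgue (\<lambda>x. \<phi> k x - u x)) < ennreal \<rho>"
    using \<rho> by (intro order_tendstoD(2)[OF lim(1)]) auto
  moreover have "\<forall>\<^sub>F k in sequentially. (nn_square lebesgue (\<lambda>x. norm (pgrad (\<phi> k) x - g x))) < ennreal (\<rho> / 2 / \<kappa>)"
    using \<rho> \<theta> by (intro order_tendstoD(2)[OF lim(2)]) auto
  ultimately have "\<forall>\<^sub>F k in sequentially. (nn_square lebesgue (\<lambda>x. \<phi> k x - u x)) < ennreal \<rho> \<and>
      (nn_square lebesgue (\<lambda>x. norm (pgrad (\<phi> k) x - g x))) < ennreal (\<rho> / 2 / \<kappa>)"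
    by (rule eventually_conj)
  then obtain k where k: "(nn_square lebesgue (\<lambda>x. \<phi> k x - u x)) < ennreal \<rho>"
      "(nn_square lebesgue (\<lambda>x. norm (pgrad (\<phi> k) x - g x))) < ennreal (\<rho> / 2 / \<kappa>)"
    by (auto simp: eventually_sequentially)
  define G where "G = pgrad (\<phi> k)"
  have C1: "C1_disc (\<phi> k) G" unfolding G_def by (rule test_fun_C1_disc[OF test])
  note [measurable] = C1_disc_measurable_lebesgue[OF C1]
  have "ennreal (dirichlet (ball 0 1) G) = (\<integral>\<^sup>+ x\<in>ball 0 1. ennreal ((norm (G x))\<^sup>2) \<partial>lebesgue)"
    using C1_disc_energy(1)[OF C1] by (simp add: nn_integral_completion)
  also have "\<dots> \<le> (\<integral>\<^sup>+ x. ennreal (1 + \<theta>) * (ennreal ((norm (g x))\<^sup>2) * indicator (ball 0 1) x)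
        + ennreal \<kappa> * ennreal ((norm (G x - g x))\<^sup>2) \<partial>lebesgue)"
  proof (rule nn_integral_mono)
    fix x
    have "ennreal ((norm (G x))\<^sup>2) \<le> ennreal ((1 + \<theta>) * (norm (g x))\<^sup>2 + \<kappa> * (norm (G x - g x))\<^sup>2)"
      unfolding \<kappa>_def by (intro ennreal_leI norm_square_young \<theta>)
    also have "\<dots> = ennreal (1 + \<theta>) * ennreal ((norm (g x))\<^sup>2) + ennreal \<kappa> * ennreal ((norm (G x - g x))\<^sup>2)"
      using \<theta> by (subst ennreal_plus) (auto simp: ennreal_mult')
    finally show "ennreal ((norm (G x))\<^sup>2) * indicator (ball 0 1) x \<le> ennreal (1 + \<theta>) * (ennreal ((norm (g x))\<^sup>2) * indicator (ball 0 1) x)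
        + ennreal \<kappa> * ennreal ((norm (G x - g x))\<^sup>2)"
      by (auto split: split_indicator)
  qed
  also have "\<dots> = ennreal (1 + \<theta>) * (\<integral>\<^sup>+ x\<in>ball 0 1. ennreal ((norm (g x))\<^sup>2) \<partial>lebesgue)
      + ennreal \<kappa> * (nn_square lebesgue (\<lambda>x. norm (G x - g x)))"
  proof -
    have "(\<lambda>x. ennreal ((norm (g x))\<^sup>2) * indicator (ball 0 1) x) \<in> borel_measurable lebesgue"
      by (intro borel_measurable_times_ennreal borel_measurable_indicator) auto
    then show ?thesis by (simp add: nn_integral_add nn_integral_cmult)
  qed
  also have "\<dots> \<le> ennreal (1 + \<theta>) * 1 + ennreal \<kappa> * ennreal (\<rho> / 2 / \<kappa>)"
    unfolding G_def by (intro add_mono mult_left_mono energy less_imp_le[OF k(2)]) auto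
  also have "\<dots> = ennreal (1 + \<rho>)"
    using \<theta> \<rho> by (simp add: \<theta>_def ennreal_mult[symmetric] del: ennreal_plus flip: ennreal_plus)
  finally have "(dirichlet (ball 0 1) G) \<le> 1 + \<rho>" using \<rho> by (subst (asm) ennreal_le_iff) auto
  with that[OF C1] k(1) show thesis by simp
qed

lemma in_H10_square_integrable:
  assumes "in_H10 (ball 0 1) u"
  shows "u \<in> borel_measurable lebesgue" "integrable lebesgue (\<lambda>x. (u x)\<^sup>2)"
proof -
  from assms obtain g \<phi> where u [measurable]: "u \<in> borel_measurable lebesgue"
    and test: "\<And>k. test_fun (ball 0 1) (\<phi> k)"
    and lim: "(\<lambda>k. \<integral>\<^sup>+ x. ennreal ((\<phi> k x - u x)\<^sup>2) \<partial>lebesgue) \<longlonglongrightarrow> 0"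
    unfolding in_H10_def H10_grad_def by blast
  show "u \<in> borel_measurable lebesgue" by (rule u)
  have "\<forall>\<^sub>F k in sequentially. (nn_square lebesgue (\<lambda>x. \<phi> k x - u x)) < 1"
    by (intro order_tendstoD(2)[OF lim]) auto
  then obtain k where k: "(nn_square lebesgue (\<lambda>x. \<phi> k x - u x)) < 1" by (auto simp: eventually_sequentially)
  have C1: "C1_disc (\<phi> k) (pgrad (\<phi> k))" by (rule test_fun_C1_disc[OF test])
  have "(nn_square lebesgue u)
      \<le> 2 * (nn_square lebesgue (\<lambda>x. \<phi> k x - u x)) + 2 * (nn_square lebesgue (\<phi> k))"
    by (rule nn_integral_square_le[OF u C1_disc_measurable_lebesgue(1)[OF C1]])
  also have "\<dots> \<le> 2 * 1 + 2 * ennreal (\<integral>x. (\<phi> k x)\<^sup>2 \<partial>lborel)"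
    using k by (intro add_mono mult_left_mono) (auto simp: C1_disc_nn_square[OF C1])
  also have "\<dots> < \<infinity>" by (auto simp: ennreal_mult_less_top)
  finally have "(nn_square lebesgue u) < \<infinity>" .
  then show "integrable lebesgue (\<lambda>x. (u x)\<^sup>2)" by (intro integrableI_nonneg) auto
qed

lemma fmeasurable_lebesgue_ball: "ball (x :: real^2) h \<in> lmeasurable"
  by simp

lemma set_integrable_lebesgue_ball:
  fixes u :: "real^2 \<Rightarrow> real"
  assumes [measurable]: "u \<in> borel_measurable lebesgue" and int: "integrable lebesgue (\<lambda>x. (u x)\<^sup>2)"
  shows "set_integrable lebesgue (ball x h) (\<lambda>z. (u z)\<^sup>2)" "set_integrable lebesgue (ball x h) u"
proof -
  show 1: "set_integrable lebesgue (ball x h) (\<lambda>z. (u z)\<^sup>2)"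
    unfolding set_integrable_def using integrable_mult_indicator[OF _ int, of "ball x h"] by simp
  have "integrable lebesgue (\<lambda>z. indicator (ball x h) z + (u z)\<^sup>2)"
    using fmeasurable_lebesgue_ball[of x h] by (intro Bochner_Integration.integrable_add int integrable_real_indicator) (auto simp: fmeasurable_def)
  then show "set_integrable lebesgue (ball x h) u" unfolding set_integrable_def
  proof (rule Bochner_Integration.integrable_bound)
    show "AE z in lebesgue. norm (indicator (ball x h) z *\<^sub>R u z) \<le> norm (indicator (ball x h) z + (u z)\<^sup>2)"
    proof (rule AE_I2)
      fix z
      have "0 \<le> (\<bar>u z\<bar> - 1)\<^sup>2 + \<bar>u z\<bar>\<^sup>2 + 1" by simp
      then have "\<bar>u z\<bar> \<le> 1 + (u z)\<^sup>2" by (simp add: power2_eq_square algebra_simps abs_mult_self)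
      then show "norm (indicator (ball x h) z *\<^sub>R u z) \<le> norm (indicator (ball x h) z + (u z)\<^sup>2)"
        by (auto split: split_indicator)
    qed
    show "(\<lambda>z. indicator (ball x h) z *\<^sub>R u z) \<in> borel_measurable lebesgue"
      by (intro borel_measurable_scaleR borel_measurable_indicator assms(1)) auto
  qed
qed

lemma ball_integral_le:
  fixes u :: "real^2 \<Rightarrow> real"
  assumes "u \<in> borel_measurable lebesgue" and int: "integrable lebesgue (\<lambda>x. (u x)\<^sup>2)"
  shows "\<bar>LINT z:ball x h|lebesgue. u z\<bar> \<le> sqrt (measure lebesgue (ball x h)) * sqrt (\<integral>z. (u z)\<^sup>2 \<partial>lebesgue)"
proof -
  have "(LINT z:ball x h|lebesgue. u z)\<^sup>2 \<le> measure lebesgue (ball x h) * (LINT z:ball x h|lebesgue. (u z)\<^sup>2)"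
    by (intro set_integral_cauchy_schwarz set_integrable_lebesgue_ball assms fmeasurable_lebesgue_ball)
  also have "\<dots> \<le> measure lebesgue (ball x h) * (\<integral>z. (u z)\<^sup>2 \<partial>lebesgue)"
  proof (rule mult_left_mono)
    show "(LINT z:ball x h|lebesgue. (u z)\<^sup>2) \<le> (\<integral>z. (u z)\<^sup>2 \<partial>lebesgue)"
      using set_integrable_lebesgue_ball(1)[OF assms, of x h] unfolding set_lebesgue_integral_def set_integrable_def
      by (intro integral_mono int) (auto split: split_indicator)
  qed simp
  finally have "sqrt ((LINT z:ball x h|lebesgue. u z)\<^sup>2) \<le> sqrt (measure lebesgue (ball x h) * (\<integral>z. (u z)\<^sup>2 \<partial>lebesgue))"
    by (rule real_sqrt_le_mono)
  then show ?thesis by (simp add: real_sqrt_mult)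
qed

text \<open>Weak convergence is tested only against these functionals; their values on \<phi> are
  the ball integrals that \<open>rellich\<close> consumes.\<close>

lemma H10_dual_ball_integral: "H10_dual (ball 0 1) (\<lambda>u. LINT z:ball x h|lebesgue. u z)"
  unfolding H10_dual_def
proof (intro conjI allI impI exI)
  fix u v :: "real^2 \<Rightarrow> real" and a b :: real
  assume "in_H10 (ball 0 1) u" "in_H10 (ball 0 1) v"
  then have "set_integrable lebesgue (ball x h) u" "set_integrable lebesgue (ball x h) v"
    by (auto intro!: set_integrable_lebesgue_ball in_H10_square_integrable)
  then show "(LINT z:ball x h|lebesgue. a * u z + b * v z) = a * (LINT z:ball x h|lebesgue. u z) + b * (LINT z:ball x h|lebesgue. v z)"
    by (subst set_integral_add(2)) auto
next
  fix u assume u: "in_H10 (ball 0 1) u"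
  have "\<bar>LINT z:ball x h|lebesgue. u z\<bar> \<le> sqrt (measure lebesgue (ball x h)) * sqrt (\<integral>z. (u z)\<^sup>2 \<partial>lebesgue)"
    by (intro ball_integral_le in_H10_square_integrable u)
  also have "\<dots> \<le> sqrt (measure lebesgue (ball x h)) * H1_norm (ball 0 1) u"
    unfolding H1_norm_def by (intro mult_left_mono real_sqrt_le_mono) auto
  finally show "\<bar>LINT z:ball x h|lebesgue. u z\<bar> \<le> sqrt (measure lebesgue (ball x h)) * H1_norm (ball 0 1) u" .
qed

lemma C1_disc_scale:
  assumes "C1_disc \<phi> G" shows "C1_disc (\<lambda>x. s * \<phi> x) (\<lambda>x. s *\<^sub>R G x)"
  unfolding C1_disc_def
proof (intro conjI allI impI)
  show "((\<lambda>x. s * \<phi> x) has_derivative (\<lambda>h. (s *\<^sub>R G x) \<bullet> h)) (at x)" for x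
  proof -
    have "(\<phi> has_derivative (\<lambda>h. G x \<bullet> h)) (at x)" using assms unfolding C1_disc_def by blast
    from has_derivative_mult_right[OF this, of s] show ?thesis by simp
  qed
  show "continuous_on UNIV (\<lambda>x. s *\<^sub>R G x)" by (intro continuous_intros C1_disc_continuous[OF assms])
  fix x assume "x \<notin> ball (0 :: real^2) 1"
  then show "s * \<phi> x = 0" "s *\<^sub>R G x = 0" using C1_disc_zero[OF assms] by auto
qed

text \<open>Serves twice: with varying \<open>u n\<close> it replaces a weakly convergent sequence
  by C1 functions, and with constant \<open>u n\<close> it approximates a single function.\<close>

lemma H10_approx_sequence:
  assumes H: "\<And>n. H10_grad (ball 0 1) (u n) (g n)"
    and energy: "\<And>n. (\<integral>\<^sup>+ x\<in>ball 0 1. ennreal ((norm (g n x))\<^sup>2) \<partial>lebesgue) \<le> 1"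
    and \<rho>: "\<And>n :: nat. 0 < \<rho> n"
  obtains \<phi> G where "\<And>n. C1_disc (\<phi> n) (G n)"
    "\<And>n. (dirichlet (ball 0 1) (G n)) \<le> 1 + \<rho> n"
    "\<And>n. (nn_square lebesgue (\<lambda>x. \<phi> n x - u n x)) \<le> ennreal (\<rho> n)"
    "\<And>n. integrable lebesgue (\<lambda>x. (\<phi> n x - u n x)\<^sup>2)"
    "\<And>n. (\<integral>x. (\<phi> n x - u n x)\<^sup>2 \<partial>lebesgue) \<le> \<rho> n"
proof -
  define Q where "Q n p \<longleftrightarrow> C1_disc (fst p) (snd p) \<and>
    (LINT x:ball 0 1|lborel. (norm (snd p x))\<^sup>2) \<le> 1 + \<rho> n \<and>
    (nn_square lebesgue (\<lambda>x. fst p x - u n x)) \<le> ennreal (\<rho> n)" for n p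
  have ex: "\<exists>p. Q n p" for n
  proof (rule H10_approx[OF H[of n] energy[of n] \<rho>[of n]])
    fix \<phi> G
    assume "C1_disc \<phi> G" "(dirichlet (ball 0 1) G) \<le> 1 + \<rho> n"
      "(nn_square lebesgue (\<lambda>x. \<phi> x - u n x)) \<le> ennreal (\<rho> n)"
    then have "Q n (\<phi>, G)" by (simp add: Q_def)
    then show "\<exists>p. Q n p" ..
  qed
  define p where "p n = (SOME p. Q n p)" for n
  have Q: "Q n (p n)" for n unfolding p_def by (rule someI_ex[OF ex])
  have C1: "C1_disc (fst (p n)) (snd (p n))" and close: "(nn_square lebesgue (\<lambda>x. fst (p n) x - u n x)) \<le> ennreal (\<rho> n)" for n
    using Q[of n] by (simp_all add: Q_def)
  have "u n \<in> borel_measurable lebesgue" for n using H[of n] unfolding H10_grad_def by blast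
  then have int: "integrable lebesgue (\<lambda>x. (fst (p n) x - u n x)\<^sup>2)" for n
    using close[of n] C1_disc_measurable_lebesgue(1)[OF C1]
    by (intro integrableI_nonneg borel_measurable_power borel_measurable_diff) (auto elim: le_less_trans)
  have le: "(\<integral>x. (fst (p n) x - u n x)\<^sup>2 \<partial>lebesgue) \<le> \<rho> n" for n
  proof -
    have "ennreal (\<integral>x. (fst (p n) x - u n x)\<^sup>2 \<partial>lebesgue) = (nn_square lebesgue (\<lambda>x. fst (p n) x - u n x))"
      by (intro nn_integral_eq_integral[symmetric] int) auto
    also note close[of n]
    finally show ?thesis using \<rho>[of n] by (subst (asm) ennreal_le_iff) auto
  qed
  show thesis
    using Q int le unfolding Q_def by (intro that[of "\<lambda>n. fst (p n)" "\<lambda>n. snd (p n)"]) blast+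
qed

text \<open>The approximants differ from \<open>u n\<close> by a vanishing amount in the mean
  square, so their ball integrals tend to 0 along with those of \<open>u n\<close>. Their energies
  are at most 2, \<open>rellich\<close> applies, and the conclusion passes back to
  \<open>u n\<close>.\<close>

lemma H10_weak_conv_imp_L2:
  assumes H: "\<And>n. H10_grad (ball 0 1) (u n) (g n)"
    and energy: "\<And>n. (\<integral>\<^sup>+ x\<in>ball 0 1. ennreal ((norm (g n x))\<^sup>2) \<partial>lebesgue) \<le> 1"
    and weak: "H10_weak_conv (ball 0 1) u (\<lambda>x. 0)"
  shows "(\<lambda>n. \<integral>\<^sup>+ x. ennreal ((u n x)\<^sup>2) \<partial>lebesgue) \<longlonglongrightarrow> 0"
proof -
  define \<rho> where "\<rho> n = inverse (real (Suc n))" for n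
  have \<rho>: "0 < \<rho> n" "\<rho> n \<le> 1" for n by (auto simp: \<rho>_def divide_simps)
  have \<rho>_lim: "\<rho> \<longlonglongrightarrow> 0" unfolding \<rho>_def by (rule LIMSEQ_inverse_real_of_nat)
  obtain \<phi> G where C1: "\<And>n. C1_disc (\<phi> n) (G n)"
    and en: "\<And>n. (dirichlet (ball 0 1) (G n)) \<le> 1 + \<rho> n"
    and close: "\<And>n. (nn_square lebesgue (\<lambda>x. \<phi> n x - u n x)) \<le> ennreal (\<rho> n)"
    and diff_int: "\<And>n. integrable lebesgue (\<lambda>x. (\<phi> n x - u n x)\<^sup>2)"
    and diff_le: "\<And>n. (\<integral>x. (\<phi> n x - u n x)\<^sup>2 \<partial>lebesgue) \<le> \<rho> n"
    by (rule H10_approx_sequence[OF H energy \<rho>(1)]) (rule that)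
  have in_H: "in_H10 (ball 0 1) (u n)" for n using H unfolding in_H10_def by blast
  note u_meas = in_H10_square_integrable(1)[OF in_H] and u_int = in_H10_square_integrable(2)[OF in_H]
  note \<phi>_meas = C1_disc_measurable_lebesgue(1)[OF C1]
  have diff_meas: "(\<lambda>x. \<phi> n x - u n x) \<in> borel_measurable lebesgue" for n
    by (intro borel_measurable_diff \<phi>_meas u_meas)
  have averages: "(\<lambda>n. LINT z:ball x h|lborel. \<phi> n z) \<longlonglongrightarrow> 0" for x :: "real^2" and h
  proof -
    have "(\<lambda>n. LINT z:ball x h|lebesgue. u n z) \<longlonglongrightarrow> (LINT z:ball x h|lebesgue. 0)"
      using weak H10_dual_ball_integral[of x h] unfolding H10_weak_conv_def by blast
    then have lim_u: "(\<lambda>n. LINT z:ball x h|lebesgue. u n z) \<longlonglongrightarrow> 0" by simp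
    have lim_d: "(\<lambda>n. LINT z:ball x h|lebesgue. \<phi> n z - u n z) \<longlonglongrightarrow> 0"
    proof (rule Lim_null_comparison)
      have "norm (LINT z:ball x h|lebesgue. \<phi> n z - u n z) \<le> sqrt (measure lebesgue (ball x h)) * sqrt (\<rho> n)" for n
        using ball_integral_le[OF diff_meas diff_int, of x h n]
          mult_left_mono[OF real_sqrt_le_mono[OF diff_le], of "sqrt (measure lebesgue (ball x h))" n] by simp
      then show "\<forall>\<^sub>F n in sequentially. norm (LINT z:ball x h|lebesgue. \<phi> n z - u n z) \<le> sqrt (measure lebesgue (ball x h)) * sqrt (\<rho> n)"
        by simp
      have "(\<lambda>n. sqrt (measure lebesgue (ball x h)) * sqrt (\<rho> n)) \<longlonglongrightarrow> sqrt (measure lebesgue (ball x h)) * sqrt 0"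
        by (intro tendsto_intros \<rho>_lim)
      then show "(\<lambda>n. sqrt (measure lebesgue (ball x h)) * sqrt (\<rho> n)) \<longlonglongrightarrow> 0" by simp
    qed
    have "(LINT z:ball x h|lborel. \<phi> n z) = (LINT z:ball x h|lebesgue. u n z) + (LINT z:ball x h|lebesgue. \<phi> n z - u n z)" for n
    proof -
      have "(LINT z:ball x h|lborel. \<phi> n z) = (LINT z:ball x h|lebesgue. \<phi> n z)"
        unfolding set_lebesgue_integral_def
        by (intro integral_completion[symmetric] borel_measurable_scaleR borel_measurable_indicator)
          (auto simp: C1_disc_measurable[OF C1])
      also have "\<dots> = (LINT z:ball x h|lebesgue. u n z + (\<phi> n z - u n z))" by simp
      also have "\<dots> = (LINT z:ball x h|lebesgue. u n z) + (LINT z:ball x h|lebesgue. \<phi> n z - u n z)"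
        by (rule set_integral_add(2)[OF set_integrable_lebesgue_ball(2)[OF u_meas u_int] set_integrable_lebesgue_ball(2)[OF diff_meas diff_int]])
      finally show ?thesis .
    qed
    then show ?thesis using tendsto_add[OF lim_u lim_d] by simp
  qed
  have "(\<lambda>n. \<integral>x. (\<phi> n x)\<^sup>2 \<partial>lborel) \<longlonglongrightarrow> 0"
  proof (rule rellich[OF C1 _ _ averages])
    fix n
    show "(nn_square lborel (\<lambda>x. norm (G n x))) \<le> ennreal 2"
      unfolding C1_disc_energy(2)[OF C1] using en[of n] \<rho>(2)[of n] by (intro ennreal_leI) simp
  qed simp
  then have "(\<lambda>n. 2 * \<rho> n + 2 * (\<integral>x. (\<phi> n x)\<^sup>2 \<partial>lborel)) \<longlonglongrightarrow> 2 * 0 + 2 * 0"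
    by (intro tendsto_intros \<rho>_lim)
  then have lim: "(\<lambda>n. ennreal (2 * \<rho> n + 2 * (\<integral>x. (\<phi> n x)\<^sup>2 \<partial>lborel))) \<longlonglongrightarrow> ennreal 0"
    by (intro tendsto_ennrealI) simp
  have le: "(nn_square lebesgue (u n)) \<le> ennreal (2 * \<rho> n + 2 * (\<integral>x. (\<phi> n x)\<^sup>2 \<partial>lborel))" for n
  proof -
    have "(nn_square lebesgue (u n))
        \<le> 2 * (nn_square lebesgue (\<lambda>x. \<phi> n x - u n x)) + 2 * (nn_square lebesgue (\<phi> n))"
      by (rule nn_integral_square_le[OF u_meas \<phi>_meas])
    also have "\<dots> \<le> 2 * ennreal (\<rho> n) + 2 * ennreal (\<integral>x. (\<phi> n x)\<^sup>2 \<partial>lborel)"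
      unfolding C1_disc_nn_square[OF C1] by (intro add_mono mult_left_mono close) auto
    also have "\<dots> = ennreal (2 * \<rho> n + 2 * (\<integral>x. (\<phi> n x)\<^sup>2 \<partial>lborel))"
      using \<rho>(1)[of n] by (subst ennreal_plus) (auto simp: ennreal_mult')
    finally show ?thesis .
  qed
  show ?thesis by (rule tendsto_sandwich[OF _ _ tendsto_const lim[unfolded ennreal_0]]) (use le in auto)
qed

text \<open>The exponential need not behave continuously under the approximation; lower
  semicontinuity is enough, since every rescaled approximant already satisfies the bound
  \<open>B\<close>.\<close>

lemma H10_moser_functional_le:
  fixes \<delta> :: real
  assumes H: "H10_grad (ball 0 1) u g"
    and energy: "(\<integral>\<^sup>+ x\<in>ball 0 1. ennreal ((norm (g x))\<^sup>2) \<partial>lebesgue) \<le> 1"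
    and \<delta>: "0 < \<delta>" and small: "(nn_square lebesgue u) \<le> ennreal (\<delta> / 4)"
    and smooth: "\<And>\<phi> G. C1_disc \<phi> G \<Longrightarrow> (dirichlet (ball 0 1) G) \<le> 1 \<Longrightarrow>
        (\<integral>x. (\<phi> x)\<^sup>2 \<partial>lborel) \<le> \<delta> \<Longrightarrow>
        (\<integral>\<^sup>+ x\<in>ball 0 1. ennreal (w x * exp (c * (\<phi> x)\<^sup>2)) \<partial>lborel) \<le> B"
    and w: "w \<in> borel_measurable borel"
  shows "(\<integral>\<^sup>+ x\<in>ball 0 1. ennreal (w x * exp (c * (u x)\<^sup>2)) \<partial>lebesgue) \<le> B"
proof -
  define \<rho> where "\<rho> n = inverse (real (Suc n))" for n
  have \<rho>: "0 < \<rho> n" for n by (auto simp: \<rho>_def)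
  have \<rho>_lim: "\<rho> \<longlonglongrightarrow> 0" unfolding \<rho>_def by (rule LIMSEQ_inverse_real_of_nat)
  obtain \<phi> G where C1: "\<And>n. C1_disc (\<phi> n) (G n)"
    and en: "\<And>n. (dirichlet (ball 0 1) (G n)) \<le> 1 + \<rho> n"
    and close: "\<And>n. (nn_square lebesgue (\<lambda>x. \<phi> n x - u x)) \<le> ennreal (\<rho> n)"
    and diff_int: "\<And>n. integrable lebesgue (\<lambda>x. (\<phi> n x - u x)\<^sup>2)"
    and diff_le: "\<And>n. (\<integral>x. (\<phi> n x - u x)\<^sup>2 \<partial>lebesgue) \<le> \<rho> n"
    by (rule H10_approx_sequence[OF H energy \<rho>]) (rule that)
  have u_meas [measurable]: "u \<in> borel_measurable lebesgue" using H unfolding H10_grad_def by blast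
  note \<phi>_meas [measurable] = C1_disc_measurable_lebesgue(1)[OF C1]
  have "(\<lambda>n. \<integral>x. norm ((\<phi> n x - u x)\<^sup>2) \<partial>lebesgue) \<longlonglongrightarrow> 0"
    by (rule tendsto_sandwich[OF _ _ tendsto_const \<rho>_lim]) (use diff_le in auto)
  \<comment> \<open>Mean square convergence yields convergence almost everywhere only along a
    subsequence.\<close>
  from tendsto_L1_AE_subseq[OF diff_int this] obtain r where r: "strict_mono r"
    and AE_sq: "AE x in lebesgue. (\<lambda>n. (\<phi> (r n) x - u x)\<^sup>2) \<longlonglongrightarrow> 0" by blast
  \<comment> \<open>Rescaling restores energy at most 1, does not increase the mean square, and
    disappears in the limit.\<close>
  define s where "s n = 1 / sqrt (1 + \<rho> n)" for n
  have s: "0 < s n" "s n \<le> 1" "(s n)\<^sup>2 * (1 + \<rho> n) = 1" for n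
    using \<rho>[of n] by (auto simp: s_def power_divide)
  have s_lim: "s \<longlonglongrightarrow> 1"
  proof -
    have "s \<longlonglongrightarrow> 1 / sqrt (1 + 0)" unfolding s_def by (intro tendsto_intros \<rho>_lim) auto
    then show ?thesis by simp
  qed
  define F where "F n x = ennreal (w x * exp (c * (s n * \<phi> n x)\<^sup>2)) * indicator (ball 0 1) x" for n x
  have ev: "\<forall>\<^sub>F n in sequentially. integral\<^sup>N lebesgue (F n) \<le> B"
  proof -
    \<comment> \<open>The quarter accounts for
      \<open>(a + b)\<^sup>2 \<le> 2 * a\<^sup>2 + 2 * b\<^sup>2\<close>: two contributions of at
      most \<open>\<delta> / 4\<close>, each doubled, stay within \<open>\<delta>\<close>.\<close>
    have "\<forall>\<^sub>F n in sequentially. \<rho> n < \<delta> / 4" by (rule order_tendstoD(2)[OF \<rho>_lim]) (use \<delta> in simp)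
    then show ?thesis
    proof eventually_elim
      case (elim n)
      let ?\<psi> = "\<lambda>x. s n * \<phi> n x" and ?H = "\<lambda>x. s n *\<^sub>R G n x"
      have C1': "C1_disc ?\<psi> ?H" by (rule C1_disc_scale[OF C1])
      have "(LINT x:ball 0 1|lborel. (norm (?H x))\<^sup>2) = (s n)\<^sup>2 * (dirichlet (ball 0 1) (G n))"
        by (simp add: power_mult_distrib)
      also have "\<dots> \<le> (s n)\<^sup>2 * (1 + \<rho> n)" by (intro mult_left_mono en) auto
      finally have E: "(LINT x:ball 0 1|lborel. (norm (?H x))\<^sup>2) \<le> 1" using s(3) by simp
      have "ennreal (\<integral>x. (\<phi> n x)\<^sup>2 \<partial>lborel) = (nn_square lebesgue (\<phi> n))" by (rule C1_disc_nn_square[OF C1, symmetric])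
      also have "\<dots> \<le> 2 * (nn_square lebesgue (\<lambda>x. u x - \<phi> n x)) + 2 * (nn_square lebesgue u)"
        by (rule nn_integral_square_le[OF \<phi>_meas u_meas])
      also have "(\<lambda>x. ennreal ((u x - \<phi> n x)\<^sup>2)) = (\<lambda>x. ennreal ((\<phi> n x - u x)\<^sup>2))" by (simp add: power2_commute)
      also have "2 * (nn_square lebesgue (\<lambda>x. \<phi> n x - u x)) + 2 * (nn_square lebesgue u)
          \<le> 2 * ennreal (\<rho> n) + 2 * ennreal (\<delta> / 4)"
        by (intro add_mono mult_left_mono close small) auto
      also have "\<dots> = ennreal (2 * \<rho> n + 2 * (\<delta> / 4))"
        using \<rho>[of n] \<delta> by (simp only: ennreal_plus ennreal_mult' ennreal_numeral mult_nonneg_nonneg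
            zero_le_numeral less_imp_le divide_pos_pos zero_less_numeral)
      finally have "(\<integral>x. (\<phi> n x)\<^sup>2 \<partial>lborel) \<le> 2 * \<rho> n + 2 * (\<delta> / 4)"
        using \<rho>[of n] \<delta> by (subst (asm) ennreal_le_iff) auto
      then have L: "(\<integral>x. (\<phi> n x)\<^sup>2 \<partial>lborel) \<le> \<delta>" using elim by simp
      have "(\<integral>x. (?\<psi> x)\<^sup>2 \<partial>lborel) = (s n)\<^sup>2 * (\<integral>x. (\<phi> n x)\<^sup>2 \<partial>lborel)" by (simp add: power_mult_distrib)
      also have "\<dots> \<le> 1 * (\<integral>x. (\<phi> n x)\<^sup>2 \<partial>lborel)"
        using s(1,2)[of n] by (intro mult_right_mono) (auto simp: power_le_one)
      finally have "(\<integral>x. (?\<psi> x)\<^sup>2 \<partial>lborel) \<le> \<delta>" using L by simp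
      from smooth[OF C1' E this] show ?case unfolding F_def nn_integral_completion .
    qed
  qed
  have w' : "w \<in> borel_measurable lebesgue" using w by (auto intro: measurable_completion)
  have F_meas: "F n \<in> borel_measurable lebesgue" for n
    unfolding F_def using w' by (intro borel_measurable_times_ennreal borel_measurable_indicator) auto
  have "(\<integral>\<^sup>+ x\<in>ball 0 1. ennreal (w x * exp (c * (u x)\<^sup>2)) \<partial>lebesgue) = (\<integral>\<^sup>+ x. liminf (\<lambda>n. F (r n) x) \<partial>lebesgue)"
  proof (rule nn_integral_cong_AE)
    show "AE x in lebesgue. ennreal (w x * exp (c * (u x)\<^sup>2)) * indicator (ball 0 1) x = liminf (\<lambda>n. F (r n) x)"
      using AE_sq
    proof eventually_elim
      case (elim x)
      have "(\<lambda>n. sqrt ((\<phi> (r n) x - u x)\<^sup>2)) \<longlonglongrightarrow> sqrt 0" using elim by (rule tendsto_real_sqrt)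
      then have "(\<lambda>n. \<phi> (r n) x - u x) \<longlonglongrightarrow> 0" by (simp add: tendsto_rabs_zero_iff)
      then have "(\<lambda>n. \<phi> (r n) x) \<longlonglongrightarrow> u x" by (simp add: LIM_zero_iff)
      moreover have "(\<lambda>n. s (r n)) \<longlonglongrightarrow> 1" using LIMSEQ_subseq_LIMSEQ[OF s_lim r] by (simp add: o_def)
      ultimately have "(\<lambda>n. w x * exp (c * (s (r n) * \<phi> (r n) x)\<^sup>2)) \<longlonglongrightarrow> w x * exp (c * (1 * u x)\<^sup>2)"
        by (intro tendsto_intros)
      then have "(\<lambda>n. ennreal (w x * exp (c * (s (r n) * \<phi> (r n) x)\<^sup>2))) \<longlonglongrightarrow> ennreal (w x * exp (c * (u x)\<^sup>2))"
        by (intro tendsto_ennrealI) simp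
      then have "(\<lambda>n. F (r n) x) \<longlonglongrightarrow> ennreal (w x * exp (c * (u x)\<^sup>2)) * indicator (ball 0 1) x"
        unfolding F_def by (cases "x \<in> ball 0 1") auto
      then show ?case by (intro lim_imp_Liminf[symmetric]) auto
    qed
  qed
  \<comment> \<open>Fatou's lemma.\<close>
  also have "\<dots> \<le> liminf (\<lambda>n. integral\<^sup>N lebesgue (F (r n)))"
    by (rule nn_integral_liminf[OF F_meas])
  also have "\<dots> \<le> limsup (\<lambda>n. integral\<^sup>N lebesgue (F (r n)))" by (rule Liminf_le_Limsup) simp
  also have "\<dots> \<le> B" by (rule Limsup_bounded[OF eventually_subseq[OF r ev]])
  finally show ?thesis .
qed

theorem theorem1p1:
  fixes \<alpha> :: real and u :: "nat \<Rightarrow> real^2 \<Rightarrow> real" and g :: "nat \<Rightarrow> real^2 \<Rightarrow> real^2"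
  assumes "-1 < \<alpha>" and "\<alpha> \<le> 0"
    and "\<And>n. H10_grad (ball 0 1) (u n) (g n)"
    and "\<And>n. (\<integral>\<^sup>+ x \<in> ball 0 1. ennreal ((norm (g n x))^2) \<partial>lebesgue) \<le> 1"
    and "H10_weak_conv (ball 0 1) u (\<lambda>x. 0)"
  shows "limsup (\<lambda>n. \<integral>\<^sup>+ x \<in> ball 0 1.
            ennreal (norm x powr (2 * \<alpha>) * exp (4 * pi * (1 + \<alpha>) * (u n x)^2)) \<partial>lebesgue)
         \<le> ennreal (pi * (1 + exp 1) / (1 + \<alpha>))"
proof (rule ennreal_le_epsilon)
  fix \<epsilon> :: real assume \<epsilon>: "0 < \<epsilon>"
  \<comment> \<open>Undoes the factor \<open>pi / (1 + \<alpha>)\<close> in front of the bound for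
    C1 functions.\<close>
  define \<epsilon>' where "\<epsilon>' = \<epsilon> * (1 + \<alpha>) / pi"
  have \<epsilon>': "0 < \<epsilon>'" using \<epsilon> assms(1) by (simp add: \<epsilon>'_def)
  obtain \<delta> where \<delta>: "0 < \<delta>" and smooth: "\<And>\<phi> G. C1_disc \<phi> G \<Longrightarrow> (dirichlet (ball 0 1) G) \<le> 1 \<Longrightarrow>
    (\<integral>x. (\<phi> x)\<^sup>2 \<partial>lborel) \<le> \<delta> \<Longrightarrow>
    (\<integral>\<^sup>+ x\<in>ball 0 1. ennreal (norm x powr (2 * \<alpha>) * exp (4 * pi * (1 + \<alpha>) * (\<phi> x)\<^sup>2)) \<partial>lborel)
      \<le> ennreal (pi / (1 + \<alpha>) * (1 + exp 1 + \<epsilon>'))"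
    by (rule moser_functional_small_L2[OF assms(1,2) \<epsilon>']) (rule that)
  have "\<forall>\<^sub>F n in sequentially. (nn_square lebesgue (u n)) < ennreal (\<delta> / 4)"
    using H10_weak_conv_imp_L2[OF assms(3-5)] by (rule order_tendstoD(2)) (use \<delta> in simp)
  then have "\<forall>\<^sub>F n in sequentially. (\<integral>\<^sup>+ x \<in> ball 0 1.
      ennreal (norm x powr (2 * \<alpha>) * exp (4 * pi * (1 + \<alpha>) * (u n x)^2)) \<partial>lebesgue)
      \<le> ennreal (pi / (1 + \<alpha>) * (1 + exp 1 + \<epsilon>'))"
  proof eventually_elim
    case (elim n)
    show ?case by (rule H10_moser_functional_le[OF assms(3,4) \<delta> less_imp_le[OF elim] smooth]) auto
  qed
  then have "limsup (\<lambda>n. \<integral>\<^sup>+ x \<in> ball 0 1.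
      ennreal (norm x powr (2 * \<alpha>) * exp (4 * pi * (1 + \<alpha>) * (u n x)^2)) \<partial>lebesgue)
      \<le> ennreal (pi / (1 + \<alpha>) * (1 + exp 1 + \<epsilon>'))"
    by (rule Limsup_bounded)
  also have "pi / (1 + \<alpha>) * (1 + exp 1 + \<epsilon>') = pi * (1 + exp 1) / (1 + \<alpha>) + \<epsilon>"
  proof -
    have "pi / (1 + \<alpha>) * \<epsilon>' = \<epsilon>" using assms(1) by (simp add: \<epsilon>'_def)
    then show ?thesis by (simp add: distrib_left add_divide_distrib)
  qed
  also have "ennreal (pi * (1 + exp 1) / (1 + \<alpha>) + \<epsilon>) = ennreal (pi * (1 + exp 1) / (1 + \<alpha>)) + ennreal \<epsilon>"
    using assms(1) \<epsilon> by (intro ennreal_plus) (auto intro!: divide_nonneg_pos mult_nonneg_nonneg add_nonneg_nonneg)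
  finally show "limsup (\<lambda>n. \<integral>\<^sup>+ x \<in> ball 0 1.
      ennreal (norm x powr (2 * \<alpha>) * exp (4 * pi * (1 + \<alpha>) * (u n x)^2)) \<partial>lebesgue)
      \<le> ennreal (pi * (1 + exp 1) / (1 + \<alpha>)) + ennreal \<epsilon>" .
qed

end
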